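(* Let $1\le p<2<u\le\infty$, $1\le p_1\le\infty$ and $\alpha>1$, and let $X$ and $I:X\to\mathbb{K}$ be the space and operator defined in the context. Then there are constants $c_1,\dots,c_6>0$ and $n_0\in\mathbb{N}$ such that for all $n\ge n_0$ $$c_1n^{-\alpha/2+1/(2p)+1/(2u)-1}+c_1n^{-\alpha/2-1/2}\le e_n^{\mathrm{ran}}(I,B_X)\le c_2n^{-\alpha/2+1/(2p)+1/(2u)-1}(\log(n+1))^{1-1/u}+c_2n^{-\alpha/2-1/2}(\log(n+1))^{1/2},$$ $$c_3n^{-\alpha/2+1/(2p)-3/4}\le e_n^{\mathrm{ran-non}}(I,B_X)\le c_4n^{-\alpha/2+1/(2p)-3/4},$$ $$c_5n^{-\alpha/2}\le e_n^{\mathrm{det}}(I,B_X)\le e_n^{\mathrm{det-non}}(I,B_X)\le c_6n^{-\alpha/2}.$$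
   Context: $\mathbb{N}=\{1,2,\dots\}$, $\mathbb{N}_0=\mathbb{N}\cup\{0\}$, $\mathbb{K}\in\{\mathbb{R},\mathbb{C}\}$, $\log=\log_2$, $1/\infty=0$, $B_X$ is the closed unit ball of a normed space $X$. Spaces and problem. For $N\in\mathbb{N}$, $1\le p\le\infty$, $L_p^N$ is the space of functions $f:\{1,\dots,N\}\to\mathbb{K}$ with norm $\big(\frac1N\sum_{i=1}^N|f(i)|^p\big)^{1/p}$ if $p<\infty$ and $\max_i|f(i)|$ if $p=\infty$. $L_p^{N_1}(L_u^{N_2})$ is the space of all $f:\{1,\dots,N_1\}\times\{1,\dots,N_2\}\to\mathbb{K}$ with norm $\big\|(\|f_i\|_{L_u^{N_2}})_{i=1}^{N_1}\big\|_{L_p^{N_1}}$, where $f_i=(f(i,j))_{j=1}^{N_2}$. The mean operator is $I^{N_1,N_2}f=\frac1{N_1N_2}\sum_{i=1}^{N_1}\sum_{j=1}^{N_2}f(i,j)$. Put $N_k=2^k$ for $k\in\mathbb{N}_0$. $X=\big(\bigoplus_{k=0}^\infty L_p^{N_k}(L_u^{N_k})\big)_{\ell_{p_1}}$ is the space of sequences $(f_k)_{k=0}^\infty$, $f_k\in L_p^{N_k}(L_u^{N_k})$, with finite norm $\big\|(\|f_k\|)_{k=0}^\infty\big\|_{\ell_{p_1}}$, and $$I:X\to\mathbb{K},\qquad I\big((f_k)_{k=0}^\infty\big)=\sum_{k=0}^\infty2^{-\alpha k}I^{N_k,N_k}f_k.$$ The numerical problem considered is $(B_X,\mathbb{K},I,\mathbb{K},\Lambda)$,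 where $\Lambda$ consists of all functionals $(f_l)_{l=0}^\infty\mapsto f_k(i,j)$ with $k\in\mathbb{N}_0$, $1\le i,j\le N_k$ (standard information). Algorithms and minimal errors. A numerical problem is a tuple $(F,G,S,K,\Lambda)$: $F$ a nonempty set, $G$ a Banach space, $S:F\to G$ a map, $K$ a nonempty set, $\Lambda$ a nonempty set of maps $F\to K$. A deterministic algorithm is a tuple $A=((L_i)_{i\ge1},(\tau_i)_{i\ge0},(\varphi_i)_{i\ge0})$ with $L_1\in\Lambda$, $\tau_0\in\{0,1\}$, $\varphi_0\in G$ and arbitrary maps $L_{i+1}:K^i\to\Lambda$, $\tau_i:K^i\to\{0,1\}$, $\varphi_i:K^i\to G$ $(i\ge1)$. For $f\in F$ let $\lambda_1=L_1$, $\lambda_i=L_i(\lambda_1(f),\dots,\lambda_{i-1}(f))$ $(i\ge2)$. $\mathrm{card}(A,f)$ is the smallest $n\ge0$ with $\tau_n(\lambda_1(f),\dots,\lambda_n(f))=1$ (for $n=0$: $\tau_0=1$), and $\infty$ if there is none. The output is $A(f)=\varphi_n(\lambda_1(f),\dots,\lambda_n(f))$ if $n=\mathrm{card}(A,f)<\infty$ (with $A(f)=\varphi_0$ for $n=0$) and $A(f)=\varphi_0$ if $\mathrm{card}(A,f)=\infty$. $A$ is non-adaptive if all $L_i$ and all $\tau_i$ are constant. For $n\in\mathbb{N}_0$, $e_n^{\mathrm{det}}(S,F,G)$ (resp. $e_n^{\mathrm{det-non}}(S,F,G)$) is the infimum of $\sup_{f\in F}\|S(f)-A(f)\|_G$ over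 all (resp. all non-adaptive) deterministic algorithms with $\sup_{f\in F}\mathrm{card}(A,f)\le n$. A randomized algorithm is $A=((\Omega,\Sigma,\mathbb{P}),(A_\omega)_{\omega\in\Omega})$ with $(\Omega,\Sigma,\mathbb{P})$ a probability space and each $A_\omega$ a deterministic algorithm, such that for every $f\in F$ the map $\omega\mapsto\mathrm{card}(A_\omega,f)$ is measurable and $\omega\mapsto A_\omega(f)$ is Borel measurable and almost surely separably valued; it is non-adaptive if every $A_\omega$ is. $e_n^{\mathrm{ran}}(S,F,G)$ (resp. $e_n^{\mathrm{ran-non}}(S,F,G)$) is the infimum of $\sup_{f\in F}\mathbb{E}\|S(f)-A_\omega(f)\|_G$ over all (resp. all non-adaptive) randomized algorithms with $\sup_{f\in F}\mathbb{E}\,\mathrm{card}(A_\omega,f)\le n$. If $G=\mathbb{K}$, $G$ is omitted from the notation. *)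

theory Defs
  imports "HOL-Probability.Probability"
begin

section \<open>Deterministic and randomized algorithms\<close>

text \<open>
  A tuple of values in \<open>K\<^sup>i\<close> is a list of length \<open>i\<close>, so the whole sequences
  \<open>(L\<^sub>i)\<close> (\<open>i \<ge> 1\<close>), \<open>(\<tau>\<^sub>i)\<close>, \<open>(\<phi>\<^sub>i)\<close> (\<open>i \<ge> 0\<close>) become single functions on lists:
  \<open>L\<^sub>i\<^sub>+\<^sub>1\<close>, \<open>\<tau>\<^sub>i\<close> and \<open>\<phi>\<^sub>i\<close> are the restrictions of \<open>query\<close>, \<open>stop\<close> and \<open>result\<close>
  to lists of length \<open>i\<close>. The sets \<open>K\<close> and \<open>G\<close> are the types \<open>'k\<close> and \<open>'g\<close>.
\<close>

record ('f, 'k, 'g) det_alg =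
  query :: "'k list \<Rightarrow> 'f \<Rightarrow> 'k"
  stop :: "'k list \<Rightarrow> bool"
  result :: "'k list \<Rightarrow> 'g"

definition det_algorithm :: "('f \<Rightarrow> 'k) set \<Rightarrow> ('f, 'k, 'g) det_alg \<Rightarrow> bool" where
  "det_algorithm \<Lambda> A \<longleftrightarrow> (\<forall>xs. query A xs \<in> \<Lambda>)"

definition nonadaptive :: "('f, 'k, 'g) det_alg \<Rightarrow> bool" where
  "nonadaptive A \<longleftrightarrow>
     (\<forall>xs ys. length xs = length ys \<longrightarrow> query A xs = query A ys \<and> stop A xs = stop A ys)"

text \<open>\<open>info A f n\<close> is the list \<open>[\<lambda>\<^sub>1(f), \<dots>, \<lambda>\<^sub>n(f)]\<close>.\<close>

primrec info :: "('f, 'k, 'g) det_alg \<Rightarrow> 'f \<Rightarrow> nat \<Rightarrow> 'k list" where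
  "info A f 0 = []"
| "info A f (Suc n) = info A f n @ [query A (info A f n) f]"

definition alg_card :: "('f, 'k, 'g) det_alg \<Rightarrow> 'f \<Rightarrow> enat" where
  "alg_card A f =
     (if \<exists>n. stop A (info A f n) then enat (LEAST n. stop A (info A f n)) else \<infinity>)"

definition alg_out :: "('f, 'k, 'g) det_alg \<Rightarrow> 'f \<Rightarrow> 'g" where
  "alg_out A f =
     (case alg_card A f of enat n \<Rightarrow> result A (info A f n) | \<infinity> \<Rightarrow> result A [])"

definition det_error :: "'f set \<Rightarrow> ('f \<Rightarrow> 'g::real_normed_vector) \<Rightarrow> ('f, 'k, 'g) det_alg \<Rightarrow> ennreal" where
  "det_error F S A = (SUP f\<in>F. ennreal (norm (S f - alg_out A f)))"

definition e_det ::
  "'f set \<Rightarrow> ('f \<Rightarrow> 'g::banach) \<Rightarrow> ('f \<Rightarrow> 'k) set \<Rightarrow> nat \<Rightarrow> ennreal" where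
  "e_det F S \<Lambda> n =
     (INF A\<in>{A. det_algorithm \<Lambda> A \<and> (SUP f\<in>F. alg_card A f) \<le> enat n}. det_error F S A)"

definition e_det_non ::
  "'f set \<Rightarrow> ('f \<Rightarrow> 'g::banach) \<Rightarrow> ('f \<Rightarrow> 'k) set \<Rightarrow> nat \<Rightarrow> ennreal" where
  "e_det_non F S \<Lambda> n =
     (INF A\<in>{A. det_algorithm \<Lambda> A \<and> nonadaptive A \<and> (SUP f\<in>F. alg_card A f) \<le> enat n}.
        det_error F S A)"

definition ran_algorithm ::
  "'f set \<Rightarrow> ('f \<Rightarrow> 'k) set \<Rightarrow> 'w measure \<Rightarrow> ('w \<Rightarrow> ('f, 'k, 'g::banach) det_alg) \<Rightarrow> bool" where
  "ran_algorithm F \<Lambda> M A \<longleftrightarrow>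
     prob_space M \<and>
     (\<forall>\<omega>\<in>space M. det_algorithm \<Lambda> (A \<omega>)) \<and>
     (\<forall>f\<in>F. (\<lambda>\<omega>. alg_card (A \<omega>) f) \<in> M \<rightarrow>\<^sub>M count_space UNIV \<and>
            (\<lambda>\<omega>. alg_out (A \<omega>) f) \<in> borel_measurable M \<and>
            (\<exists>D. countable D \<and> (AE \<omega> in M. alg_out (A \<omega>) f \<in> closure D)))"

definition ran_card :: "'f set \<Rightarrow> 'w measure \<Rightarrow> ('w \<Rightarrow> ('f, 'k, 'g) det_alg) \<Rightarrow> ennreal" where
  "ran_card F M A = (SUP f\<in>F. \<integral>\<^sup>+\<omega>. ennreal_of_enat (alg_card (A \<omega>) f) \<partial>M)"

definition ran_error ::
  "'f set \<Rightarrow> ('f \<Rightarrow> 'g::real_normed_vector) \<Rightarrow> 'w measure \<Rightarrow> ('w \<Rightarrow> ('f, 'k, 'g) det_alg) \<Rightarrow> ennreal" where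
  "ran_error F S M A = (SUP f\<in>F. \<integral>\<^sup>+\<omega>. ennreal (norm (S f - alg_out (A \<omega>) f)) \<partial>M)"

text \<open>
  The infimum below should range over probability spaces on arbitrary sets, which a single
  term cannot express. It ranges over all probability spaces whose points are of type
  \<open>det_alg\<close>. Nothing is lost: pushing the probability measure of an arbitrary randomized
  algorithm forward along \<open>\<omega> \<mapsto> A\<^sub>\<omega>\<close> gives a randomized algorithm of this kind with the same
  cardinality and error. This is shown in \<open>e_ran_le\<close> and \<open>e_ran_non_le\<close>, where the
  type \<open>'w\<close> of sample points is arbitrary.
\<close>

definition e_ran ::
  "'f set \<Rightarrow> ('f \<Rightarrow> 'g::banach) \<Rightarrow> ('f \<Rightarrow> 'k) set \<Rightarrow> nat \<Rightarrow> ennreal" where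
  "e_ran F S \<Lambda> n =
     (INF (M, A)\<in>{(M :: ('f, 'k, 'g) det_alg measure, A).
                    ran_algorithm F \<Lambda> M A \<and> ran_card F M A \<le> of_nat n}.
        ran_error F S M A)"

definition e_ran_non ::
  "'f set \<Rightarrow> ('f \<Rightarrow> 'g::banach) \<Rightarrow> ('f \<Rightarrow> 'k) set \<Rightarrow> nat \<Rightarrow> ennreal" where
  "e_ran_non F S \<Lambda> n =
     (INF (M, A)\<in>{(M :: ('f, 'k, 'g) det_alg measure, A).
                    ran_algorithm F \<Lambda> M A \<and> (\<forall>\<omega>\<in>space M. nonadaptive (A \<omega>)) \<and>
                    ran_card F M A \<le> of_nat n}.
        ran_error F S M A)"

lemma ran_algorithm_push_forward:
  fixes M :: "'w measure" and A :: "'w \<Rightarrow> ('f, 'k, 'g::banach) det_alg"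
  assumes "ran_algorithm F \<Lambda> M A"
  obtains M' :: "('f, 'k, 'g) det_alg measure" where
    "space M' = A ` space M" "ran_algorithm F \<Lambda> M' (\<lambda>B. B)"
    "ran_card F M' (\<lambda>B. B) = ran_card F M A"
    "\<And>S. ran_error F S M' (\<lambda>B. B) = ran_error F S M A"
proof -
  interpret M: prob_space M
    using assms by (simp add: ran_algorithm_def)
  define \<X> where "\<X> = {B. B \<subseteq> A ` space M \<and> A -` B \<inter> space M \<in> sets M}"
  interpret X: sigma_algebra "A ` space M" \<X>
    unfolding sigma_algebra_iff2
  proof (intro conjI allI ballI impI)
    show "\<X> \<subseteq> Pow (A ` space M)" by (auto simp: \<X>_def)
    show "{} \<in> \<X>" by (auto simp: \<X>_def)
    fix B assume B: "B \<in> \<X>"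
    have "A -` (A ` space M - B) \<inter> space M = space M - (A -` B \<inter> space M)" by auto
    then show "A ` space M - B \<in> \<X>" using B by (auto simp: \<X>_def)
  next
    fix B :: "nat \<Rightarrow> _" assume B: "range B \<subseteq> \<X>"
    have "A -` (\<Union>i. B i) \<inter> space M = (\<Union>i. A -` B i \<inter> space M)" by auto
    moreover have "(\<Union>i. A -` B i \<inter> space M) \<in> sets M"
      using B by (intro sets.countable_nat_UN) (auto simp: \<X>_def)
    ultimately show "(\<Union>i. B i) \<in> \<X>" using B unfolding \<X>_def by (simp add: UN_subset_iff image_subset_iff)
  qed
  define N where "N = sigma (A ` space M) \<X>"
  have spN: "space N = A ` space M" and seN: "sets N = \<X>"
    using X.sigma_sets_eq X.space_closed by (auto simp: N_def space_measure_of_conv)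
  have A: "A \<in> M \<rightarrow>\<^sub>M N"
    by (rule measurableI) (auto simp: spN seN \<X>_def)
  define M' where "M' = distr M N A"
  have factor: "h \<in> M' \<rightarrow>\<^sub>M T" if "(\<lambda>\<omega>. h (A \<omega>)) \<in> M \<rightarrow>\<^sub>M T" for h and T :: "'t measure"
  proof (rule measurableI)
    fix B assume "B \<in> space M'"
    then show "h B \<in> space T" using measurable_space[OF that] by (auto simp: M'_def spN)
  next
    fix C assume "C \<in> sets T"
    from measurable_sets[OF that this]
    have "A -` (h -` C \<inter> A ` space M) \<inter> space M \<in> sets M"
      by (rule back_subst[where P = "\<lambda>x. x \<in> sets M"]) auto
    then show "h -` C \<inter> space M' \<in> sets M'"
      by (auto simp: M'_def spN seN \<X>_def)
  qed
  have integral: "(\<integral>\<^sup>+B. h B \<partial>M') = (\<integral>\<^sup>+\<omega>. h (A \<omega>) \<partial>M)"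
    if "(\<lambda>\<omega>. h (A \<omega>)) \<in> borel_measurable M" for h
    unfolding M'_def using factor[OF that] by (intro nn_integral_distr A) (simp add: M'_def)
  have meas: "(\<lambda>\<omega>. alg_card (A \<omega>) f) \<in> M \<rightarrow>\<^sub>M count_space UNIV"
    "(\<lambda>\<omega>. alg_out (A \<omega>) f) \<in> borel_measurable M" if "f \<in> F" for f
    using assms that by (auto simp: ran_algorithm_def)
  have "ran_algorithm F \<Lambda> M' (\<lambda>B. B)"
    unfolding ran_algorithm_def
  proof (intro conjI ballI)
    show "prob_space M'" unfolding M'_def by (rule M.prob_space_distr[OF A])
  next
    fix B assume "B \<in> space M'"
    then show "det_algorithm \<Lambda> B" using assms by (auto simp: ran_algorithm_def M'_def spN)
  next
    fix f assume f: "f \<in> F"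
    show "(\<lambda>B. alg_card B f) \<in> M' \<rightarrow>\<^sub>M count_space UNIV" by (rule factor[OF meas(1)[OF f]])
    show out: "(\<lambda>B. alg_out B f) \<in> borel_measurable M'" by (rule factor[OF meas(2)[OF f]])
    obtain D where D: "countable D" "AE \<omega> in M. alg_out (A \<omega>) f \<in> closure D"
      using assms f unfolding ran_algorithm_def by blast
    have "{B \<in> space N. alg_out B f \<in> closure D} \<in> sets N"
      using measurable_sets[OF out, of "closure D"]
      by (simp add: M'_def vimage_def Int_def conj_commute)
    then have "AE B in M'. alg_out B f \<in> closure D"
      unfolding M'_def using D(2) by (subst AE_distr_iff[OF A])
    with D(1) show "\<exists>D. countable D \<and> (AE B in M'. alg_out B f \<in> closure D)" by blast
  qed
  moreover have "ran_card F M' (\<lambda>B. B) = ran_card F M A"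
    unfolding ran_card_def
  proof (intro SUP_cong refl integral)
    fix f assume "f \<in> F"
    show "(\<lambda>\<omega>. ennreal_of_enat (alg_card (A \<omega>) f)) \<in> borel_measurable M"
      by (rule measurable_compose[OF meas(1)[OF \<open>f \<in> F\<close>]]) simp
  qed
  moreover have "ran_error F S M' (\<lambda>B. B) = ran_error F S M A" for S
    unfolding ran_error_def
  proof (intro SUP_cong refl integral)
    fix f assume "f \<in> F"
    have "(\<lambda>g. ennreal (norm (S f - g))) \<in> borel_measurable borel"
      by (intro borel_measurable_continuous_onI continuous_on_ennreal continuous_intros)
    then show "(\<lambda>\<omega>. ennreal (norm (S f - alg_out (A \<omega>) f))) \<in> borel_measurable M"
      by (rule measurable_compose[OF meas(2)[OF \<open>f \<in> F\<close>]])
  qed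
  ultimately show ?thesis
    by (intro that[of M']) (simp_all add: M'_def spN)
qed

lemma e_ran_le:
  fixes M :: "'w measure" and A :: "'w \<Rightarrow> ('f, 'k, 'g::banach) det_alg"
  assumes "ran_algorithm F \<Lambda> M A" "ran_card F M A \<le> of_nat n"
  shows "e_ran F S \<Lambda> n \<le> ran_error F S M A"
proof -
  obtain M' :: "('f, 'k, 'g) det_alg measure" where M':
    "ran_algorithm F \<Lambda> M' (\<lambda>B. B)" "ran_card F M' (\<lambda>B. B) = ran_card F M A"
    "ran_error F S M' (\<lambda>B. B) = ran_error F S M A"
    using ran_algorithm_push_forward[OF assms(1)] by metis
  show ?thesis
    unfolding e_ran_def using M' assms(2)
    by (intro INF_lower2[of "(M', \<lambda>B. B)"]) auto
qed

lemma e_ran_non_le: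
  fixes M :: "'w measure" and A :: "'w \<Rightarrow> ('f, 'k, 'g::banach) det_alg"
  assumes "ran_algorithm F \<Lambda> M A" "\<forall>\<omega>\<in>space M. nonadaptive (A \<omega>)"
    "ran_card F M A \<le> of_nat n"
  shows "e_ran_non F S \<Lambda> n \<le> ran_error F S M A"
proof -
  obtain M' :: "('f, 'k, 'g) det_alg measure" where M':
    "space M' = A ` space M"
    "ran_algorithm F \<Lambda> M' (\<lambda>B. B)" "ran_card F M' (\<lambda>B. B) = ran_card F M A"
    "ran_error F S M' (\<lambda>B. B) = ran_error F S M A"
    using ran_algorithm_push_forward[OF assms(1)] by metis
  show ?thesis
    unfolding e_ran_non_def using M' assms(2,3)
    by (intro INF_lower2[of "(M', \<lambda>B. B)"]) auto
qed


section \<open>The spaces and the operator\<close>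

text \<open>
  An element of \<open>L\<^sub>p\<^sup>N\<close> is a function on \<open>nat\<close> of which only the values on \<open>{1..N}\<close> matter.
  Exponents are extended reals.
\<close>

definition L_norm :: "ereal \<Rightarrow> nat \<Rightarrow> (nat \<Rightarrow> 'a::real_normed_vector) \<Rightarrow> real" where
  "L_norm p N f =
     (if p = \<infinity> then (MAX i\<in>{1..N}. norm (f i))
      else (1 / real N * (\<Sum>i=1..N. norm (f i) powr real_of_ereal p)) powr (1 / real_of_ereal p))"

definition LL_norm ::
  "ereal \<Rightarrow> nat \<Rightarrow> ereal \<Rightarrow> nat \<Rightarrow> (nat \<Rightarrow> nat \<Rightarrow> 'a::real_normed_vector) \<Rightarrow> real" where
  "LL_norm p N\<^sub>1 u N\<^sub>2 f = L_norm p N\<^sub>1 (\<lambda>i. L_norm u N\<^sub>2 (f i))"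

definition mean_op :: "nat \<Rightarrow> nat \<Rightarrow> (nat \<Rightarrow> nat \<Rightarrow> 'a::real_normed_field) \<Rightarrow> 'a" where
  "mean_op N\<^sub>1 N\<^sub>2 f = 1 / of_nat (N\<^sub>1 * N\<^sub>2) * (\<Sum>i=1..N\<^sub>1. \<Sum>j=1..N\<^sub>2. f i j)"

definition in_lq :: "ereal \<Rightarrow> (nat \<Rightarrow> real) \<Rightarrow> bool" where
  "in_lq q a \<longleftrightarrow>
     (if q = \<infinity> then bounded (range a) else summable (\<lambda>k. \<bar>a k\<bar> powr real_of_ereal q))"

definition lq_norm :: "ereal \<Rightarrow> (nat \<Rightarrow> real) \<Rightarrow> real" where
  "lq_norm q a =
     (if q = \<infinity> then (SUP k. \<bar>a k\<bar>)
      else (\<Sum>k. \<bar>a k\<bar> powr real_of_ereal q) powr (1 / real_of_ereal q))"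

definition X_level_norms ::
  "ereal \<Rightarrow> ereal \<Rightarrow> (nat \<Rightarrow> nat \<Rightarrow> nat \<Rightarrow> 'a::real_normed_vector) \<Rightarrow> nat \<Rightarrow> real" where
  "X_level_norms p u f k = LL_norm p (2 ^ k) u (2 ^ k) (f k)"

text \<open>
  The value \<open>f\<^sub>k(i,j)\<close> is \<open>f k i j\<close>; the components are extended by zero outside
  \<open>{1..2 ^ k} \<times> {1..2 ^ k}\<close>, so that distinct members of \<open>X_space\<close> are distinct sequences.
\<close>

definition X_space ::
  "ereal \<Rightarrow> ereal \<Rightarrow> ereal \<Rightarrow> (nat \<Rightarrow> nat \<Rightarrow> nat \<Rightarrow> 'a::real_normed_vector) set" where
  "X_space p u p\<^sub>1 =
     {f. (\<forall>k i j. (i, j) \<notin> {1..2 ^ k} \<times> {1..2 ^ k} \<longrightarrow> f k i j = 0) \<and>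
         in_lq p\<^sub>1 (X_level_norms p u f)}"

definition X_norm ::
  "ereal \<Rightarrow> ereal \<Rightarrow> ereal \<Rightarrow> (nat \<Rightarrow> nat \<Rightarrow> nat \<Rightarrow> 'a::real_normed_vector) \<Rightarrow> real" where
  "X_norm p u p\<^sub>1 f = lq_norm p\<^sub>1 (X_level_norms p u f)"

definition X_ball ::
  "ereal \<Rightarrow> ereal \<Rightarrow> ereal \<Rightarrow> (nat \<Rightarrow> nat \<Rightarrow> nat \<Rightarrow> 'a::real_normed_vector) set" where
  "X_ball p u p\<^sub>1 = {f \<in> X_space p u p\<^sub>1. X_norm p u p\<^sub>1 f \<le> 1}"

definition I_op :: "real \<Rightarrow> (nat \<Rightarrow> nat \<Rightarrow> nat \<Rightarrow> 'a::{real_normed_field, banach}) \<Rightarrow> 'a" where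
  "I_op \<alpha> f = (\<Sum>k. of_real (2 powr (- \<alpha> * real k)) * mean_op (2 ^ k) (2 ^ k) (f k))"

definition std_info :: "((nat \<Rightarrow> nat \<Rightarrow> nat \<Rightarrow> 'a) \<Rightarrow> 'a) set" where
  "std_info = {(\<lambda>f. f k i j) |k i j. i \<in> {1..2 ^ k} \<and> j \<in> {1..2 ^ k}}"

end

theory Submission
  imports Defs
begin

text \<open>
  Write \<open>N = 2 ^ k\<close> for the number of rows, and of columns, on level \<open>k\<close>. A
  level with \<open>N\<^sup>2\<close> not much above \<open>n\<close> is the hardest one: lower levels
  can be read completely at cost \<open>O(n)\<close>, and on higher levels the weight \<open>2 powr (-
  \<alpha> k)\<close> with \<open>\<alpha> > 1\<close> outweighs the loss of information.

  \<^bold>\<open>Lower bounds.\<close> They all live on one level with \<open>N\<^sup>2\<close> between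
  \<open>16 n\<close> and \<open>64 n\<close>. A deterministic algorithm cannot distinguish the two
  functions that are \<open>1\<close> or \<open>- 1\<close> wherever the zero function is not queried,
  and \<open>0\<close> elsewhere; this costs a multiple of \<open>2 powr (- \<alpha> k)\<close>. Against
  randomized algorithms one averages over inputs that carry independent signs of modulus \<open>h\<close>
  on a block \<open>T\<close> of points. Flipping all unseen signs does not change the run of the
  algorithm, so its error is at least a multiple of the modulus of the sum of the unseen signs. The sum
  over the whole block has mean modulus of order \<open>sqrt (card T)\<close> (lemma
  \<open>khinchine\<close>), while the sum over the seen part, however adaptively it was chosen, has
  second moment equal to the mean number of seen points (lemma \<open>sum_seen_square\<close>, a
  martingale identity). This is \<open>sign_lower_bound\<close>. The three blocks that matter are the
  whole level with \<open>h = 1\<close>, a random single point with \<open>h = N powr (1 / p + 1 /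
  u)\<close>, and, for nonadaptive algorithms, which cannot concentrate on the row that matters, a random
  row with \<open>h = N powr (1 / p)\<close>.

  \<^bold>\<open>Upper bounds.\<close> The levels \<open>k \<le> m\<close>, where \<open>4 ^ m\<close> is
  proportional to \<open>n\<close>, are read exactly, the levels \<open>m < k \<le> 2 m\<close> are
  sampled, and higher levels are ignored. With \<open>s\<close> samples in every row the variance of the
  sampled mean is at most \<open>1 / (s N\<^sup>2)\<close> times the sum of the row mean squares, and
  \<open>p < 2\<close> bounds this sum by \<open>N powr (2 / p)\<close>; this gives the nonadaptive rate.
  The adaptive algorithm first estimates the mean square of every row from \<open>s\<close> samples and
  then distributes \<open>O(s N)\<close> new samples in proportion to the square roots of the estimates.
  If the estimates were correct, the variance would be governed by the \<open>L\<^sub>1\<close> mean of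
  the row sizes, which gives the rate \<open>n powr (- 1 / 2)\<close> on the critical level. The estimate
  of a row with mean square \<open>\<mu>\<close> is wrong in the harmful direction, that is less than
  \<open>\<mu> / 4\<close>, with a probability \<open>P\<close> such that \<open>\<mu> P\<close> is at
  most a multiple of \<open>s powr (2 / u - 1)\<close> times the square of the \<open>L\<^sub>u\<close>
  norm of the row (lemma \<open>mean_sq_underestimated\<close>, by truncation and Chebyshev's
  inequality). These rows contribute the other term of the rate. The logarithms in the statement are at
  least \<open>1\<close>, so the bounds obtained in this way imply the stated ones.
\<close>

type_synonym 'a levels = "nat \<Rightarrow> nat \<Rightarrow> nat \<Rightarrow> 'a"

section \<open>What an algorithm learns about its input\<close>

text \<open>
  Cutting off after \<open>n\<close> steps allows induction over the run; the union over \<open>n\<close>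
  also covers inputs on which the algorithm never stops.
\<close>

definition asked :: "('f, 'k, 'g) det_alg \<Rightarrow> 'f \<Rightarrow> nat \<Rightarrow> ('f \<Rightarrow> 'k) set" where
  "asked A f n = {query A (info A f i) |i. i < n \<and> (\<forall>j\<le>i. \<not> stop A (info A f j))}"

definition all_asked :: "('f, 'k, 'g) det_alg \<Rightarrow> 'f \<Rightarrow> ('f \<Rightarrow> 'k) set" where
  "all_asked A f = (\<Union>n. asked A f n)"

lemma asked_mono: "m \<le> n \<Longrightarrow> asked A f m \<subseteq> asked A f n"
  unfolding asked_def by fastforce

lemma asked_Suc:
  "asked A f (Suc n) = asked A f n \<union>
     (if \<forall>j\<le>n. \<not> stop A (info A f j) then {query A (info A f n)} else {})"
  unfolding asked_def by (auto simp: less_Suc_eq)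

lemma all_asked_altdef:
  "all_asked A f = {query A (info A f i) |i. \<forall>j\<le>i. \<not> stop A (info A f j)}"
  unfolding all_asked_def asked_def by blast

lemma info_cong:
  assumes agree: "\<forall>L\<in>asked A f n. L f = L g" and "i \<le> n"
  shows "(\<forall>j<i. \<not> stop A (info A f j)) = (\<forall>j<i. \<not> stop A (info A g j)) \<and>
         ((\<forall>j<i. \<not> stop A (info A f j)) \<longrightarrow> info A g i = info A f i)"
  using assms(2)
proof (induction i)
  case 0
  then show ?case by simp
next
  case (Suc i)
  then have IH: "(\<forall>j<i. \<not> stop A (info A f j)) = (\<forall>j<i. \<not> stop A (info A g j))"
    "(\<forall>j<i. \<not> stop A (info A f j)) \<Longrightarrow> info A g i = info A f i" by auto
  have "query A (info A f i) f = query A (info A f i) g" if "\<forall>j<Suc i. \<not> stop A (info A f j)"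
    using that Suc.prems by (intro agree[rule_format]) (auto simp: asked_def less_Suc_eq_le)
  then show ?case using IH by (auto simp: less_Suc_eq)
qed

lemma asked_cong:
  assumes agree: "\<forall>L\<in>asked A f n. L f = L g"
  shows "asked A g n = asked A f n"
proof -
  have run: "(\<forall>j\<le>i. \<not> stop A (info A g j)) = (\<forall>j\<le>i. \<not> stop A (info A f j))" if "i < n" for i
    using info_cong[where f = f and g = g and A = A and n = n and i = "Suc i", OF agree] that
    unfolding less_Suc_eq_le Suc_le_eq by argo
  have same: "info A g i = info A f i" if "i < n" "\<forall>j\<le>i. \<not> stop A (info A f j)" for i
    using info_cong[where f = f and g = g and A = A and n = n and i = i, OF agree] that less_imp_le by metis
  have image: "asked A h n = (\<lambda>i. query A (info A h i)) ` {i. i < n \<and> (\<forall>j\<le>i. \<not> stop A (info A h j))}" for h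
    unfolding asked_def by blast
  show ?thesis
    unfolding image
  proof (rule image_cong)
    show "{i. i < n \<and> (\<forall>j\<le>i. \<not> stop A (info A g j))} = {i. i < n \<and> (\<forall>j\<le>i. \<not> stop A (info A f j))}"
      using run by blast
  qed (simp add: same)
qed

text \<open>
  An algorithm cannot distinguish two inputs that agree on everything it asks about one of them. If the
  run on one of them is infinite, so is the other one, and both return the same default.
\<close>

lemma all_asked_cong:
  assumes "\<forall>L\<in>all_asked A f. L f = L g"
  shows "all_asked A g = all_asked A f" "alg_out A g = alg_out A f"
proof -
  have agree: "\<forall>L\<in>asked A f n. L f = L g" for n
    using assms by (auto simp: all_asked_def)
  show "all_asked A g = all_asked A f"
    unfolding all_asked_def using asked_cong[where f = f and g = g and A = A, OF agree] by simp
  have ic: "(\<forall>j<i. \<not> stop A (info A f j)) = (\<forall>j<i. \<not> stop A (info A g j)) \<and>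
         ((\<forall>j<i. \<not> stop A (info A f j)) \<longrightarrow> info A g i = info A f i)" for i
    by (rule info_cong[where n = i, OF agree]) auto
  show "alg_out A g = alg_out A f"
  proof (cases "\<exists>n. stop A (info A f n)")
    case True
    define c where "c = (LEAST n. stop A (info A f n))"
    have c: "stop A (info A f c)" "\<And>j. j < c \<Longrightarrow> \<not> stop A (info A f j)"
      using True unfolding c_def by (metis LeastI, metis not_less_Least)
    then have g: "info A g c = info A f c" "\<And>j. j < c \<Longrightarrow> \<not> stop A (info A g j)"
      using ic[of c] by blast+
    have "(LEAST n. stop A (info A g n)) = c"
      using g c by (intro Least_equality) (auto simp: not_less[symmetric])
    then have "alg_card A g = enat c" "alg_card A f = enat c"
      using g c True unfolding alg_card_def c_def by (auto intro: exI[of _ c] simp: c_def)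
    then show ?thesis using g by (simp add: alg_out_def)
  next
    case False
    then have "\<not> stop A (info A g n)" for n using ic[of "Suc n"] by (simp del: info.simps)
    then show ?thesis using False by (simp add: alg_out_def alg_card_def)
  qed
qed

lemma card_le_alg_card:
  assumes "inj_on pt T" "finite T"
  shows "ennreal (real (card {t \<in> T. pt t \<in> all_asked A f})) \<le> ennreal_of_enat (alg_card A f)"
proof (cases "alg_card A f")
  case (enat c)
  then have c: "stop A (info A f c)"
    unfolding alg_card_def by (auto split: if_splits intro: LeastI)
  have "pt ` {t \<in> T. pt t \<in> all_asked A f} \<subseteq> (\<lambda>i. query A (info A f i)) ` {..<c}"
    using c unfolding all_asked_altdef by (auto simp: not_less[symmetric])
  then have "card (pt ` {t \<in> T. pt t \<in> all_asked A f}) \<le> card {..<c}"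
    by (meson card_image_le card_mono finite_imageI finite_lessThan le_trans)
  then have "card {t \<in> T. pt t \<in> all_asked A f} \<le> c"
    using assms by (subst (asm) card_image) (auto intro: inj_on_subset)
  then show ?thesis using enat
    by (simp add: ennreal_of_nat_eq_real_of_nat[symmetric])
qed (simp)

section \<open>Random signs\<close>

lemma sum_Pow_insert:
  assumes "finite T" "t \<notin> T"
  shows "(\<Sum>B\<in>Pow (insert t T). g B) = (\<Sum>B\<in>Pow T. g B + (g (insert t B) :: 'b::comm_monoid_add))"
proof -
  have "(\<Sum>B\<in>Pow (insert t T). g B) = (\<Sum>B\<in>Pow T. g B) + (\<Sum>B\<in>insert t ` Pow T. g B)"
    unfolding Pow_insert using assms by (intro sum.union_disjoint) auto
  also have "(\<Sum>B\<in>insert t ` Pow T. g B) = (\<Sum>B\<in>Pow T. g (insert t B))"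
    using assms by (subst sum.reindex) (auto simp: inj_on_def dest: insert_ident)
  finally show ?thesis by (simp add: sum.distrib)
qed

text \<open>
  A choice of signs on \<open>T\<close> is encoded by the subset \<open>B\<close> of \<open>T\<close>
  where the sign is positive, so an expectation over random signs is a sum over \<open>Pow T\<close>
  divided by \<open>2 ^ card T\<close>.
\<close>

definition eps :: "'x set \<Rightarrow> 'x \<Rightarrow> real" where
  "eps B t = (if t \<in> B then 1 else - 1)"

text \<open>
  Adding one more sign replaces a sum \<open>S\<close> by \<open>S - 1\<close> and \<open>S + 1\<close>,
  which gives recursions for the moments.
\<close>

lemma sign_moments:
  assumes "finite T"
  shows "(\<Sum>B\<in>Pow T. (\<Sum>t\<in>T. eps B t)\<^sup>2) = real (card T) * 2 ^ card T"
    and "(\<Sum>B\<in>Pow T. (\<Sum>t\<in>T. eps B t) ^ 4) \<le> 3 * (real (card T))\<^sup>2 * 2 ^ card T"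
proof -
  have step: "(\<Sum>B\<in>Pow (insert x T). (\<Sum>t\<in>insert x T. eps B t) ^ n)
      = (\<Sum>B\<in>Pow T. ((\<Sum>t\<in>T. eps B t) - 1) ^ n + ((\<Sum>t\<in>T. eps B t) + 1) ^ n)"
    if "finite T" "x \<notin> T" for x n and T :: "'a set"
  proof (subst sum_Pow_insert[OF that], rule sum.cong[OF refl])
    fix B assume "B \<in> Pow T"
    then have "(\<Sum>t\<in>T. eps (insert x B) t) = (\<Sum>t\<in>T. eps B t)" "x \<notin> B"
      using that by (auto simp: eps_def intro!: sum.cong)
    then show "(\<Sum>t\<in>insert x T. eps B t) ^ n + (\<Sum>t\<in>insert x T. eps (insert x B) t) ^ n =
         ((\<Sum>t\<in>T. eps B t) - 1) ^ n + ((\<Sum>t\<in>T. eps B t) + 1) ^ n"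
      using that by (simp add: eps_def algebra_simps)
  qed
  have m2: "(\<Sum>B\<in>Pow T. (\<Sum>t\<in>T. eps B t)\<^sup>2) = real (card T) * 2 ^ card T" if "finite T" for T :: "'a set"
    using that
  proof (induction T)
    case (insert x T)
    have "(\<Sum>B\<in>Pow (insert x T). (\<Sum>t\<in>insert x T. eps B t)\<^sup>2)
      = (\<Sum>B\<in>Pow T. 2 * (\<Sum>t\<in>T. eps B t)\<^sup>2 + 2)"
      unfolding step[OF insert(1,2)] by (intro sum.cong refl) (simp add: power2_eq_square algebra_simps)
    also have "\<dots> = 2 * (\<Sum>B\<in>Pow T. (\<Sum>t\<in>T. eps B t)\<^sup>2) + 2 * 2 ^ card T"
      using insert by (simp add: sum.distrib card_Pow flip: sum_distrib_left)
    finally show ?case using insert by (simp add: algebra_simps)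
  qed simp
  show "(\<Sum>B\<in>Pow T. (\<Sum>t\<in>T. eps B t)\<^sup>2) = real (card T) * 2 ^ card T" by (rule m2[OF assms])
  show "(\<Sum>B\<in>Pow T. (\<Sum>t\<in>T. eps B t) ^ 4) \<le> 3 * (real (card T))\<^sup>2 * 2 ^ card T"
    using assms
  proof (induction T)
    case (insert x T)
    have "(\<Sum>B\<in>Pow (insert x T). (\<Sum>t\<in>insert x T. eps B t) ^ 4)
      = (\<Sum>B\<in>Pow T. 2 * (\<Sum>t\<in>T. eps B t) ^ 4 + 12 * (\<Sum>t\<in>T. eps B t)\<^sup>2 + 2)"
      unfolding step[OF insert(1,2)]
      by (intro sum.cong refl) (simp add: power2_eq_square power4_eq_xxxx algebra_simps)
    also have "\<dots> = 2 * (\<Sum>B\<in>Pow T. (\<Sum>t\<in>T. eps B t) ^ 4) + 12 * (\<Sum>B\<in>Pow T. (\<Sum>t\<in>T. eps B t)\<^sup>2)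
        + 2 * 2 ^ card T"
      using insert by (simp add: sum.distrib card_Pow flip: sum_distrib_left)
    also have "\<dots> \<le> 2 * (3 * (real (card T))\<^sup>2 * 2 ^ card T) + 12 * (real (card T) * 2 ^ card T) + 2 * 2 ^ card T"
      using insert.IH m2[OF insert(1)] by linarith
    also have "\<dots> = (6 * (real (card T))\<^sup>2 + 12 * real (card T) + 2) * 2 ^ card T"
      by (simp add: algebra_simps)
    also have "\<dots> \<le> (6 * (real (card T) + 1)\<^sup>2) * 2 ^ card T"
      by (intro mult_right_mono) (auto simp: power2_eq_square algebra_simps)
    finally show ?case using insert by (simp add: algebra_simps)
  qed simp
qed

text \<open>
  The first moment is bounded from below by the second and the fourth, because \<open>y \<ge> y\<^sup>2 -
  4 / 27 * y ^ 4\<close> for \<open>y \<ge> 0\<close>: the difference is \<open>4 / 27 * y * (y - 3 /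
  2)\<^sup>2 * (y + 3)\<close>.
\<close>

lemma khinchine:
  assumes "finite T"
  shows "2 ^ card T * sqrt (card T) / 2 \<le> (\<Sum>B\<in>Pow T. \<bar>\<Sum>t\<in>T. eps B t\<bar>)"
proof (cases "card T = 0")
  case True
  then show ?thesis by (simp add: sum_nonneg)
next
  case False
  define r where "r = sqrt (card T)"
  have r: "r > 0" "real (card T) = r\<^sup>2" using False by (auto simp: r_def)
  have poly: "x\<^sup>2 / r - 4 / 27 * x ^ 4 / r ^ 3 \<le> \<bar>x\<bar>" for x :: real
  proof -
    define y where "y = \<bar>x\<bar> / r"
    have y: "0 \<le> y" "\<bar>x\<bar> = r * y" using r by (auto simp: y_def)
    have "x\<^sup>2 = (r * y)\<^sup>2" "x ^ 4 = (r * y) ^ 4" by (metis y(2) power2_abs, metis y(2) power_even_abs even_numeral)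
    then have "x\<^sup>2 / r - 4 / 27 * x ^ 4 / r ^ 3 = r * (y\<^sup>2 - 4 / 27 * y ^ 4)"
      using r by (simp add: power_mult_distrib field_simps power2_eq_square power3_eq_cube power4_eq_xxxx)
    also have "y\<^sup>2 - 4 / 27 * y ^ 4 = y - y * (4 / 27 * (y - 3 / 2)\<^sup>2 * (y + 3))"
      by (simp add: power2_eq_square power4_eq_xxxx field_simps)
    also have "\<dots> \<le> y" using y by simp
    finally show ?thesis using r y by simp
  qed
  have "2 ^ card T * r / 2 \<le> 2 ^ card T * r * (5 / 9)" using r by simp
  also have "\<dots> = (r\<^sup>2 * 2 ^ card T) / r - 4 / 27 * (3 * (r\<^sup>2)\<^sup>2 * 2 ^ card T) / r ^ 3"
    using r by (simp add: field_simps power2_eq_square power3_eq_cube)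
  also have "\<dots> \<le> (\<Sum>B\<in>Pow T. (\<Sum>t\<in>T. eps B t)\<^sup>2) / r - 4 / 27 * (\<Sum>B\<in>Pow T. (\<Sum>t\<in>T. eps B t) ^ 4) / r ^ 3"
    using sign_moments[OF assms] r by (intro diff_mono divide_right_mono mult_left_mono) (auto simp: )
  also have "\<dots> = (\<Sum>B\<in>Pow T. (\<Sum>t\<in>T. eps B t)\<^sup>2 / r - 4 / 27 * (\<Sum>t\<in>T. eps B t) ^ 4 / r ^ 3)"
    by (simp add: sum_subtractf sum_divide_distrib sum_distrib_left)
  also have "\<dots> \<le> (\<Sum>B\<in>Pow T. \<bar>\<Sum>t\<in>T. eps B t\<bar>)"
    by (intro sum_mono poly)
  finally show ?thesis by (simp add: r_def)
qed

section \<open>Inputs that carry independent signs\<close>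

text \<open>
  Inputs \<open>F B\<close> in which the sign at \<open>t\<close> can only be read off by the functional
  \<open>pt t\<close>. This is everything the lower bounds for randomized algorithms need to know about
  the inputs.
\<close>

locale sign_family =
  fixes \<Lambda> :: "('f \<Rightarrow> 'k) set" and pt :: "'x \<Rightarrow> 'f \<Rightarrow> 'k" and T :: "'x set" and F :: "'x set \<Rightarrow> 'f"
  assumes fin: "finite T" and inj: "inj_on pt T"
    and indep: "\<And>L B B'. L \<in> \<Lambda> \<Longrightarrow> B \<subseteq> T \<Longrightarrow> B' \<subseteq> T \<Longrightarrow>
      (\<And>t. t \<in> T \<Longrightarrow> L = pt t \<Longrightarrow> t \<in> B \<longleftrightarrow> t \<in> B') \<Longrightarrow> L (F B) = L (F B')"
begin

definition seen :: "('f, 'k, 'g) det_alg \<Rightarrow> 'x set \<Rightarrow> nat \<Rightarrow> 'x set" where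
  "seen A B n = {t \<in> T. pt t \<in> asked A (F B) n}"

definition all_seen :: "('f, 'k, 'g) det_alg \<Rightarrow> 'x set \<Rightarrow> 'x set" where
  "all_seen A B = {t \<in> T. pt t \<in> all_asked A (F B)}"

lemma asked_agree:
  assumes A: "det_algorithm \<Lambda> A" and B: "B \<subseteq> T" "B' \<subseteq> T"
    and eq: "\<And>t. t \<in> seen A B n \<Longrightarrow> t \<in> B \<longleftrightarrow> t \<in> B'" and L: "L \<in> asked A (F B) n"
  shows "L (F B) = L (F B')"
proof (rule indep[OF _ B])
  show "L \<in> \<Lambda>" using A L by (auto simp: asked_def det_algorithm_def)
  show "t \<in> B \<longleftrightarrow> t \<in> B'" if "t \<in> T" "L = pt t" for t
    using eq[of t] that L by (auto simp: seen_def)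
qed

text \<open>
  The sum of the signs seen so far is a martingale with increments of modulus \<open>1\<close>. In a step
  that queries a new point, flipping the sign at this point is an involution that leaves everything seen
  before unchanged, hence the mixed term in the square cancels.
\<close>

lemma sum_seen_square:
  assumes A: "det_algorithm \<Lambda> A"
  shows "(\<Sum>B\<in>Pow T. (\<Sum>t\<in>seen A B n. eps B t)\<^sup>2) = (\<Sum>B\<in>Pow T. real (card (seen A B n)))"
proof (induction n)
  case 0
  then show ?case by (simp add: seen_def asked_def)
next
  case (Suc n)
  define new where "new B t \<longleftrightarrow> t \<in> T \<and> t \<notin> seen A B n \<and>
    (\<forall>j\<le>n. \<not> stop A (info A (F B) j)) \<and> query A (info A (F B) n) = pt t" for B t
  define W where "W = {B \<in> Pow T. \<exists>t. new B t}"
  define x where "x B = (SOME t. new B t)" for B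
  have finseen: "finite (seen A B n)" for B using fin by (simp add: seen_def)
  have x: "new B (x B)" if "B \<in> W" for B
    using that unfolding W_def x_def by (auto intro: someI)
  have uniq: "t = x B" if "B \<in> W" "new B t" for B t
    using inj x[OF that(1)] that(2) by (auto simp: new_def inj_on_def)
  have seenW: "seen A B (Suc n) = insert (x B) (seen A B n)" if "B \<in> W" for B
    using x[OF that] uniq[OF that] unfolding seen_def asked_Suc new_def by (auto simp: seen_def)
  have seenV: "seen A B (Suc n) = seen A B n" if "B \<in> Pow T" "B \<notin> W" for B
    using that unfolding W_def seen_def asked_Suc new_def by (auto simp: seen_def)
  \<comment> \<open>Flip the sign at the point that is queried in this step.\<close>
  define \<psi> where "\<psi> B = (if x B \<in> B then B - {x B} else insert (x B) B)" for B
  have \<psi>: "\<psi> B \<in> W \<and> x (\<psi> B) = x B \<and> seen A (\<psi> B) n = seen A B n" if B: "B \<in> W" for B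
  proof -
    have sub: "B \<subseteq> T" "\<psi> B \<subseteq> T" using B x[OF B] by (auto simp: W_def \<psi>_def new_def)
    have nx: "x B \<notin> seen A B n" using x[OF B] by (simp add: new_def)
    have agree: "\<forall>L\<in>asked A (F B) n. L (F B) = L (F (\<psi> B))"
      by (rule ballI, rule asked_agree[OF A sub]) (use nx in \<open>auto simp: \<psi>_def\<close>)
    have seen: "seen A (\<psi> B) n = seen A B n"
      unfolding seen_def using asked_cong[where f = "F B" and g = "F (\<psi> B)" and A = A, OF agree] by simp
    have run: "\<forall>j\<le>n. \<not> stop A (info A (F B) j)" using x[OF B] by (simp add: new_def)
    then have info: "info A (F (\<psi> B)) i = info A (F B) i" if "i \<le> n" for i
      using info_cong[where f = "F B" and g = "F (\<psi> B)" and A = A and n = n and i = i, OF agree] that by auto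
    have "new (\<psi> B) (x B)"
      using x[OF B] run info unfolding new_def seen by auto
    moreover have "\<psi> B \<in> W" using calculation sub by (auto simp: W_def)
    ultimately show ?thesis using uniq[of "\<psi> B" "x B"] seen by auto
  qed
  have inv: "\<psi> (\<psi> B) = B" if "B \<in> W" for B
    using \<psi>[OF that] unfolding \<psi>_def by auto
  have flip: "eps (\<psi> B) (x B) = - eps B (x B)" for B by (auto simp: eps_def \<psi>_def)
  have keep: "(\<Sum>t\<in>seen A B n. eps (\<psi> B) t) = (\<Sum>t\<in>seen A B n. eps B t)" if "B \<in> W" for B
    using x[OF that] by (intro sum.cong) (auto simp: new_def eps_def \<psi>_def)
  have "(\<Sum>B\<in>W. (\<Sum>t\<in>seen A B n. eps B t) * eps B (x B))
      = (\<Sum>B\<in>W. - ((\<Sum>t\<in>seen A B n. eps B t) * eps B (x B)))"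
    by (rule sum.reindex_bij_witness[where i = \<psi> and j = \<psi>]) (auto simp: \<psi> inv flip keep)
  then have cross: "(\<Sum>B\<in>W. (\<Sum>t\<in>seen A B n. eps B t) * eps B (x B)) = 0"
    by (simp add: sum_negf)
  have finW: "finite W" and WP: "W \<subseteq> Pow T" using fin by (auto simp: W_def)
  have finP: "finite (Pow T)" using fin by simp
  have sq: "(eps B t)\<^sup>2 = 1" for B :: "'x set" and t by (simp add: eps_def)
  have W2: "(\<Sum>t\<in>seen A B (Suc n). eps B t)\<^sup>2 = (\<Sum>t\<in>seen A B n. eps B t)\<^sup>2 + 1
      + 2 * ((\<Sum>t\<in>seen A B n. eps B t) * eps B (x B))" if "B \<in> W" for B
    using x[OF that] finseen by (simp add: seenW[OF that] new_def power2_sum sq)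
  have "(\<Sum>B\<in>Pow T. (\<Sum>t\<in>seen A B (Suc n). eps B t)\<^sup>2)
      = (\<Sum>B\<in>Pow T - W. (\<Sum>t\<in>seen A B n. eps B t)\<^sup>2) + (\<Sum>B\<in>W. (\<Sum>t\<in>seen A B n. eps B t)\<^sup>2 + 1
      + 2 * ((\<Sum>t\<in>seen A B n. eps B t) * eps B (x B)))"
    unfolding sum.subset_diff[OF WP finP] using seenV W2 by simp
  also have "\<dots> = (\<Sum>B\<in>Pow T. (\<Sum>t\<in>seen A B n. eps B t)\<^sup>2) + real (card W)"
    unfolding sum.subset_diff[OF WP finP] by (simp add: sum.distrib cross flip: sum_distrib_left)
  also have "\<dots> = (\<Sum>B\<in>Pow T. real (card (seen A B n))) + real (card W)" using Suc by simp
  also have "\<dots> = (\<Sum>B\<in>Pow T - W. real (card (seen A B n))) + (\<Sum>B\<in>W. real (card (seen A B n)) + 1)"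
    unfolding sum.subset_diff[OF WP finP] by (simp add: sum.distrib)
  also have "\<dots> = (\<Sum>B\<in>Pow T. real (card (seen A B (Suc n))))"
  proof -
    have "real (card (seen A B (Suc n))) = real (card (seen A B n)) + 1" if "B \<in> W" for B
      using x[OF that] finseen by (simp add: seenW[OF that] new_def)
    then show ?thesis unfolding sum.subset_diff[OF WP finP] using seenV by simp
  qed
  finally show ?case .
qed

lemma ex_all_seen: "\<exists>n. \<forall>B\<in>Pow T. seen A B n = all_seen A B"
proof -
  have "\<forall>z\<in>{(B, t). B \<in> Pow T \<and> t \<in> all_seen A B}. \<exists>n. snd z \<in> seen A (fst z) n"
    by (auto simp: all_seen_def seen_def all_asked_def)
  then obtain n where n: "\<And>B t. B \<in> Pow T \<Longrightarrow> t \<in> all_seen A B \<Longrightarrow> t \<in> seen A B (n (B, t))"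
    by (metis (mono_tags, lifting) bchoice case_prodI fst_conv mem_Collect_eq snd_conv)
  define m where "m = Max (insert 0 (n ` (Pow T \<times> T)))"
  have "seen A B m = all_seen A B" if "B \<in> Pow T" for B
  proof
    show "seen A B m \<subseteq> all_seen A B" by (auto simp: seen_def all_seen_def all_asked_def)
    show "all_seen A B \<subseteq> seen A B m"
    proof
      fix t assume t: "t \<in> all_seen A B"
      then have "t \<in> T" by (simp add: all_seen_def)
      then have "n (B, t) \<le> m" unfolding m_def using that fin by (intro Max_ge) auto
      then show "t \<in> seen A B m"
        using n[OF that t] asked_mono[of "n (B, t)" m A "F B"] by (auto simp: seen_def)
    qed
  qed
  then show ?thesis by blast
qed

text \<open>
  Flipping all unseen signs preserves the output, so the errors at the two inputs together are at least
  twice \<open>v\<close> times the modulus of the unseen sum. The unseen sum is the difference of the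
  full sum, controlled by \<open>khinchine\<close>, and the seen sum, controlled by
  \<open>sum_seen_square\<close>. Applying \<open>\<bar>x\<bar> \<le> x\<^sup>2 / r + r / 4\<close> with
  \<open>r = sqrt (card T)\<close> to the seen sum, instead of the Cauchy-Schwarz inequality, keeps the
  bound linear in the number of queries, so that it can be averaged over the randomness of an algorithm
  without measurability issues.
\<close>

lemma sign_lower_bound:
  fixes A :: "('f, 'k, 'g::banach) det_alg"
  assumes A: "det_algorithm \<Lambda> A" and v: "0 \<le> v"
    and S: "\<And>B B'. B \<subseteq> T \<Longrightarrow> B' \<subseteq> T \<Longrightarrow>
       v * \<bar>(\<Sum>t\<in>T. eps B t) - (\<Sum>t\<in>T. eps B' t)\<bar> \<le> norm (S (F B) - S (F B'))"
    and T: "T \<noteq> {}"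
  shows "2 ^ card T * (v * sqrt (card T) / 4)
    \<le> (\<Sum>B\<in>Pow T. norm (S (F B) - alg_out A (F B)))
      + v / sqrt (card T) * (\<Sum>B\<in>Pow T. real (card (all_seen A B)))"
proof -
  \<comment> \<open>Keep the signs that are seen and flip the others.\<close>
  define \<phi> where "\<phi> B = (B \<inter> all_seen A B) \<union> (T - all_seen A B - B)" for B
  have seen_sub: "all_seen A B \<subseteq> T" for B by (auto simp: all_seen_def)
  have \<phi>: "\<phi> B \<subseteq> T" if "B \<subseteq> T" for B using that by (auto simp: \<phi>_def)
  have agree: "\<forall>L\<in>all_asked A (F B). L (F B) = L (F (\<phi> B))" if "B \<subseteq> T" for B
  proof
    fix L assume "L \<in> all_asked A (F B)"
    then obtain n where L: "L \<in> asked A (F B) n" by (auto simp: all_asked_def)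
    have "seen A B n \<subseteq> all_seen A B" by (auto simp: seen_def all_seen_def all_asked_def)
    then show "L (F B) = L (F (\<phi> B))"
      by (intro asked_agree[OF A that \<phi>[OF that] _ L]) (use that in \<open>auto simp: \<phi>_def seen_def\<close>)
  qed
  have out: "alg_out A (F (\<phi> B)) = alg_out A (F B)" "all_seen A (\<phi> B) = all_seen A B" if "B \<subseteq> T" for B
    using all_asked_cong[where f = "F B" and g = "F (\<phi> B)" and A = A, OF agree[OF that]] by (auto simp: all_seen_def)
  have inv: "\<phi> (\<phi> B) = B" if "B \<subseteq> T" for B
    using that out(2)[OF that] seen_sub[of B] unfolding \<phi>_def by auto
  define D where "D B = (\<Sum>t\<in>all_seen A B. eps B t)" for B
  have split: "(\<Sum>t\<in>T. eps C t) = (\<Sum>t\<in>T - all_seen A B. eps C t) + (\<Sum>t\<in>all_seen A B. eps C t)" for B C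
    by (rule sum.subset_diff[OF seen_sub fin])
  have diff: "(\<Sum>t\<in>T. eps B t) - (\<Sum>t\<in>T. eps (\<phi> B) t) = 2 * ((\<Sum>t\<in>T. eps B t) - D B)" if "B \<subseteq> T" for B
  proof -
    have "(\<Sum>t\<in>all_seen A B. eps (\<phi> B) t) = (\<Sum>t\<in>all_seen A B. eps B t)"
      by (intro sum.cong) (auto simp: eps_def \<phi>_def)
    moreover have "(\<Sum>t\<in>T - all_seen A B. eps (\<phi> B) t) = - (\<Sum>t\<in>T - all_seen A B. eps B t)"
      unfolding sum_negf[symmetric] by (intro sum.cong) (auto simp: eps_def \<phi>_def)
    ultimately show ?thesis unfolding D_def split[of _ B] by simp
  qed
  define err where "err B = norm (S (F B) - alg_out A (F B))" for B
  have pair: "2 * v * (\<bar>\<Sum>t\<in>T. eps B t\<bar> - \<bar>D B\<bar>) \<le> err B + err (\<phi> B)" if "B \<subseteq> T" for B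
  proof -
    have "2 * v * (\<bar>\<Sum>t\<in>T. eps B t\<bar> - \<bar>D B\<bar>) \<le> 2 * v * \<bar>(\<Sum>t\<in>T. eps B t) - D B\<bar>"
      using v by (intro mult_left_mono) auto
    also have "\<dots> = v * \<bar>(\<Sum>t\<in>T. eps B t) - (\<Sum>t\<in>T. eps (\<phi> B) t)\<bar>"
      by (simp only: diff[OF that] abs_mult abs_numeral mult_ac)
    also have "\<dots> \<le> norm (S (F B) - S (F (\<phi> B)))" by (rule S[OF that \<phi>[OF that]])
    also have "\<dots> = norm ((S (F B) - alg_out A (F B)) - (S (F (\<phi> B)) - alg_out A (F (\<phi> B))))"
      by (simp add: out that)
    also have "\<dots> \<le> err B + err (\<phi> B)" unfolding err_def by (rule norm_triangle_ineq4)
    finally show ?thesis .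
  qed
  have re: "(\<Sum>B\<in>Pow T. err (\<phi> B)) = (\<Sum>B\<in>Pow T. err B)"
    by (rule sum.reindex_bij_witness[where i = \<phi> and j = \<phi>]) (auto simp: inv dest!: \<phi>)
  have "(\<Sum>B\<in>Pow T. 2 * v * (\<bar>\<Sum>t\<in>T. eps B t\<bar> - \<bar>D B\<bar>)) \<le> (\<Sum>B\<in>Pow T. err B + err (\<phi> B))"
    by (intro sum_mono pair) auto
  then have main: "v * ((\<Sum>B\<in>Pow T. \<bar>\<Sum>t\<in>T. eps B t\<bar>) - (\<Sum>B\<in>Pow T. \<bar>D B\<bar>)) \<le> (\<Sum>B\<in>Pow T. err B)"
    unfolding sum.distrib re by (simp add: sum_distrib_left[symmetric] sum_subtractf)
  define r where "r = sqrt (card T)"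
  have r: "r > 0" using T fin by (simp add: r_def card_gt_0_iff)
  have young: "\<bar>x\<bar> \<le> x\<^sup>2 / r + r / 4" for x :: real
  proof -
    have "0 \<le> (\<bar>x\<bar> - r / 2)\<^sup>2" by simp
    then have "\<bar>x\<bar> * r \<le> x\<^sup>2 + r\<^sup>2 / 4" by (simp add: power2_diff power_divide)
    then show ?thesis using r by (simp add: field_simps power2_eq_square)
  qed
  obtain n where n: "\<And>B. B \<in> Pow T \<Longrightarrow> seen A B n = all_seen A B" using ex_all_seen by blast
  have "(\<Sum>B\<in>Pow T. \<bar>D B\<bar>) \<le> (\<Sum>B\<in>Pow T. (D B)\<^sup>2 / r + r / 4)" by (intro sum_mono young)
  also have "\<dots> = (\<Sum>B\<in>Pow T. (D B)\<^sup>2) / r + 2 ^ card T * r / 4"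
    using fin by (simp add: sum.distrib sum_divide_distrib card_Pow)
  also have "(\<Sum>B\<in>Pow T. (D B)\<^sup>2) = (\<Sum>B\<in>Pow T. real (card (all_seen A B)))"
    using sum_seen_square[OF A, of n] n unfolding D_def by simp
  finally have "v * (2 ^ card T * r / 4 - (\<Sum>B\<in>Pow T. real (card (all_seen A B))) / r) \<le>
      v * ((\<Sum>B\<in>Pow T. \<bar>\<Sum>t\<in>T. eps B t\<bar>) - (\<Sum>B\<in>Pow T. \<bar>D B\<bar>))"
    using khinchine[OF fin] v by (intro mult_left_mono) (auto simp: r_def field_simps)
  with main have "v * (2 ^ card T * r / 4 - (\<Sum>B\<in>Pow T. real (card (all_seen A B))) / r) \<le> (\<Sum>B\<in>Pow T. err B)"
    by linarith
  then show ?thesis unfolding r_def err_def by (simp add: algebra_simps)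
qed

end

section \<open>From deterministic to randomized algorithms\<close>

text \<open>
  Averaging over inputs: a bound that is linear in error and cost and holds for every deterministic
  algorithm of a class passes to randomized algorithms by integration. The predicate \<open>P\<close>
  selects the class, and the inputs \<open>g y\<close> at which the cost is measured may differ from the
  inputs \<open>f x\<close>.
\<close>

lemma ran_lower_bound:
  fixes S :: "'f \<Rightarrow> 'g::banach" and f :: "'i \<Rightarrow> 'f" and g :: "'j \<Rightarrow> 'f"
  assumes alg: "ran_algorithm F \<Lambda> M A" and P: "\<forall>\<omega>\<in>space M. P (A \<omega>)"
    and card: "ran_card F M A \<le> of_nat n"
    and I: "finite I" "f ` I \<subseteq> F" "0 \<le> a" "a * real (card I) = 1"
    and J: "finite J" "g ` J \<subseteq> F" "0 \<le> c"
    and key: "\<And>A. det_algorithm \<Lambda> A \<Longrightarrow> P A \<Longrightarrow> ennreal b \<le>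
        (\<Sum>x\<in>I. ennreal a * ennreal (norm (S (f x) - alg_out A (f x)))) +
        (\<Sum>y\<in>J. ennreal c * ennreal_of_enat (alg_card A (g y)))"
  shows "ennreal (b - c * real (card J) * real n) \<le> ran_error F S M A"
proof -
  interpret prob_space M using alg by (simp add: ran_algorithm_def)
  have cardm: "(\<lambda>\<omega>. ennreal_of_enat (alg_card (A \<omega>) h)) \<in> borel_measurable M" if "h \<in> F" for h
  proof -
    have "(\<lambda>\<omega>. alg_card (A \<omega>) h) \<in> M \<rightarrow>\<^sub>M count_space UNIV"
      using alg that by (simp add: ran_algorithm_def)
    then show ?thesis by (rule measurable_compose) simp
  qed
  have errm: "(\<lambda>\<omega>. ennreal (norm (S h - alg_out (A \<omega>) h))) \<in> borel_measurable M" if "h \<in> F" for h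
  proof -
    have "(\<lambda>g. ennreal (norm (S h - g))) \<in> borel_measurable borel"
      by (intro borel_measurable_continuous_onI continuous_on_ennreal continuous_intros)
    moreover have "(\<lambda>\<omega>. alg_out (A \<omega>) h) \<in> borel_measurable M"
      using alg that by (simp add: ran_algorithm_def)
    ultimately show ?thesis by (rule measurable_compose[rotated])
  qed
  have fI: "f x \<in> F" if "x \<in> I" for x using I that by auto
  have gJ: "g y \<in> F" if "y \<in> J" for y using J that by auto
  have "ennreal b = (\<integral>\<^sup>+\<omega>. ennreal b \<partial>M)" by (simp add: emeasure_space_1)
  also have "\<dots> \<le> (\<integral>\<^sup>+\<omega>. (\<Sum>x\<in>I. ennreal a * ennreal (norm (S (f x) - alg_out (A \<omega>) (f x)))) +
        (\<Sum>y\<in>J. ennreal c * ennreal_of_enat (alg_card (A \<omega>) (g y))) \<partial>M)"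
    using alg P by (intro nn_integral_mono key) (auto simp: ran_algorithm_def)
  also have "\<dots> = (\<Sum>x\<in>I. ennreal a * (\<integral>\<^sup>+\<omega>. ennreal (norm (S (f x) - alg_out (A \<omega>) (f x))) \<partial>M)) +
        (\<Sum>y\<in>J. ennreal c * (\<integral>\<^sup>+\<omega>. ennreal_of_enat (alg_card (A \<omega>) (g y)) \<partial>M))"
    using cardm errm fI gJ
    by (subst nn_integral_add) (auto simp: nn_integral_sum nn_integral_cmult intro!: borel_measurable_sum)
  also have "\<dots> \<le> (\<Sum>x\<in>I. ennreal a * ran_error F S M A) + (\<Sum>y\<in>J. ennreal c * ran_card F M A)"
    using fI gJ unfolding ran_error_def ran_card_def
    by (intro add_mono sum_mono mult_left_mono SUP_upper) auto
  also have "\<dots> = ennreal (a * real (card I)) * ran_error F S M A + ennreal (c * real (card J)) * ran_card F M A"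
    using I(3) J(3) by (simp add: ennreal_mult ennreal_of_nat_eq_real_of_nat mult_ac)
  also have "\<dots> \<le> ran_error F S M A + ennreal (c * real (card J)) * of_nat n"
    using I by (auto intro: mult_left_mono card)
  also have "ennreal (c * real (card J)) * of_nat n = ennreal (c * real (card J) * real n)"
    using J by (simp add: ennreal_mult ennreal_of_nat_eq_real_of_nat)
  finally have "ennreal b \<le> ran_error F S M A + ennreal (c * real (card J) * real n)" .
  then have "ennreal b - ennreal (c * real (card J) * real n) \<le> ran_error F S M A"
    by (simp add: ennreal_minus_le_iff add.commute)
  then show ?thesis using J by (simp add: ennreal_minus)
qed

lemma nonadaptive_all_asked:
  assumes "nonadaptive A"
  shows "all_asked A f = all_asked A g"
proof -
  have len: "length (info A h n) = n" for h n by (induction n) auto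
  have "query A (info A f i) = query A (info A g i)" "stop A (info A f i) = stop A (info A g i)" for i
    using assms len unfolding nonadaptive_def by metis+
  then show ?thesis by (simp add: all_asked_altdef)
qed

section \<open>Functions with signs on one level\<close>

abbreviation grid :: "nat \<Rightarrow> (nat \<times> nat) set" where
  "grid k \<equiv> {1..2 ^ k} \<times> {1..2 ^ k}"

definition signs_on ::
  "nat \<Rightarrow> (nat \<times> nat) set \<Rightarrow> real \<Rightarrow> (nat \<times> nat) set \<Rightarrow> 'a::real_normed_field levels" where
  "signs_on k T h B = (\<lambda>k' i j. if k' = k \<and> (i, j) \<in> T then of_real (h * eps B (i, j)) else 0)"

definition at_point :: "nat \<Rightarrow> nat \<times> nat \<Rightarrow> ('a levels) \<Rightarrow> 'a" where
  "at_point k t = (\<lambda>f. f k (fst t) (snd t))"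

lemma inj_at_point: "inj (at_point k :: _ \<Rightarrow> ('a::zero_neq_one levels) \<Rightarrow> 'a)"
proof (rule injI)
  fix s t :: "nat \<times> nat" assume eq: "(at_point k s :: ('a levels) \<Rightarrow> 'a) = at_point k t"
  have "at_point k s (\<lambda>_ i j. if (i, j) = s then 1 else 0 :: 'a) = at_point k t (\<lambda>_ i j. if (i, j) = s then 1 else 0)"
    by (simp add: eq)
  then show "s = t" by (auto simp: at_point_def split: if_splits)
qed

lemma sign_family_signs_on:
  assumes "finite T"
  shows "sign_family std_info (at_point k) T (signs_on k T h :: _ \<Rightarrow> 'a::real_normed_field levels)"
proof
  show "inj_on (at_point k :: _ \<Rightarrow> ('a levels) \<Rightarrow> 'a) T" using inj_at_point by (rule inj_on_subset) simp
next
  fix L :: "('a levels) \<Rightarrow> 'a" and B B' :: "(nat \<times> nat) set"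
  assume L: "L \<in> std_info" and eq: "\<And>t. t \<in> T \<Longrightarrow> L = at_point k t \<Longrightarrow> (t \<in> B) = (t \<in> B')"
  obtain k' i j where L: "L = (\<lambda>f. f k' i j)" using L by (auto simp: std_info_def)
  show "L (signs_on k T h B) = L (signs_on k T h B')"
    using eq[of "(i, j)"] unfolding L signs_on_def by (auto simp: at_point_def eps_def)
qed fact

lemma I_op_one_level:
  fixes f :: "'a::{real_normed_field, banach} levels"
  assumes "\<And>k'. k' \<noteq> k \<Longrightarrow> f k' = (\<lambda>_ _. 0)"
  shows "I_op \<alpha> f = of_real (2 powr (- \<alpha> * real k)) * mean_op (2 ^ k) (2 ^ k) (f k)"
  unfolding I_op_def
  by (subst suminf_finite[of "{k}"]) (auto simp: assms mean_op_def)

lemma I_op_signs_on: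
  assumes "T \<subseteq> grid k"
  shows "I_op \<alpha> (signs_on k T h B :: 'a::{real_normed_field, banach} levels)
    = of_real (2 powr (- \<alpha> * real k) / 4 ^ k * h * (\<Sum>t\<in>T. eps B t))"
proof -
  have "(\<Sum>i=1..2^k. \<Sum>j=1..2^k. signs_on k T h B k i j) =
      (\<Sum>t\<in>grid k. if t \<in> T then of_real (h * eps B t) else (0 :: 'a))"
    unfolding sum.cartesian_product by (intro sum.cong) (auto simp: signs_on_def)
  also have "\<dots> = (\<Sum>t\<in>T. of_real (h * eps B t))"
    using assms by (simp add: sum.If_cases Int_absorb1)
  also have "\<dots> = of_real (h * (\<Sum>t\<in>T. eps B t))" by (simp add: sum_distrib_left)
  finally have "mean_op (2 ^ k) (2 ^ k) (signs_on k T h B k) = (of_real (h * (\<Sum>t\<in>T. eps B t) / 4 ^ k) :: 'a)"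
    by (simp add: mean_op_def power_mult_distrib[symmetric])
  then show ?thesis by (subst I_op_one_level) (auto simp: signs_on_def fun_eq_iff)
qed

lemma sign_error_bound:
  fixes A :: "('a levels, 'a, 'a::{real_normed_field, banach}) det_alg"
    and \<alpha> h :: real and k :: nat
  defines "v \<equiv> 2 powr (- \<alpha> * real k) / 4 ^ k * h"
  assumes A: "det_algorithm std_info A" and T: "T \<subseteq> grid k" "T \<noteq> {}" and h: "0 \<le> h"
  shows "2 ^ card T * (v * sqrt (card T) / 4)
    \<le> (\<Sum>B\<in>Pow T. norm (I_op \<alpha> (signs_on k T h B) - alg_out A (signs_on k T h B)))
      + v / sqrt (card T) * (\<Sum>B\<in>Pow T. real (card {t \<in> T. at_point k t \<in> all_asked A (signs_on k T h B)}))"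
proof -
  have fin: "finite T" using T finite_subset by blast
  interpret sign_family std_info "at_point k" T "signs_on k T h :: _ \<Rightarrow> 'a levels"
    by (rule sign_family_signs_on[OF fin])
  have "0 \<le> v" using h by (simp add: v_def)
  show ?thesis
  proof (rule sign_lower_bound[OF A \<open>0 \<le> v\<close> _ T(2), unfolded all_seen_def])
    fix B B' assume "B \<subseteq> T" "B' \<subseteq> T"
    have "norm (I_op \<alpha> (signs_on k T h B) - I_op \<alpha> (signs_on k T h B') :: 'a)
       = norm (of_real (v * ((\<Sum>t\<in>T. eps B t) - (\<Sum>t\<in>T. eps B' t))) :: 'a)"
      unfolding I_op_signs_on[OF T(1)] v_def by (simp only: of_real_diff[symmetric] right_diff_distrib)
    also have "\<dots> = v * \<bar>(\<Sum>t\<in>T. eps B t) - (\<Sum>t\<in>T. eps B' t)\<bar>"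
      using \<open>0 \<le> v\<close> by (simp only: norm_of_real abs_mult abs_of_nonneg)
    finally show "v * \<bar>(\<Sum>t\<in>T. eps B t) - (\<Sum>t\<in>T. eps B' t)\<bar>
       \<le> norm (I_op \<alpha> (signs_on k T h B) - I_op \<alpha> (signs_on k T h B') :: 'a)" by simp
  qed
qed

section \<open>Norms of functions on one level\<close>

lemma L_norm_nonneg: "1 \<le> N \<Longrightarrow> 0 \<le> L_norm u N f"
  by (auto simp: L_norm_def Max_ge_iff)

lemma L_norm_le:
  assumes "1 \<le> u" "1 \<le> N" "\<And>j. j \<in> {1..N} \<Longrightarrow> norm (f j) \<le> h"
  shows "L_norm u N f \<le> h"
proof -
  have h: "0 \<le> h" using order_trans[OF norm_ge_zero assms(3)[of 1]] assms(2) by simp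
  show ?thesis
  proof (cases u)
    case (real r)
    have r: "1 \<le> r" using assms(1) real by simp
    have "(\<Sum>j=1..N. norm (f j) powr r) \<le> (\<Sum>j=1..N. h powr r)"
      using assms(3) r by (intro sum_mono powr_mono2) auto
    then have "1 / real N * (\<Sum>j=1..N. norm (f j) powr r) \<le> h powr r"
      using assms(2) by (simp add: field_simps)
    then have "(1 / real N * (\<Sum>j=1..N. norm (f j) powr r)) powr (1 / r) \<le> (h powr r) powr (1 / r)"
      using r by (intro powr_mono2) (auto intro!: sum_nonneg divide_nonneg_nonneg)
    also have "\<dots> = h" using r h by (simp add: powr_powr)
    finally show ?thesis using real by (simp add: L_norm_def)
  qed (use assms in \<open>auto simp: L_norm_def\<close>)
qed

lemma real_of_ereal_inverse: "real_of_ereal (1 / ereal r) = 1 / r"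
  by (cases "r = 0") (auto simp: one_ereal_def)

lemma L_norm_single:
  assumes "1 \<le> u" "j0 \<in> {1..N}" "\<And>j. j \<in> {1..N} \<Longrightarrow> j \<noteq> j0 \<Longrightarrow> f j = 0"
  shows "L_norm u N f = norm (f j0) * real N powr (- real_of_ereal (1 / u))"
proof (cases u)
  case (real r)
  have r: "1 \<le> r" using assms(1) real by simp
  have "(\<Sum>j=1..N. norm (f j) powr r) = (\<Sum>j\<in>{j0}. norm (f j) powr r)"
    using assms by (intro sum.mono_neutral_right) auto
  then show ?thesis
    using r assms(2) real by (simp add: L_norm_def powr_divide powr_powr powr_minus real_of_ereal_inverse divide_simps)
next
  case PInf
  have "(MAX j\<in>{1..N}. norm (f j)) = norm (f j0)"
  proof (rule Max_eqI)
    fix y assume "y \<in> (\<lambda>j. norm (f j)) ` {1..N}"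
    then obtain j where "j \<in> {1..N}" "y = norm (f j)" by auto
    then show "y \<le> norm (f j0)" using assms(3)[of j] by (cases "j = j0") auto
  qed (use assms in auto)
  then show ?thesis using PInf assms(2) by (simp add: L_norm_def)
qed (use assms in auto)

lemma L_norm_zero: "1 \<le> u \<Longrightarrow> 1 \<le> N \<Longrightarrow> L_norm u N (\<lambda>_. 0) = 0"
  using L_norm_single[of u 1 N "\<lambda>_. 0"] by simp

lemma X_ball_one_level:
  fixes f :: "'a::real_normed_vector levels"
  assumes pq: "1 \<le> p" "1 \<le> u" "1 \<le> p1"
    and supp: "\<And>k' i j. k' \<noteq> k \<or> (i, j) \<notin> grid k \<Longrightarrow> f k' i j = 0"
    and le: "LL_norm p (2 ^ k) u (2 ^ k) (f k) \<le> 1"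
  shows "f \<in> X_ball p u p1"
proof -
  define x where "x = X_level_norms p u f k"
  have "f k' = (\<lambda>_ _. 0)" if "k' \<noteq> k" for k' using supp that by (auto simp: fun_eq_iff)
  then have norms: "X_level_norms p u f k' = (if k' = k then x else 0)" for k'
    using pq by (auto simp: X_level_norms_def LL_norm_def L_norm_zero x_def)
  have x: "0 \<le> x" "x \<le> 1" using le by (auto simp: x_def X_level_norms_def LL_norm_def intro: L_norm_nonneg)
  have "in_lq p1 (X_level_norms p u f) \<and> lq_norm p1 (X_level_norms p u f) \<le> 1"
  proof (cases p1)
    case (real r)
    then have r: "1 \<le> r" using pq by simp
    have sums: "(\<lambda>k'. \<bar>X_level_norms p u f k'\<bar> powr r) sums (x powr r)"
    proof -
      have "(\<lambda>k'. \<bar>X_level_norms p u f k'\<bar> powr r) = (\<lambda>k'. if k' = k then x powr r else 0)"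
        using x r by (auto simp: norms fun_eq_iff)
      then show ?thesis using sums_single[of k "\<lambda>_. x powr r"] by simp
    qed
    have "(x powr r) powr (1 / r) \<le> 1" using x r by (simp add: powr_powr)
    then show ?thesis
      using real sums by (auto simp: in_lq_def lq_norm_def sums_iff)
  next
    case PInf
    have "bounded (range (X_level_norms p u f))"
      by (rule boundedI[of _ 1]) (use x in \<open>auto simp: norms\<close>)
    moreover have "(SUP k'. \<bar>X_level_norms p u f k'\<bar>) \<le> 1"
      by (rule cSUP_least) (use x in \<open>auto simp: norms\<close>)
    ultimately show ?thesis using PInf by (simp add: in_lq_def lq_norm_def)
  qed (use pq in auto)
  then show ?thesis
    unfolding X_ball_def X_space_def X_norm_def mem_Collect_eq using supp by metis
qed

lemma norm_signs_on:
  "0 \<le> h \<Longrightarrow> norm (signs_on k T h B k i j :: 'a::real_normed_field) = (if (i, j) \<in> T then h else 0)"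
  by (simp add: signs_on_def eps_def)

text \<open>
  The three ways to use up the unit ball: \<open>h\<close> is the reciprocal of the norm of the indicator
  function of the full level, of a row, and of a single point.
\<close>

lemma signs_on_in_ball:
  fixes p :: real and u p1 :: ereal
  assumes pq: "1 \<le> p" "1 \<le> u" "1 \<le> p1" and T: "T \<subseteq> grid k"
    and h: "h = 1 \<or> (h = (2 ^ k) powr (1 / p) \<and> (\<exists>i. T \<subseteq> {i} \<times> {1..2 ^ k}))
      \<or> (h = (2 ^ k) powr (1 / p + real_of_ereal (1 / u)) \<and> (\<exists>i j. T \<subseteq> {(i, j)}))"
  shows "(signs_on k T h B :: 'a::real_normed_field levels) \<in> X_ball (ereal p) u p1"
proof (rule X_ball_one_level)
  let ?f = "signs_on k T h B :: 'a levels"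
  have h0: "0 \<le> h" using h by auto
  note n = norm_signs_on[OF h0, where 'a = 'a]
  have inner: "L_norm u (2 ^ k) (?f k i) \<le> h" for i
    using pq h0 by (intro L_norm_le) (auto simp: n)
  have zero: "L_norm u (2 ^ k) (?f k i) = 0" if "\<And>j. (i, j) \<notin> T" for i
    using L_norm_zero[of u "2 ^ k"] pq that by (simp add: signs_on_def)
  have nn: "0 \<le> L_norm u (2 ^ k) (?f k i)" for i by (intro L_norm_nonneg) simp
  show "LL_norm (ereal p) (2 ^ k) u (2 ^ k) (?f k) \<le> 1"
  proof (cases "T = {}")
    case True
    then have "L_norm u (2 ^ k) (?f k i) = 0" for i by (intro zero) simp
    then show ?thesis using pq by (simp add: LL_norm_def L_norm_zero)
  next
    case False
    then obtain i0 j0 where ij: "(i0, j0) \<in> T" by auto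
    then have ij': "i0 \<in> {1..2^k}" "j0 \<in> {1..2^k}" using T by auto
    from h consider "h = 1" | "h = (2 ^ k) powr (1 / p)" "T \<subseteq> {i0} \<times> {1..2 ^ k}"
      | "h = (2 ^ k) powr (1 / p + real_of_ereal (1 / u))" "T = {(i0, j0)}"
      using ij by auto
    then show ?thesis
    proof cases
      case 1
      then show ?thesis
        unfolding LL_norm_def using pq inner nn by (intro L_norm_le) auto
    next
      case 2
      have "LL_norm (ereal p) (2 ^ k) u (2 ^ k) (?f k)
        = norm (L_norm u (2 ^ k) (?f k i0)) * real (2 ^ k) powr (- real_of_ereal (1 / ereal p))"
        unfolding LL_norm_def using pq 2 by (intro L_norm_single ij' zero) auto
      also have "\<dots> \<le> h * real (2 ^ k) powr (- real_of_ereal (1 / ereal p))"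
        using inner nn by (intro mult_right_mono) auto
      also have "\<dots> = 1" using 2 pq by (simp add: real_of_ereal_inverse flip: powr_add)
      finally show ?thesis .
    next
      case 3
      have "L_norm u (2 ^ k) (?f k i0) = norm (?f k i0 j0) * real (2 ^ k) powr (- real_of_ereal (1 / u))"
        using pq 3 by (intro L_norm_single ij') (auto simp: signs_on_def)
      also have "\<dots> = (2 ^ k) powr (1 / p)"
        unfolding n if_P[OF ij] by (simp add: 3(1) flip: powr_add)
      finally have i0: "L_norm u (2 ^ k) (?f k i0) = (2 ^ k) powr (1 / p)" .
      have "LL_norm (ereal p) (2 ^ k) u (2 ^ k) (?f k)
        = norm (L_norm u (2 ^ k) (?f k i0)) * real (2 ^ k) powr (- real_of_ereal (1 / ereal p))"
        unfolding LL_norm_def using pq 3 by (intro L_norm_single ij' zero) auto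
      also have "\<dots> = 1" using pq by (simp add: i0 real_of_ereal_inverse flip: powr_add)
      finally show ?thesis by simp
    qed
  qed
qed (use assms in \<open>auto simp: signs_on_def\<close>)

section \<open>Lower bounds\<close>

lemma sum_ennreal_split:
  assumes "finite I" "finite J" "\<And>x. x \<in> I \<Longrightarrow> 0 \<le> e x" "\<And>y. y \<in> J \<Longrightarrow> 0 \<le> q y" "0 \<le> a" "0 \<le> c"
    and "b \<le> a * (\<Sum>x\<in>I. e x) + c * (\<Sum>y\<in>J. q y)"
  shows "ennreal b \<le> (\<Sum>x\<in>I. ennreal a * ennreal (e x)) + (\<Sum>y\<in>J. ennreal c * ennreal (q y))"
proof -
  have "(\<Sum>x\<in>I. ennreal a * ennreal (e x)) = ennreal (a * (\<Sum>x\<in>I. e x))"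
    using assms by (subst sum_distrib_left[symmetric]) (simp add: ennreal_mult sum_nonneg)
  moreover have "(\<Sum>y\<in>J. ennreal c * ennreal (q y)) = ennreal (c * (\<Sum>y\<in>J. q y))"
    using assms by (subst sum_distrib_left[symmetric]) (simp add: ennreal_mult sum_nonneg)
  ultimately show ?thesis
    using assms by (simp add: sum_nonneg ennreal_leI flip: ennreal_plus)
qed

lemma zero_in_X_ball:
  assumes "1 \<le> p" "1 \<le> u" "1 \<le> p1"
  shows "(\<lambda>_ _ _. 0) \<in> X_ball p u p1"
  using assms by (intro X_ball_one_level[of _ _ _ 0]) (auto simp: LL_norm_def L_norm_zero)

text \<open>
  On average at most \<open>n\<close> of the \<open>4 ^ k\<close> signs are seen, too few to determine
  their sum.
\<close>

lemma e_ran_ge_all_signs: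
  fixes p \<alpha> :: real and u p1 :: ereal
  assumes pq: "1 \<le> p" "1 \<le> u" "1 \<le> p1" and n: "16 * n \<le> 4 ^ k"
  shows "ennreal (2 powr (- \<alpha> * real k) / 2 ^ k / 8)
    \<le> e_ran (X_ball (ereal p) u p1 :: ('a::{real_normed_field, banach} levels) set) (I_op \<alpha>) std_info n"
  unfolding e_ran_def
proof (rule INF_greatest, clarify)
  let ?F = "X_ball (ereal p) u p1 :: ('a levels) set"
  let ?f = "\<lambda>B. signs_on k (grid k) 1 B :: 'a levels"
  fix M :: "('a levels, 'a, 'a) det_alg measure"
    and A :: "('a levels, 'a, 'a) det_alg \<Rightarrow> ('a levels, 'a, 'a) det_alg"
  assume alg: "ran_algorithm ?F std_info M A" and card: "ran_card ?F M A \<le> of_nat n"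
  define v where "v = 2 powr (- \<alpha> * real k) / 4 ^ k"
  have v: "0 \<le> v" by (simp add: v_def)
  have cT: "card (grid k) = 4 ^ k" by (simp add: card_cartesian_product flip: power_mult_distrib)
  have sq: "sqrt (4 ^ k) = 2 ^ k" by (simp add: real_sqrt_power)
  have ball: "?f B \<in> ?F" for B by (rule signs_on_in_ball[OF pq]) auto
  define K :: real where "K = 2 ^ card (grid k)"
  have K: "K > 0" by (simp add: K_def)
  have cP: "real (card (Pow (grid k))) = K" by (simp add: card_Pow K_def)
  have "ennreal (v * 2 ^ k / 4 - (v / 2 ^ k / K) * real (card (Pow (grid k))) * real n) \<le> ran_error ?F (I_op \<alpha>) M A"
  proof (rule ran_lower_bound[where P = "\<lambda>_. True" and f = ?f and g = ?f and a = "1 / K", OF alg _ card])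
    fix A :: "('a levels, 'a, 'a) det_alg"
    assume A: "det_algorithm std_info A"
    let ?q = "\<lambda>B. real (card {t \<in> grid k. at_point k t \<in> all_asked A (?f B)})"
    let ?e = "\<lambda>B. norm (I_op \<alpha> (?f B) - alg_out A (?f B))"
    have "K * (v * 2 ^ k / 4) \<le> (\<Sum>B\<in>Pow (grid k). ?e B) + v / 2 ^ k * (\<Sum>B\<in>Pow (grid k). ?q B)"
      using sign_error_bound[OF A, of "grid k" k 1 \<alpha>] by (simp add: cT sq v_def K_def)
    then have "v * 2 ^ k / 4 \<le> 1 / K * (\<Sum>B\<in>Pow (grid k). ?e B) + (v / 2 ^ k / K) * (\<Sum>B\<in>Pow (grid k). ?q B)"
      using K by (simp add: field_simps)
    then have "ennreal (v * 2 ^ k / 4) \<le> (\<Sum>B\<in>Pow (grid k). ennreal (1 / K) * ennreal (?e B)) +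
       (\<Sum>B\<in>Pow (grid k). ennreal (v / 2 ^ k / K) * ennreal (?q B))"
      using K v by (intro sum_ennreal_split) auto
    also have "\<dots> \<le> (\<Sum>B\<in>Pow (grid k). ennreal (1 / K) * ennreal (?e B)) +
       (\<Sum>B\<in>Pow (grid k). ennreal (v / 2 ^ k / K) * ennreal_of_enat (alg_card A (?f B)))"
      by (intro add_mono order_refl sum_mono mult_left_mono card_le_alg_card
          inj_on_subset[OF inj_at_point]) auto
    finally show "ennreal (v * 2 ^ k / 4) \<le> \<dots>" .
  qed (use K v ball cP in auto)
  also have "v * 2 ^ k / 4 - (v / 2 ^ k / K) * real (card (Pow (grid k))) * real n = v * 2 ^ k / 4 - v / 2 ^ k * real n"
    using K cP by simp
  finally have le: "ennreal (v * 2 ^ k / 4 - v / 2 ^ k * real n) \<le> ran_error ?F (I_op \<alpha>) M A" .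
  have four: "(4::real) ^ k = 2 ^ k * 2 ^ k" by (simp flip: power_mult_distrib)
  have "real n \<le> 2 ^ k * 2 ^ k / 16" using of_nat_mono[OF n, where 'a = real] four by simp
  then have "v / 2 ^ k * real n \<le> v / 2 ^ k * (2 ^ k * 2 ^ k / 16)" using v by (intro mult_left_mono) auto
  also have "\<dots> = v * 2 ^ k / 16" by (simp add: field_simps)
  finally have "v * 2 ^ k / 8 \<le> v * 2 ^ k / 4 - v / 2 ^ k * real n"
    using mult_nonneg_nonneg[OF v, of "2 ^ k"] zero_le_power[of "2 :: real" k] by linarith
  then have "ennreal (v * 2 ^ k / 8) \<le> ran_error ?F (I_op \<alpha>) M A"
    by (rule order_trans[OF ennreal_leI le])
  moreover have "v * 2 ^ k / 8 = 2 powr (- \<alpha> * real k) / 2 ^ k / 8" by (simp add: v_def four)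
  ultimately show "ennreal (2 powr (- \<alpha> * real k) / 2 ^ k / 8) \<le> ran_error ?F (I_op \<alpha>) M A"
    by simp
qed

text \<open>
  Signs on a block that is itself chosen at random from a disjoint family. The hypothesis
  \<open>same\<close> says that the points of the block that the algorithm sees are those that it sees in
  the zero function. Thus the blocks share the queries made on one single input, and on average a block
  receives only the fraction \<open>1 / card I\<close> of them.
\<close>

lemma ran_error_ge_random_block:
  fixes p \<alpha> h :: real and u p1 :: ereal and T :: "'i \<Rightarrow> (nat \<times> nat) set"
  assumes alg: "ran_algorithm (X_ball (ereal p) u p1 :: ('a::{real_normed_field, banach} levels) set) std_info M A"
    and card: "ran_card (X_ball (ereal p) u p1) M A \<le> of_nat n"
    and P: "\<forall>\<omega>\<in>space M. P (A \<omega>)"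
    and pq: "1 \<le> p" "1 \<le> u" "1 \<le> p1" and h: "0 \<le> h"
    and I: "finite I" "I \<noteq> {}" "\<And>i. i \<in> I \<Longrightarrow> T i \<subseteq> grid k" "\<And>i. i \<in> I \<Longrightarrow> card (T i) = \<tau>"
      "disjoint_family_on T I" "0 < \<tau>"
    and ball: "\<And>i B. i \<in> I \<Longrightarrow> (signs_on k (T i) h B :: 'a levels) \<in> X_ball (ereal p) u p1"
    and same: "\<And>A i B. P A \<Longrightarrow> i \<in> I \<Longrightarrow> {t \<in> T i. at_point k t \<in> all_asked A (signs_on k (T i) h B)}
        = {t \<in> T i. at_point k t \<in> all_asked A (\<lambda>_ _ _. 0)}"
    and n: "16 * n \<le> \<tau> * card I"
  shows "ennreal (2 powr (- \<alpha> * real k) / 4 ^ k * h * sqrt \<tau> / 8)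
    \<le> ran_error (X_ball (ereal p) u p1) (I_op \<alpha>) M A"
proof -
  let ?F = "X_ball (ereal p) u p1 :: ('a levels) set"
  let ?f = "\<lambda>(i, B). signs_on k (T i) h B :: 'a levels"
  define v where "v = 2 powr (- \<alpha> * real k) / 4 ^ k * h"
  have v: "0 \<le> v" using h by (simp add: v_def)
  define K :: real where "K = 2 ^ \<tau>"
  have K: "K > 0" by (simp add: K_def)
  define m where "m = real (card I)"
  have m: "m > 0" using I by (simp add: m_def card_gt_0_iff)
  have finT: "finite (T i)" if "i \<in> I" for i using I(3)[OF that] finite_subset by blast
  have s: "sqrt \<tau> > 0" "sqrt \<tau> * sqrt \<tau> = \<tau>" using I by auto
  have "ennreal (v * sqrt \<tau> / 4 - (v / (sqrt \<tau> * m)) * real (card {()}) * real n) \<le> ran_error ?F (I_op \<alpha>) M A"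
  proof (rule ran_lower_bound[where P = P and f = ?f and I = "Sigma I (\<lambda>i. Pow (T i))"
        and g = "\<lambda>_. \<lambda>_ _ _. 0" and a = "1 / (m * K)", OF alg P card])
    show "1 / (m * K) * real (card (Sigma I (\<lambda>i. Pow (T i)))) = 1"
      using I K m finT by (simp add: card_SigmaI card_Pow K_def m_def)
    show "(\<lambda>_ _ _ _. 0) ` {()} \<subseteq> ?F" using zero_in_X_ball[of "ereal p" u p1] pq by auto
    fix A :: "('a levels, 'a, 'a) det_alg"
    assume A: "det_algorithm std_info A" and PA: "P A"
    let ?q = "\<lambda>i. real (card {t \<in> T i. at_point k t \<in> all_asked A (\<lambda>_ _ _. 0)})"
    let ?e = "\<lambda>i B. norm (I_op \<alpha> (signs_on k (T i) h B) - alg_out A (signs_on k (T i) h B))"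
    let ?Q = "{t \<in> grid k. at_point k t \<in> all_asked A (\<lambda>_ _ _. 0)}"
    have one: "K * (v * sqrt \<tau> / 4) \<le> (\<Sum>B\<in>Pow (T i). ?e i B) + v / sqrt \<tau> * (K * ?q i)" if i: "i \<in> I" for i
    proof -
      have "T i \<noteq> {}" using I(4)[OF i] I(6) by auto
      note sign_error_bound[OF A I(3)[OF i] this h, of \<alpha>]
      then show ?thesis
        using finT[OF i] unfolding same[OF PA i] by (simp add: I(4)[OF i] K_def v_def card_Pow)
    qed
    have "(\<Sum>i\<in>I. K * (v * sqrt \<tau> / 4)) \<le> (\<Sum>i\<in>I. (\<Sum>B\<in>Pow (T i). ?e i B) + v / sqrt \<tau> * (K * ?q i))"
      by (intro sum_mono one)
    also have "\<dots> = (\<Sum>x\<in>Sigma I (\<lambda>i. Pow (T i)). ?e (fst x) (snd x)) + v / sqrt \<tau> * (K * (\<Sum>i\<in>I. ?q i))"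
    proof -
      have "(\<Sum>i\<in>I. \<Sum>B\<in>Pow (T i). ?e i B) = (\<Sum>(i, B)\<in>Sigma I (\<lambda>i. Pow (T i)). ?e i B)"
        using I(1) finT by (intro sum.Sigma) auto
      then show ?thesis by (simp add: sum.distrib sum_distrib_left case_prod_unfold)
    qed
    also have "(\<Sum>i\<in>I. ?q i) = real (card (\<Union>i\<in>I. {t \<in> T i. at_point k t \<in> all_asked A (\<lambda>_ _ _. 0)}))"
      using I(1,5) finT by (subst card_UN_disjoint) (auto simp: disjoint_family_on_def)
    also have "\<dots> \<le> real (card ?Q)"
      using I(3) by (intro of_nat_mono card_mono) auto
    finally have "m * K * (v * sqrt \<tau> / 4) \<le>
       (\<Sum>x\<in>Sigma I (\<lambda>i. Pow (T i)). ?e (fst x) (snd x)) + v / sqrt \<tau> * (K * real (card ?Q))"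
      using v K s by (simp add: m_def mult_left_mono divide_right_mono)
    then have "v * sqrt \<tau> / 4 \<le> 1 / (m * K) * (\<Sum>x\<in>Sigma I (\<lambda>i. Pow (T i)). ?e (fst x) (snd x))
       + v / (sqrt \<tau> * m) * (\<Sum>y\<in>{()}. real (card ?Q))"
      using v K s m by (simp add: field_simps)
    then have "ennreal (v * sqrt \<tau> / 4) \<le>
       (\<Sum>x\<in>Sigma I (\<lambda>i. Pow (T i)). ennreal (1 / (m * K)) * ennreal (?e (fst x) (snd x)))
       + (\<Sum>y\<in>{()}. ennreal (v / (sqrt \<tau> * m)) * ennreal (real (card ?Q)))"
      using K m v s I(1) finT by (intro sum_ennreal_split) auto
    also have "\<dots> \<le> (\<Sum>x\<in>Sigma I (\<lambda>i. Pow (T i)). ennreal (1 / (m * K)) * ennreal (?e (fst x) (snd x)))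
       + (\<Sum>y\<in>{()}. ennreal (v / (sqrt \<tau> * m)) * ennreal_of_enat (alg_card A (\<lambda>_ _ _. 0)))"
      by (intro add_mono order_refl sum_mono mult_left_mono card_le_alg_card
          inj_on_subset[OF inj_at_point]) auto
    finally show "ennreal (v * sqrt \<tau> / 4) \<le> (\<Sum>x\<in>Sigma I (\<lambda>i. Pow (T i)). ennreal (1 / (m * K)) *
         ennreal (norm (I_op \<alpha> (?f x) - alg_out A (?f x))))
       + (\<Sum>y\<in>{()}. ennreal (v / (sqrt \<tau> * m)) * ennreal_of_enat (alg_card A (\<lambda>_ _ _. 0)))"
      by (simp add: case_prod_unfold)
  qed (use K v m s I(1) finT ball in auto)
  also have "v * sqrt \<tau> / 4 - (v / (sqrt \<tau> * m)) * real (card {()}) * real n = v * sqrt \<tau> / 4 - v / (sqrt \<tau> * m) * real n"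
    by simp
  finally have le: "ennreal (v * sqrt \<tau> / 4 - v / (sqrt \<tau> * m) * real n) \<le> ran_error ?F (I_op \<alpha>) M A" .
  have "real n \<le> \<tau> * m / 16" using of_nat_mono[OF n, where 'a = real] by (simp add: m_def)
  then have "v / (sqrt \<tau> * m) * real n \<le> v / (sqrt \<tau> * m) * (\<tau> * m / 16)"
    using v s m by (intro mult_left_mono) auto
  also have "\<dots> = v * sqrt \<tau> / 16" using s m by (simp add: field_simps)
  finally have "v * sqrt \<tau> / 8 \<le> v * sqrt \<tau> / 4 - v / (sqrt \<tau> * m) * real n"
    using mult_nonneg_nonneg[OF v, of "sqrt \<tau>"] s(1) by linarith
  then show ?thesis
    unfolding v_def[symmetric] by (rule order_trans[OF ennreal_leI le])
qed

text \<open>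
  As long as the spike has not been found, the algorithm behaves as on the zero function; this verifies
  the hypothesis \<open>same\<close> for single points even for adaptive algorithms.
\<close>

lemma e_ran_ge_spike:
  fixes p \<alpha> :: real and u p1 :: ereal
  assumes pq: "1 \<le> p" "1 \<le> u" "1 \<le> p1" and n: "16 * n \<le> 4 ^ k"
  shows "ennreal (2 powr (- \<alpha> * real k) / 4 ^ k * (2 ^ k) powr (1 / p + real_of_ereal (1 / u)) / 8)
    \<le> e_ran (X_ball (ereal p) u p1 :: ('a::{real_normed_field, banach} levels) set) (I_op \<alpha>) std_info n"
  unfolding e_ran_def
proof (rule INF_greatest, clarify)
  let ?F = "X_ball (ereal p) u p1 :: ('a levels) set"
  define h :: real where "h = (2 ^ k) powr (1 / p + real_of_ereal (1 / u))"
  fix M :: "('a levels, 'a, 'a) det_alg measure"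
    and A :: "('a levels, 'a, 'a) det_alg \<Rightarrow> ('a levels, 'a, 'a) det_alg"
  assume alg: "ran_algorithm ?F std_info M A" and card: "ran_card ?F M A \<le> of_nat n"
  have "ennreal (2 powr (- \<alpha> * real k) / 4 ^ k * h * sqrt (real 1) / 8) \<le> ran_error ?F (I_op \<alpha>) M A"
  proof (rule ran_error_ge_random_block[where P = "det_algorithm std_info" and I = "grid k" and T = "\<lambda>t. {t}", OF alg card _ pq])
    show "\<forall>\<omega>\<in>space M. det_algorithm std_info (A \<omega>)" using alg by (simp add: ran_algorithm_def)
    show "16 * n \<le> 1 * card (grid k)" using n by (simp add: card_cartesian_product flip: power_mult_distrib)
    show "signs_on k {i} h B \<in> ?F" if "i \<in> grid k" for i B
      using that by (intro signs_on_in_ball[OF pq]) (auto simp: h_def)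
    fix A :: "('a levels, 'a, 'a) det_alg" and t B
    assume A: "det_algorithm std_info A"
    let ?f = "signs_on k {t} h B :: 'a levels" and ?z = "\<lambda>_ _ _. 0 :: 'a"
    have eq: "L ?f = L ?z" if "L \<in> std_info" "L \<noteq> at_point k t" for L
      using that by (auto simp: std_info_def signs_on_def at_point_def)
    have std: "all_asked A g \<subseteq> std_info" for g
      using A by (auto simp: all_asked_altdef det_algorithm_def)
    have "(at_point k t \<in> all_asked A ?f) = (at_point k t \<in> all_asked A ?z)"
    proof (rule ccontr)
      assume "(at_point k t \<in> all_asked A ?f) \<noteq> (at_point k t \<in> all_asked A ?z)"
      then consider "at_point k t \<notin> all_asked A ?f" "at_point k t \<in> all_asked A ?z"
        | "at_point k t \<in> all_asked A ?f" "at_point k t \<notin> all_asked A ?z" by blast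
      then show False
      proof cases
        case 1
        have "\<forall>L\<in>all_asked A ?f. L ?f = L ?z"
        proof
          fix L assume "L \<in> all_asked A ?f"
          with 1 std[of ?f] show "L ?f = L ?z" by (intro eq) auto
        qed
        from all_asked_cong(1)[OF this] 1 show False by simp
      next
        case 2
        have "\<forall>L\<in>all_asked A ?z. L ?z = L ?f"
        proof
          fix L assume "L \<in> all_asked A ?z"
          with 2 std[of ?z] show "L ?z = L ?f" by (intro eq[symmetric]) auto
        qed
        from all_asked_cong(1)[OF this] 2 show False by simp
      qed
    qed
    then show "{s \<in> {t}. at_point k s \<in> all_asked A ?f} = {s \<in> {t}. at_point k s \<in> all_asked A ?z}" by auto
  qed (auto simp: disjoint_family_on_def h_def)
  then show "ennreal (2 powr (- \<alpha> * real k) / 4 ^ k * (2 ^ k) powr (1 / p + real_of_ereal (1 / u)) / 8)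
    \<le> ran_error ?F (I_op \<alpha>) M A" by (simp add: h_def)
qed

text \<open>
  A nonadaptive algorithm queries the same points for every input, which gives \<open>same\<close> for
  whole rows. An adaptive one could spend its remaining queries on the row once it has seen a nonzero
  value.
\<close>

lemma e_ran_non_ge_random_row:
  fixes p \<alpha> :: real and u p1 :: ereal
  assumes pq: "1 \<le> p" "1 \<le> u" "1 \<le> p1" and n: "16 * n \<le> 4 ^ k"
  shows "ennreal (2 powr (- \<alpha> * real k) / 4 ^ k * (2 ^ k) powr (1 / p) * sqrt (2 ^ k) / 8)
    \<le> e_ran_non (X_ball (ereal p) u p1 :: ('a::{real_normed_field, banach} levels) set) (I_op \<alpha>) std_info n"
  unfolding e_ran_non_def
proof (rule INF_greatest, clarify)
  let ?F = "X_ball (ereal p) u p1 :: ('a levels) set"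
  define h :: real where "h = (2 ^ k) powr (1 / p)"
  fix M :: "('a levels, 'a, 'a) det_alg measure"
    and A :: "('a levels, 'a, 'a) det_alg \<Rightarrow> ('a levels, 'a, 'a) det_alg"
  assume alg: "ran_algorithm ?F std_info M A" and non: "\<forall>\<omega>\<in>space M. nonadaptive (A \<omega>)"
    and card: "ran_card ?F M A \<le> of_nat n"
  have "ennreal (2 powr (- \<alpha> * real k) / 4 ^ k * h * sqrt (real (2 ^ k)) / 8) \<le> ran_error ?F (I_op \<alpha>) M A"
  proof (rule ran_error_ge_random_block[where P = nonadaptive and I = "{1..2 ^ k}" and T = "\<lambda>i. {i} \<times> {1..2 ^ k}",
        OF alg card non pq])
    show "16 * n \<le> 2 ^ k * card {1..(2::nat) ^ k}" using n by (simp flip: power_mult_distrib)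
    show "signs_on k ({i} \<times> {1..2 ^ k}) h B \<in> ?F" if "i \<in> {1..2 ^ k}" for i B
      using that by (intro signs_on_in_ball[OF pq]) (auto simp: h_def)
  qed (auto simp: disjoint_family_on_def h_def dest: nonadaptive_all_asked)
  then show "ennreal (2 powr (- \<alpha> * real k) / 4 ^ k * (2 ^ k) powr (1 / p) * sqrt (2 ^ k) / 8)
    \<le> ran_error ?F (I_op \<alpha>) M A" by (simp add: h_def)
qed

text \<open>
  The block consists of the points that are not queried on the zero function, so both constant choices of
  signs on it look like zero.
\<close>

lemma e_det_ge_fooling:
  fixes p \<alpha> :: real and u p1 :: ereal
  assumes pq: "1 \<le> p" "1 \<le> u" "1 \<le> p1" and n: "16 * n \<le> 4 ^ k"
  shows "ennreal (2 powr (- \<alpha> * real k) / 8)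
    \<le> e_det (X_ball (ereal p) u p1 :: ('a::{real_normed_field, banach} levels) set) (I_op \<alpha>) std_info n"
  unfolding e_det_def
proof (rule INF_greatest, clarify)
  let ?F = "X_ball (ereal p) u p1 :: ('a levels) set" and ?z = "\<lambda>_ _ _. 0 :: 'a"
  fix A :: "('a levels, 'a, 'a) det_alg"
  assume A: "det_algorithm std_info A" and card: "(SUP f\<in>?F. alg_card A f) \<le> enat n"
  define Q where "Q = {t \<in> grid k. at_point k t \<in> all_asked A ?z}"
  define T where "T = grid k - Q"
  let ?f = "\<lambda>B. signs_on k T 1 B :: 'a levels"
  have ball: "?f B \<in> ?F" for B by (rule signs_on_in_ball[OF pq]) (auto simp: T_def)
  have "ennreal (real (card Q)) \<le> ennreal_of_enat (alg_card A ?z)"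
    unfolding Q_def by (intro card_le_alg_card inj_on_subset[OF inj_at_point]) auto
  also have "alg_card A ?z \<le> enat n"
    by (rule order_trans[OF SUP_upper card]) (use zero_in_X_ball[of "ereal p" u p1] pq in simp)
  finally have "card Q \<le> n"
    by (simp add: ennreal_of_enat_le_iff ennreal_of_nat_eq_real_of_nat)
  have "card T = 4 ^ k - card Q"
    unfolding T_def by (subst card_Diff_subset) (auto simp: Q_def card_cartesian_product simp flip: power_mult_distrib)
  then have "4 ^ k \<le> 8 * card T" using n \<open>card Q \<le> n\<close> by linarith
  then have large: "4 ^ k \<le> 8 * real (card T)" using of_nat_mono[where 'a = real] by fastforce
  have "alg_out A (?f B) = alg_out A ?z" for B
  proof (rule all_asked_cong(2), rule ballI)
    fix L assume L: "L \<in> all_asked A ?z"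
    then have "L \<in> std_info" using A by (auto simp: all_asked_altdef det_algorithm_def)
    then obtain k' i j where "L = (\<lambda>f. f k' i j)" "(i, j) \<in> grid k'" by (auto simp: std_info_def)
    then show "L ?z = L (?f B)" using L by (auto simp: signs_on_def T_def Q_def at_point_def)
  qed
  then have out: "alg_out A (?f {}) = alg_out A (?f T)" by simp
  have I: "norm (I_op \<alpha> (?f T) - I_op \<alpha> (?f {})) = 2 * (2 powr (- \<alpha> * real k) / 4 ^ k * real (card T))"
  proof -
    have "(\<Sum>t\<in>T. eps T t) = real (card T)" "(\<Sum>t\<in>T. eps {} t) = - real (card T)"
      by (simp_all add: eps_def)
    then have "I_op \<alpha> (?f T) - I_op \<alpha> (?f {}) = of_real (2 * (2 powr (- \<alpha> * real k) / 4 ^ k * real (card T)))"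
      by (subst (1 2) I_op_signs_on) (auto simp: T_def)
    then show ?thesis by (simp only: norm_of_real) simp
  qed
  define x where "x = 2 powr (- \<alpha> * real k) / 8"
  have "x * 4 ^ k \<le> x * (8 * real (card T))"
    using large by (intro mult_left_mono) (auto simp: x_def)
  then have "2 * x \<le> norm (I_op \<alpha> (?f T) - I_op \<alpha> (?f {}))" unfolding I by (simp add: x_def field_simps)
  also have "\<dots> = norm ((I_op \<alpha> (?f T) - alg_out A (?f T)) - (I_op \<alpha> (?f {}) - alg_out A (?f {})))"
    by (simp add: out)
  also have "\<dots> \<le> norm (I_op \<alpha> (?f T) - alg_out A (?f T)) + norm (I_op \<alpha> (?f {}) - alg_out A (?f {}))"
    by (rule norm_triangle_ineq4)
  finally have "x \<le> norm (I_op \<alpha> (?f T) - alg_out A (?f T)) \<or> x \<le> norm (I_op \<alpha> (?f {}) - alg_out A (?f {}))"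
    by linarith
  then obtain B where "x \<le> norm (I_op \<alpha> (?f B) - alg_out A (?f B))" by blast
  then have "ennreal x \<le> ennreal (norm (I_op \<alpha> (?f B) - alg_out A (?f B)))" by (rule ennreal_leI)
  also have "\<dots> \<le> det_error ?F (I_op \<alpha>) A" unfolding det_error_def by (rule SUP_upper[OF ball])
  finally show "ennreal (2 powr (- \<alpha> * real k) / 8) \<le> det_error ?F (I_op \<alpha>) A" by (simp add: x_def)
qed

section \<open>Two-stage algorithms\<close>

type_synonym pos = "nat \<times> nat \<times> nat"

definition val :: "('a levels) \<Rightarrow> pos \<Rightarrow> 'a" where
  "val f q = (case q of (k, i, j) \<Rightarrow> f k i j)"

definition valid :: "pos \<Rightarrow> bool" where
  "valid q = (case q of (k, i, j) \<Rightarrow> i \<in> {1..2 ^ k} \<and> j \<in> {1..2 ^ k})"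

text \<open>
  The information received so far, as a function with default value \<open>0\<close> at the points that
  have not been queried. It allows the second stage and the output to be given as functions of
  \<open>f\<close> itself, which read \<open>f\<close> only at the queried points.
\<close>

definition tab :: "pos list \<Rightarrow> 'a list \<Rightarrow> 'a::zero levels" where
  "tab qs xs k i j = (case map_of (zip qs xs) (k, i, j) of Some x \<Rightarrow> x | None \<Rightarrow> 0)"

lemma tab_val:
  assumes "(k, i, j) \<in> set qs"
  shows "tab qs (map (val f) qs) k i j = f k i j"
proof -
  have "map_of (zip qs (map (val f) qs)) (k, i, j) = Some (val f (k, i, j))"
    using assms by (simp add: map_of_zip_map)
  then show ?thesis by (simp add: tab_def val_def)
qed

text \<open>
  The list of points for the second stage depends on the values from the first one, and
  \<open>\<Phi>\<close> on all values. Positions outside the grid are replaced by \<open>(0, 1,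
  1)\<close>, so that every list of values leads to an admissible query.
\<close>

definition two_stage ::
  "pos list \<Rightarrow> (('a::zero levels) \<Rightarrow> pos list) \<Rightarrow> (('a levels) \<Rightarrow> 'g)
    \<Rightarrow> ('a levels, 'a, 'g) det_alg" where
  "two_stage P1 P2 \<Phi> =
    (let plan = (\<lambda>xs. P1 @ P2 (tab P1 (take (length P1) xs))) in
     \<lparr> query = (\<lambda>xs f. val f (let q = (if length xs < length P1 then P1 ! length xs else plan xs ! length xs)
          in if valid q then q else (0, 1, 1))),
       stop = (\<lambda>xs. length P1 \<le> length xs \<and> length (plan xs) \<le> length xs),
       result = (\<lambda>xs. \<Phi> (tab (plan xs) xs)) \<rparr>)"

lemma valid_default: "valid (0, 1, 1)"
  by (simp add: valid_def)

lemma det_algorithm_two_stage: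
  fixes P2 :: "('a::zero levels) \<Rightarrow> pos list"
  shows "det_algorithm std_info (two_stage P1 P2 \<Phi>)"
proof -
  have "(\<lambda>f :: 'a levels. val f q) \<in> std_info" if "valid q" for q
    using that by (auto simp: std_info_def val_def valid_def split: prod.splits)
  then show ?thesis
    using valid_default unfolding det_algorithm_def two_stage_def Let_def by (simp del: One_nat_def)
qed

lemma nonadaptive_two_stage: "nonadaptive (two_stage P1 (\<lambda>_. P2) \<Phi>)"
  unfolding nonadaptive_def two_stage_def Let_def by simp

text \<open>
  If \<open>P2\<close> and \<open>\<Phi>\<close> read only what has been queried, the table can be
  replaced by \<open>f\<close>.
\<close>

lemma two_stage_run:
  fixes f :: "'a::zero levels"
  assumes valid: "list_all valid P1" "\<And>g. list_all valid (P2 g)"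
    and P2: "\<And>f g. (\<And>k i j. (k, i, j) \<in> set P1 \<Longrightarrow> f k i j = g k i j) \<Longrightarrow> P2 f = P2 g"
    and \<Phi>: "\<And>f g. (\<And>k i j. (k, i, j) \<in> set P1 \<union> set (P2 f) \<Longrightarrow> f k i j = g k i j) \<Longrightarrow> \<Phi> f = \<Phi> g"
  shows "alg_card (two_stage P1 P2 \<Phi>) f = enat (length P1 + length (P2 f))"
    and "alg_out (two_stage P1 P2 \<Phi>) f = \<Phi> f"
proof -
  let ?A = "two_stage P1 P2 \<Phi>" and ?n = "length P1 + length (P2 f)"
  define ps where "ps = P1 @ P2 f"
  have plan: "P2 (tab P1 (take (length P1) (map (val f) (take n ps)))) = P2 f" if "length P1 \<le> n" for n
  proof -
    have "take (length P1) (map (val f) (take n ps)) = map (val f) P1"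
      using that by (simp add: ps_def take_map min_absorb1 flip: map_append)
    then show ?thesis by (auto intro!: P2 simp: tab_val)
  qed
  have all_valid: "list_all valid ps" using valid by (simp add: ps_def)
  have info: "info ?A f n = map (val f) (take n ps)" if "n \<le> ?n" for n
    using that
  proof (induction n)
    case (Suc n)
    then have n: "n < length ps" and IH: "info ?A f n = map (val f) (take n ps)" by (auto simp: ps_def)
    have len: "length (map (val f) (take n ps)) = n" using n by simp
    have "query ?A (map (val f) (take n ps)) f = val f (ps ! n)"
    proof (cases "n < length P1")
      case True
      then have "valid (P1 ! n)" using valid by (simp add: list_all_length)
      then show ?thesis using True unfolding two_stage_def Let_def
        by (simp only: det_alg.simps len if_True) (simp add: ps_def nth_append)
    next
      case False
      then have "valid (ps ! n)" using all_valid n by (simp add: list_all_length)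
      then show ?thesis using False plan[of n] unfolding two_stage_def Let_def det_alg.simps len
        by (simp add: ps_def)
    qed
    then show ?case using n by (simp add: IH take_Suc_conv_app_nth)
  qed simp
  have stop: "stop ?A (info ?A f n) \<longleftrightarrow> n = ?n" if "n \<le> ?n" for n
  proof -
    have len: "length (map (val f) (take n ps)) = n" using that by (simp add: ps_def)
    show ?thesis
      unfolding info[OF that] unfolding two_stage_def Let_def det_alg.simps len
      using plan[of n] that by (cases "length P1 \<le> n") auto
  qed
  have least: "(LEAST n. stop ?A (info ?A f n)) = ?n"
  proof (rule Least_equality)
    show "stop ?A (info ?A f ?n)" using stop by simp
    show "?n \<le> m" if "stop ?A (info ?A f m)" for m using that stop[of m] by linarith
  qed
  then show card: "alg_card ?A f = enat ?n" using stop[of ?n] unfolding alg_card_def by auto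
  have "alg_out ?A f = result ?A (map (val f) ps)"
    unfolding alg_out_def card using info[of ?n] by (simp add: ps_def)
  also have "\<dots> = \<Phi> (tab ps (map (val f) ps))"
    using plan[of "length ps"] unfolding two_stage_def Let_def by (simp add: ps_def)
  also have "\<dots> = \<Phi> f"
    by (intro \<Phi>[symmetric] tab_val[symmetric]) (simp add: ps_def)
  finally show "alg_out ?A f = \<Phi> f" .
qed

section \<open>Finite averages\<close>

definition avg :: "'x set \<Rightarrow> ('x \<Rightarrow> 'b::real_vector) \<Rightarrow> 'b" where
  "avg A h = (\<Sum>x\<in>A. h x) /\<^sub>R real (card A)"

lemma avg_cong: "(\<And>x. x \<in> A \<Longrightarrow> g x = h x) \<Longrightarrow> avg A g = avg A h"
  unfolding avg_def by (simp cong: sum.cong)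

lemma avg_const: "finite A \<Longrightarrow> A \<noteq> {} \<Longrightarrow> avg A (\<lambda>_. c) = c"
  by (simp add: avg_def sum_constant_scaleR)

lemma avg_add: "avg A (\<lambda>x. g x + h x) = avg A g + avg A h"
  by (simp add: avg_def sum.distrib scaleR_add_right)

lemma avg_diff: "avg A (\<lambda>x. g x - h x) = avg A g - avg A h"
  by (simp add: avg_def sum_subtractf scaleR_diff_right)

lemma avg_sum: "avg A (\<lambda>x. \<Sum>i\<in>I. g i x) = (\<Sum>i\<in>I. avg A (g i))"
  unfolding avg_def by (subst sum.swap) (simp add: scaleR_sum_right)

lemma avg_cmult: "avg A (\<lambda>x. c * h x) = c * avg A h" for h :: "'x \<Rightarrow> 'b::real_algebra"
  by (simp add: avg_def flip: sum_distrib_left)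

lemma avg_scaleR: "avg A (\<lambda>x. c *\<^sub>R h x) = c *\<^sub>R avg A h"
  by (simp add: avg_def flip: scaleR_sum_right)

lemma avg_mono: "(\<And>x. x \<in> A \<Longrightarrow> g x \<le> h x) \<Longrightarrow> avg A g \<le> (avg A h :: real)"
  unfolding avg_def by (intro scaleR_left_mono sum_mono) auto

lemma avg_nonneg: "(\<And>x. x \<in> A \<Longrightarrow> 0 \<le> h x) \<Longrightarrow> 0 \<le> (avg A h :: real)"
  unfolding avg_def by (simp add: sum_nonneg)

lemma avg_inner_left: "avg A (\<lambda>x. h x \<bullet> c) = avg A h \<bullet> c" for c :: "'b::real_inner"
  by (simp add: avg_def inner_sum_left)

lemma avg_inner_right: "avg A (\<lambda>x. c \<bullet> h x) = c \<bullet> avg A h" for c :: "'b::real_inner"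
  by (simp add: avg_def inner_sum_right)

lemma avg_power2_le: "(avg A h)\<^sup>2 \<le> avg A (\<lambda>x. (h x)\<^sup>2)" for h :: "'x \<Rightarrow> real"
proof (cases "finite A \<and> A \<noteq> {}")
  case True
  define m where "m = avg A h"
  have "0 \<le> avg A (\<lambda>x. (h x - m)\<^sup>2)" by (intro avg_nonneg) simp
  also have "\<dots> = avg A (\<lambda>x. (h x)\<^sup>2 - 2 * m * h x + m\<^sup>2)"
    by (intro avg_cong) (simp add: power2_diff algebra_simps)
  also have "\<dots> = avg A (\<lambda>x. (h x)\<^sup>2) - m\<^sup>2"
    using True by (simp add: avg_add avg_diff avg_cmult avg_const m_def power2_eq_square)
  finally show ?thesis by (simp add: m_def)
qed (auto simp: avg_def)

lemma avg_le_sqrt: "avg A h \<le> sqrt (avg A (\<lambda>x. (h x)\<^sup>2))"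
  by (intro real_le_rsqrt avg_power2_le)

lemma avg_norm_sq_diff:
  fixes h :: "'x \<Rightarrow> 'b::real_inner"
  assumes "finite A" "A \<noteq> {}"
  shows "avg A (\<lambda>x. (norm (h x - avg A h))\<^sup>2) = avg A (\<lambda>x. (norm (h x))\<^sup>2) - (norm (avg A h))\<^sup>2"
proof -
  define m where "m = avg A h"
  have "avg A (\<lambda>x. (norm (h x - m))\<^sup>2) = avg A (\<lambda>x. (norm (h x))\<^sup>2 - 2 * (h x \<bullet> m) + (norm m)\<^sup>2)"
    by (intro avg_cong) (simp add: power2_norm_eq_inner inner_diff inner_commute algebra_simps)
  also have "\<dots> = avg A (\<lambda>x. (norm (h x))\<^sup>2) - (norm m)\<^sup>2"
    using assms by (simp add: avg_add avg_diff avg_cmult avg_const avg_inner_left power2_norm_eq_inner m_def)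
  finally show ?thesis by (simp add: m_def)
qed

lemma avg_Pair: "avg (A \<times> B) h = avg A (\<lambda>x. avg B (\<lambda>y. h (x, y)))"
  by (simp add: avg_def card_cartesian_product sum.cartesian_product scaleR_sum_right)

section \<open>Independent uniform samples\<close>

lemma avg_PiE_insert:
  assumes J: "finite J" "a \<notin> J"
  shows "avg (PiE (insert a J) B) h = avg (B a) (\<lambda>x. avg (PiE J B) (\<lambda>\<omega>. h (fun_upd \<omega> a x)))"
proof -
  have inj: "inj_on (\<lambda>(y, g). fun_upd g a y) (B a \<times> PiE J B)"
    using inj_combinator[OF J(2)] .
  have "avg (PiE (insert a J) B) h = avg (B a \<times> PiE J B) (\<lambda>(x, \<omega>). h (fun_upd \<omega> a x))"
    unfolding PiE_insert_eq avg_def by (subst sum.reindex[OF inj], subst card_image[OF inj]) (simp add: case_prod_unfold comp_def)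
  then show ?thesis by (simp add: avg_Pair)
qed

lemma
  assumes J: "finite J" and B: "\<forall>a\<in>J. finite (B a) \<and> B a \<noteq> {}"
  shows finite_samples: "finite (PiE J B)" and samples_nonempty: "PiE J B \<noteq> {}"
  using assms by (auto simp: finite_PiE PiE_eq_empty_iff)

lemma avg_one_sample:
  assumes J: "finite J" and B: "\<forall>a\<in>J. finite (B a) \<and> B a \<noteq> {}" and a: "a \<in> J"
  shows "avg (PiE J B) (\<lambda>\<omega>. h (\<omega> a)) = avg (B a) h"
proof -
  have "avg (PiE (insert a (J - {a})) B) (\<lambda>\<omega>. h (\<omega> a)) = avg (B a) h"
    using J B by (subst avg_PiE_insert) (auto intro!: avg_cong avg_const finite_PiE simp: PiE_eq_empty_iff)
  then show ?thesis using a by (simp add: insert_absorb)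
qed

lemma avg_two_samples:
  assumes J: "finite J" and B: "\<forall>a\<in>J. finite (B a) \<and> B a \<noteq> {}" and a: "a \<in> J" "b \<in> J" "a \<noteq> b"
  shows "avg (PiE J B) (\<lambda>\<omega>. h (\<omega> a) (\<omega> b)) = avg (B a) (\<lambda>x. avg (B b) (h x))"
proof -
  have "avg (PiE (insert a (J - {a})) B) (\<lambda>\<omega>. h (\<omega> a) (\<omega> b))
     = avg (B a) (\<lambda>x. avg (PiE (J - {a}) B) (\<lambda>\<omega>. h x (\<omega> b)))"
    using J a by (subst avg_PiE_insert) auto
  also have "\<dots> = avg (B a) (\<lambda>x. avg (B b) (h x))"
    using J B a by (intro avg_cong avg_one_sample) auto
  finally show ?thesis using a by (simp add: insert_absorb)
qed

text \<open>
  Pairwise independence makes the mixed terms vanish.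
\<close>

lemma second_moment_independent_sum:
  fixes g :: "'a \<Rightarrow> 'x \<Rightarrow> 'b::real_inner"
  assumes J: "finite J" and B: "\<forall>a\<in>J. finite (B a) \<and> B a \<noteq> {}" and K: "K \<subseteq> J"
    and centred: "\<And>a. a \<in> K \<Longrightarrow> avg (B a) (g a) = 0"
  shows "avg (PiE J B) (\<lambda>\<omega>. (norm (\<Sum>a\<in>K. g a (\<omega> a)))\<^sup>2) = (\<Sum>a\<in>K. avg (B a) (\<lambda>x. (norm (g a x))\<^sup>2))"
proof -
  have KJ: "a \<in> J" if "a \<in> K" for a using K that by auto
  have fK: "finite K" using K J finite_subset by blast
  have "avg (PiE J B) (\<lambda>\<omega>. (norm (\<Sum>a\<in>K. g a (\<omega> a)))\<^sup>2)
      = (\<Sum>a\<in>K. \<Sum>b\<in>K. avg (PiE J B) (\<lambda>\<omega>. g a (\<omega> a) \<bullet> g b (\<omega> b)))"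
    by (simp add: power2_norm_eq_inner inner_sum_left inner_sum_right avg_sum)
      (subst sum.swap, rule refl)
  also have "\<dots> = (\<Sum>a\<in>K. \<Sum>b\<in>K. if b = a then avg (B a) (\<lambda>x. (norm (g a x))\<^sup>2) else 0)"
  proof (intro sum.cong refl)
    fix a b assume ab: "a \<in> K" "b \<in> K"
    show "avg (PiE J B) (\<lambda>\<omega>. g a (\<omega> a) \<bullet> g b (\<omega> b)) = (if b = a then avg (B a) (\<lambda>x. (norm (g a x))\<^sup>2) else 0)"
    proof (cases "a = b")
      case True
      then show ?thesis
        using avg_one_sample[OF J B KJ[OF ab(1)], where h = "\<lambda>x. g a x \<bullet> g a x"]
        by (simp add: power2_norm_eq_inner)
    next
      case False
      have "avg (PiE J B) (\<lambda>\<omega>. g a (\<omega> a) \<bullet> g b (\<omega> b)) = avg (B a) (\<lambda>x. avg (B b) (\<lambda>y. g a x \<bullet> g b y))"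
        using avg_two_samples[OF J B KJ[OF ab(1)] KJ[OF ab(2)] False, where h = "\<lambda>x y. g a x \<bullet> g b y"] by simp
      also have "\<dots> = 0" by (simp only: avg_inner_right centred[OF ab(2)] inner_zero_right) (simp add: avg_def)
      finally show ?thesis using False by simp
    qed
  qed
  also have "\<dots> = (\<Sum>a\<in>K. avg (B a) (\<lambda>x. (norm (g a x))\<^sup>2))" using fK by simp
  finally show ?thesis .
qed

section \<open>Means and norms\<close>

text \<open>
  Young's inequality \<open>x * c powr (q - 1) \<le> x powr q / q + (1 - 1 / q) * c powr q\<close>,
  averaged.
\<close>

lemma power_mean:
  fixes x :: "'i \<Rightarrow> real"
  assumes A: "finite A" "A \<noteq> {}" and q: "1 \<le> q" and x: "\<And>i. i \<in> A \<Longrightarrow> 0 \<le> x i" and c: "0 \<le> c"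
    and le: "avg A (\<lambda>i. x i powr q) \<le> c powr q"
  shows "avg A x \<le> c"
proof (cases "c = 0")
  case True
  then have "(\<Sum>i\<in>A. x i powr q) \<le> 0"
    using le q A by (simp add: avg_def zero_less_mult_iff mult_le_0_iff card_gt_0_iff)
  then have "(\<Sum>i\<in>A. x i powr q) = 0"
    by (intro antisym sum_nonneg) auto
  then have "\<forall>i\<in>A. x i = 0" using A by (subst (asm) sum_nonneg_eq_0_iff) auto
  then show ?thesis using True by (simp add: avg_def)
next
  case False
  then have c: "c > 0" using c by simp
  have young: "x i * c powr (q - 1) \<le> (1 / q) * x i powr q + (1 - 1 / q) * c powr q" if "i \<in> A" for i
  proof (cases "x i = 0")
    case True
    then show ?thesis using q c by simp
  next
    case False
    then have xi: "x i > 0" using x[OF that] by simp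
    have "(x i powr q) powr (1 / q) * (c powr q) powr (1 - 1 / q) \<le> (1 / q) * x i powr q + (1 - 1 / q) * c powr q"
      using q xi c by (intro Youngs_inequality_0) auto
    moreover have "q * (1 - 1 / q) = q - 1" using q by (simp add: field_simps)
    ultimately show ?thesis using q xi c by (simp add: powr_powr)
  qed
  have "avg A x * c powr (q - 1) = avg A (\<lambda>i. c powr (q - 1) * x i)" unfolding avg_cmult by (rule mult.commute)
  also have "\<dots> \<le> avg A (\<lambda>i. (1 / q) * x i powr q + (1 - 1 / q) * c powr q)"
    by (rule avg_mono) (use young in \<open>simp add: mult.commute\<close>)
  also have "\<dots> = (1 / q) * avg A (\<lambda>i. x i powr q) + (1 - 1 / q) * c powr q"
    by (simp only: avg_add avg_cmult avg_const[OF A])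
  also have "\<dots> \<le> (1 / q) * c powr q + (1 - 1 / q) * c powr q"
    using le q by (intro add_right_mono mult_left_mono) auto
  also have "\<dots> = c * c powr (q - 1)"
    using q c powr_add[of c 1 "q - 1"] by (simp add: algebra_simps)
  finally show ?thesis using c by simp
qed

text \<open>
  The norm of \<open>\<ell>\<^sub>q\<close> is at most the norm of \<open>\<ell>\<^sub>1\<close>.
\<close>

lemma sum_powr_le_powr_sum:
  fixes y :: "'i \<Rightarrow> real"
  assumes "finite A" "1 \<le> q" "\<And>i. i \<in> A \<Longrightarrow> 0 \<le> y i" "(\<Sum>i\<in>A. y i) \<le> c"
  shows "(\<Sum>i\<in>A. y i powr q) \<le> c powr q"
proof -
  have le: "y i \<le> c" if "i \<in> A" for i
    using member_le_sum[OF that, of y] assms by auto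
  have c: "0 \<le> c" using order_trans[OF sum_nonneg[of A y] assms(4)] assms(3) by simp
  have "(\<Sum>i\<in>A. y i powr q) \<le> (\<Sum>i\<in>A. y i * c powr (q - 1))"
  proof (rule sum_mono)
    fix i assume i: "i \<in> A"
    show "y i powr q \<le> y i * c powr (q - 1)"
    proof (cases "y i = 0")
      case False
      then have "y i powr q = y i * y i powr (q - 1)"
        using assms(3)[OF i] powr_add[of "y i" 1 "q - 1"] by simp
      also have "\<dots> \<le> y i * c powr (q - 1)"
        using assms i le by (intro mult_left_mono powr_mono2) auto
      finally show ?thesis .
    qed simp
  qed
  also have "\<dots> = (\<Sum>i\<in>A. y i) * c powr (q - 1)" by (simp add: sum_distrib_right)
  also have "\<dots> \<le> c * c powr (q - 1)" using assms by (intro mult_right_mono) auto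
  also have "\<dots> = c powr q" using c powr_add[of c 1 "q - 1"] by (cases "c = 0") auto
  finally show ?thesis .
qed

lemma L_norm_avg: "L_norm (ereal r) N f = (avg {1..N} (\<lambda>j. norm (f j) powr r)) powr (1 / r)"
  by (simp add: L_norm_def avg_def divide_inverse)

lemma L_norm_powr:
  assumes "0 < r" shows "L_norm (ereal r) N f powr r = avg {1..N} (\<lambda>j. norm (f j) powr r)"
  using assms by (simp add: L_norm_avg powr_powr avg_nonneg)

lemma norm_le_L_norm_PInf: "j \<in> {1..N} \<Longrightarrow> norm (f j) \<le> L_norm \<infinity> N f"
  unfolding L_norm_def by simp

definition mean_sq :: "nat \<Rightarrow> (nat \<Rightarrow> 'a::real_normed_vector) \<Rightarrow> real" where
  "mean_sq N g = avg {1..N} (\<lambda>j. (norm (g j))\<^sup>2)"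

lemma mean_sq_nonneg: "0 \<le> mean_sq N g"
  unfolding mean_sq_def by (intro avg_nonneg) simp

lemma norm_sq_powr: "0 < r \<Longrightarrow> ((norm x)\<^sup>2) powr (r / 2) = norm x powr r"
  by (cases "x = 0") (simp_all add: powr_powr flip: powr_numeral)

lemma mean_sq_le_L_norm:
  assumes "2 < u" "1 \<le> N"
  shows "mean_sq N g \<le> (L_norm u N g)\<^sup>2"
proof (cases u)
  case (real r)
  then have r: "2 < r" using assms by simp
  have nn: "0 \<le> L_norm u N g" using assms L_norm_nonneg by blast
  show ?thesis unfolding mean_sq_def
  proof (rule power_mean[where q = "r / 2"])
    have "((L_norm u N g)\<^sup>2) powr (r / 2) = L_norm u N g powr r"
      using norm_sq_powr[of r "L_norm u N g"] nn r by simp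
    then show "avg {1..N} (\<lambda>i. ((norm (g i))\<^sup>2) powr (r / 2)) \<le> ((L_norm u N g)\<^sup>2) powr (r / 2)"
      using r real by (simp add: norm_sq_powr L_norm_powr)
  qed (use r assms in auto)
next
  case PInf
  have "mean_sq N g \<le> avg {1..N} (\<lambda>_. (L_norm u N g)\<^sup>2)"
    unfolding mean_sq_def PInf by (intro avg_mono power_mono norm_le_L_norm_PInf) auto
  then show ?thesis using assms by (simp add: avg_const)
qed (use assms in auto)

text \<open>
  The empirical mean of \<open>y\<close> is at least that of the truncation of \<open>y\<close> at
  \<open>L\<close>. If the truncation keeps at least half of the mean, Chebyshev's inequality applies to
  it, with a variance of at most \<open>L\<close> times the mean. Otherwise the mean is at most twice the
  part above \<open>L\<close>, and the probability is bounded by \<open>1\<close>.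
\<close>

lemma empirical_lower_tail:
  fixes y :: "'x \<Rightarrow> real" and B :: "'a \<Rightarrow> 'x set"
  assumes J: "finite J" and B: "\<forall>a\<in>J. finite (B a) \<and> B a \<noteq> {}" and K: "K \<subseteq> J" "K \<noteq> {}"
    and BK: "\<And>a. a \<in> K \<Longrightarrow> B a = C" and y: "\<And>x. x \<in> C \<Longrightarrow> 0 \<le> y x" and L: "0 \<le> L"
  shows "avg C y * avg (PiE J B) (\<lambda>\<omega>. of_bool ((\<Sum>a\<in>K. y (\<omega> a)) / card K < avg C y / 4))
    \<le> max (16 * L / card K) (2 * avg C (\<lambda>x. if L < y x then y x else 0))"
proof -
  define \<mu> where "\<mu> = avg C y"
  define P where "P = avg (PiE J B) (\<lambda>\<omega>. of_bool ((\<Sum>a\<in>K. y (\<omega> a)) / card K < \<mu> / 4) :: real)"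
  define Y where "Y x = min (y x) L" for x
  define m where "m = avg C Y"
  define s where "s = real (card K)"
  have fK: "finite K" using K J finite_subset by blast
  have s: "s > 0" using fK K by (simp add: s_def card_gt_0_iff)
  have C: "finite C" "C \<noteq> {}" using B BK K by blast+
  have \<Omega>: "finite (PiE J B)" "PiE J B \<noteq> {}"
    using J B by (auto simp: finite_PiE PiE_eq_empty_iff)
  have \<mu>: "0 \<le> \<mu>" unfolding \<mu>_def by (intro avg_nonneg y)
  have P1: "P \<le> 1"
  proof -
    have "P \<le> avg (PiE J B) (\<lambda>_. 1)" unfolding P_def by (intro avg_mono) auto
    then show ?thesis using \<Omega> by (simp add: avg_const)
  qed
  consider "\<mu> = 0" | "m < \<mu> / 2" | "\<mu> \<noteq> 0" "\<mu> / 2 \<le> m" by linarith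
  then have "\<mu> * P \<le> max (16 * L / s) (2 * avg C (\<lambda>x. if L < y x then y x else 0))"
  proof cases
    case 1
    then show ?thesis using L s by (simp add: le_max_iff_disj)
  next
    case 2
    have "\<mu> \<le> 2 * (\<mu> - m)" using 2 by simp
    also have "\<mu> - m = avg C (\<lambda>x. y x - Y x)" by (simp add: avg_diff \<mu>_def m_def)
    also have "\<dots> \<le> avg C (\<lambda>x. if L < y x then y x else 0)"
      by (intro avg_mono) (use L in \<open>auto simp: Y_def\<close>)
    finally show ?thesis using mult_left_mono[OF P1 \<mu>] by simp
  next
    case 3
    then have pos: "\<mu> > 0" using \<mu> by simp
    have "P \<le> avg (PiE J B) (\<lambda>\<omega>. 16 / (\<mu>\<^sup>2 * s\<^sup>2) * (norm (\<Sum>a\<in>K. Y (\<omega> a) - m))\<^sup>2)"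
      unfolding P_def
    proof (rule avg_mono)
      fix \<omega> assume \<omega>: "\<omega> \<in> PiE J B"
      show "of_bool ((\<Sum>a\<in>K. y (\<omega> a)) / card K < \<mu> / 4) \<le> 16 / (\<mu>\<^sup>2 * s\<^sup>2) * (norm (\<Sum>a\<in>K. Y (\<omega> a) - m))\<^sup>2"
      proof (cases "(\<Sum>a\<in>K. y (\<omega> a)) / card K < \<mu> / 4")
        case True
        have "(\<Sum>a\<in>K. Y (\<omega> a)) \<le> (\<Sum>a\<in>K. y (\<omega> a))" by (intro sum_mono) (simp add: Y_def)
        also have "\<dots> < s * \<mu> / 4" using True s by (simp add: s_def field_simps)
        finally have "s * \<mu> / 4 < s * m - (\<Sum>a\<in>K. Y (\<omega> a))"
          using mult_left_mono[OF 3(2), of s] s by linarith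
        also have "\<dots> = - (\<Sum>a\<in>K. Y (\<omega> a) - m)" by (simp add: sum_subtractf s_def)
        also have "\<dots> \<le> norm (\<Sum>a\<in>K. Y (\<omega> a) - m)" by simp
        finally have "(s * \<mu> / 4)\<^sup>2 \<le> (norm (\<Sum>a\<in>K. Y (\<omega> a) - m))\<^sup>2"
          using s pos by (intro power_mono) auto
        then show ?thesis using True s pos by (simp add: field_simps power2_eq_square)
      qed simp
    qed
    also have "\<dots> = 16 / (\<mu>\<^sup>2 * s\<^sup>2) * (\<Sum>a\<in>K. avg (B a) (\<lambda>x. (norm (Y x - m))\<^sup>2))"
    proof -
      have "avg (B a) (\<lambda>x. Y x - m) = 0" if "a \<in> K" for a
        using C by (simp add: BK[OF that] avg_diff avg_const m_def)
      then show ?thesis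
        using second_moment_independent_sum[OF J B K(1), where g = "\<lambda>_ x. Y x - m"] by (simp only: avg_cmult)
    qed
    also have "\<dots> \<le> 16 / (\<mu>\<^sup>2 * s\<^sup>2) * (\<Sum>a\<in>K. L * \<mu>)"
    proof (intro mult_left_mono sum_mono)
      fix a assume "a \<in> K"
      have "avg C (\<lambda>x. (norm (Y x - m))\<^sup>2) \<le> avg C (\<lambda>x. (norm (Y x))\<^sup>2)"
        unfolding m_def avg_norm_sq_diff[OF C] by simp
      also have "\<dots> \<le> avg C (\<lambda>x. L * y x)"
      proof (rule avg_mono)
        fix x assume "x \<in> C"
        then have "0 \<le> Y x" "Y x \<le> L" "Y x \<le> y x" using y L by (auto simp: Y_def)
        then show "(norm (Y x))\<^sup>2 \<le> L * y x"
          unfolding power2_eq_square by (simp add: mult_mono)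
      qed
      finally show "avg (B a) (\<lambda>x. (norm (Y x - m))\<^sup>2) \<le> L * \<mu>"
        by (simp add: avg_cmult \<mu>_def BK[OF \<open>a \<in> K\<close>])
    qed simp
    finally have "P \<le> 16 / (\<mu>\<^sup>2 * s\<^sup>2) * (s * (L * \<mu>))" by (simp add: s_def)
    then have "\<mu> * P \<le> \<mu> * (16 / (\<mu>\<^sup>2 * s\<^sup>2) * (s * (L * \<mu>)))" using pos by (intro mult_left_mono) auto
    also have "\<dots> = 16 * L / s" using pos s by (simp add: field_simps power2_eq_square)
    finally show ?thesis by simp
  qed
  then show ?thesis by (simp add: \<mu>_def P_def s_def)
qed

text \<open>
  The quantity that matters below is the mean square times the probability that it is underestimated by
  the factor \<open>4\<close>: rows with a small mean square may well be underestimated, but they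
  contribute little. The truncation level \<open>L = b\<^sup>2 * s powr (2 / u)\<close> with
  \<open>b\<close> the \<open>L\<^sub>u\<close> norm of the row balances the two terms of
  \<open>empirical_lower_tail\<close>; the part of the square above \<open>L\<close> is bounded by the
  \<open>u\<close>-th power, which is where \<open>u > 2\<close> enters.
\<close>

lemma mean_sq_underestimated:
  fixes g :: "nat \<Rightarrow> 'a::real_normed_vector" and B :: "'i \<Rightarrow> nat set"
  assumes u: "2 < u" and N: "1 \<le> N"
    and J: "finite J" and B: "\<forall>a\<in>J. finite (B a) \<and> B a \<noteq> {}" and K: "K \<subseteq> J" "K \<noteq> {}"
    and BK: "\<And>a. a \<in> K \<Longrightarrow> B a = {1..N}"
  shows "mean_sq N g * avg (PiE J B) (\<lambda>\<omega>. of_bool ((\<Sum>a\<in>K. (norm (g (\<omega> a)))\<^sup>2) / card K < mean_sq N g / 4))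
    \<le> 16 * (L_norm u N g)\<^sup>2 * card K powr (2 * real_of_ereal (1 / u) - 1)" (is "?lhs \<le> _")
proof -
  define b where "b = L_norm u N g"
  define s where "s = real (card K)"
  have "finite K" using K J finite_subset by blast
  then have s: "s > 0" using K by (simp add: s_def card_gt_0_iff)
  have b: "0 \<le> b" using N L_norm_nonneg by (simp add: b_def)
  have tail: "?lhs \<le> max (16 * L / s) (2 * avg {1..N} (\<lambda>j. if L < (norm (g j))\<^sup>2 then (norm (g j))\<^sup>2 else 0))"
    if "0 \<le> L" for L
    unfolding mean_sq_def s_def by (rule empirical_lower_tail[OF J B K BK _ that]) auto
  show ?thesis
  proof (cases u)
    case (real r)
    then have r: "2 < r" using u by simp
    have br: "avg {1..N} (\<lambda>j. norm (g j) powr r) = b powr r"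
      unfolding b_def real using r by (simp add: L_norm_powr)
    show ?thesis
    proof (cases "b = 0")
      case True
      then have "mean_sq N g \<le> 0" using mean_sq_le_L_norm[OF u N, of g] by (simp add: b_def)
      then have "mean_sq N g = 0" using mean_sq_nonneg[of N g] by linarith
      then show ?thesis by simp
    next
      case False
      then have bp: "b > 0" using b by simp
      \<comment> \<open>For this level both bounds in the tail estimate are multiples of \<open>L / s\<close>.\<close>
      define L where "L = b\<^sup>2 * s powr (2 / r)"
      have L: "L > 0" using bp s by (simp add: L_def)
      have Ls: "L / s = b\<^sup>2 * s powr (2 / r - 1)"
        using s by (simp add: L_def powr_diff)
      have "avg {1..N} (\<lambda>j. if L < (norm (g j))\<^sup>2 then (norm (g j))\<^sup>2 else 0)
        \<le> avg {1..N} (\<lambda>j. L powr (1 - r / 2) * norm (g j) powr r)"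
      proof (rule avg_mono)
        fix j
        define x where "x = (norm (g j))\<^sup>2"
        have "x \<le> L powr (1 - r / 2) * norm (g j) powr r" if "L < x"
        proof -
          have "x = x powr (1 - r / 2) * x powr (r / 2)"
            using that L by (simp flip: powr_add)
          also have "\<dots> \<le> L powr (1 - r / 2) * x powr (r / 2)"
            using that L r by (intro mult_right_mono powr_mono2') auto
          also have "x powr (r / 2) = norm (g j) powr r" using r by (simp add: x_def norm_sq_powr)
          finally show ?thesis .
        qed
        then show "(if L < (norm (g j))\<^sup>2 then (norm (g j))\<^sup>2 else 0) \<le> L powr (1 - r / 2) * norm (g j) powr r"
          by (simp add: x_def)
      qed
      also have "\<dots> = L powr (1 - r / 2) * b powr r" by (simp only: avg_cmult br)
      also have "\<dots> = L / s"
      proof -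
        have "L powr (1 - r / 2) = L * (b\<^sup>2 * s powr (2 / r)) powr (- r / 2)"
          using L powr_add[of L 1 "- r / 2"] by (simp add: L_def)
        also have "(b\<^sup>2 * s powr (2 / r)) powr (- r / 2) = (b powr 2) powr (- r / 2) * (s powr (2 / r)) powr (- r / 2)"
          using bp s by (simp add: powr_mult)
        also have "\<dots> = b powr (- r) * s powr (- 1)"
          using r by (simp only: powr_powr) simp
        finally show ?thesis using bp s by (simp add: powr_minus field_simps)
      qed
      finally have small: "avg {1..N} (\<lambda>j. if L < (norm (g j))\<^sup>2 then (norm (g j))\<^sup>2 else 0) \<le> L / s" .
      have "0 < L / s" using L s by simp
      have "?lhs \<le> 16 * (L / s)"
      proof (rule order_trans[OF tail[of L] max.boundedI])
        show "2 * avg {1..N} (\<lambda>j. if L < (norm (g j))\<^sup>2 then (norm (g j))\<^sup>2 else 0) \<le> 16 * (L / s)"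
          using small \<open>0 < L / s\<close> by linarith
      qed (use L in auto)
      then show ?thesis
        unfolding Ls by (simp add: real real_of_ereal_inverse b_def s_def)
    qed
  next
    case PInf
    have le: "(norm (g j))\<^sup>2 \<le> b\<^sup>2" if "j \<in> {1..N}" for j
      unfolding b_def PInf using norm_le_L_norm_PInf[OF that] by (intro power_mono) auto
    have "avg {1..N} (\<lambda>j. if b\<^sup>2 < (norm (g j))\<^sup>2 then (norm (g j))\<^sup>2 else 0) = avg {1..N} (\<lambda>j. 0 :: real)"
      by (intro avg_cong) (use le in fastforce)
    also have "\<dots> = 0" by (simp add: avg_def)
    finally have zero: "avg {1..N} (\<lambda>j. if b\<^sup>2 < (norm (g j))\<^sup>2 then (norm (g j))\<^sup>2 else 0) = 0" .
    have "?lhs \<le> 16 * b\<^sup>2 / s"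
      by (rule order_trans[OF tail[of "b\<^sup>2"] max.boundedI]) (use s in \<open>simp_all only: zero, simp_all\<close>)
    then show ?thesis using s by (simp add: PInf b_def s_def powr_minus field_simps)
  qed (use u in auto)
qed

section \<open>Sampling the rows of one level\<close>

text \<open>
  The sample with index \<open>(k, i, r)\<close> is the \<open>r\<close>-th sample in row
  \<open>i\<close> of level \<open>k\<close>; its value is a column.
\<close>

definition columns :: "nat \<times> nat \<times> nat \<Rightarrow> nat set" where
  "columns a = {1..2 ^ fst a}"

lemma columns_ok: "\<forall>a\<in>J. finite (columns a) \<and> columns a \<noteq> {}"
  by (auto simp: columns_def)

definition row_index :: "nat \<Rightarrow> nat \<Rightarrow> nat \<Rightarrow> (nat \<times> nat \<times> nat) set" where
  "row_index k i n = (\<lambda>r. (k, i, r)) ` {..<n}"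

lemma card_row_index: "card (row_index k i n) = n"
  unfolding row_index_def by (subst card_image) (auto simp: inj_on_def)

lemma sum_row_index: "(\<Sum>a\<in>row_index k i n. h a) = (\<Sum>r<n. h (k, i, r))"
  unfolding row_index_def by (subst sum.reindex) (auto simp: inj_on_def)

definition row_mean_sample ::
  "nat \<Rightarrow> (nat \<Rightarrow> nat) \<Rightarrow> (nat \<times> nat \<times> nat \<Rightarrow> nat) \<Rightarrow> (nat \<Rightarrow> nat \<Rightarrow> 'a::real_normed_field) \<Rightarrow> 'a" where
  "row_mean_sample k \<nu> \<omega> f = (\<Sum>i=1..2 ^ k. \<Sum>r<\<nu> i. f i (\<omega> (k, i, r)) /\<^sub>R (2 ^ k * real (\<nu> i)))"

lemma mean_op_avg:
  fixes f :: "nat \<Rightarrow> nat \<Rightarrow> 'a::real_normed_field"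
  shows "mean_op N M f = avg {1..N} (\<lambda>i. avg {1..M} (f i))"
  unfolding mean_op_def avg_def
  by (simp add: scaleR_conv_of_real sum_distrib_left mult_ac divide_inverse)

text \<open>
  The estimator is unbiased, and row \<open>i\<close> contributes its variance, at most its mean square,
  divided by the number \<open>\<nu> i\<close> of samples.
\<close>

lemma row_mean_sample_variance:
  fixes f :: "nat \<Rightarrow> nat \<Rightarrow> 'a::{real_normed_field, real_inner}"
  assumes J: "finite J" and \<nu>: "\<And>i. i \<in> {1..2 ^ k} \<Longrightarrow> 1 \<le> \<nu> i"
    and sub: "\<And>i. i \<in> {1..2 ^ k} \<Longrightarrow> row_index k i (\<nu> i) \<subseteq> J"
  shows "avg (PiE J columns) (\<lambda>\<omega>. (norm (row_mean_sample k \<nu> \<omega> f - mean_op (2 ^ k) (2 ^ k) f))\<^sup>2)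
    \<le> (\<Sum>i=1..2 ^ k. mean_sq (2 ^ k) (f i) / real (\<nu> i)) / (2 ^ k)\<^sup>2"
proof -
  define N :: nat where "N = 2 ^ k"
  have N: "0 < N" "real N = 2 ^ k" by (auto simp: N_def)
  have ne: "finite {1..N}" "{1..N} \<noteq> {}" using N by auto
  define m where "m i = avg {1..N} (f i)" for i
  define K where "K = (\<Union>i\<in>{1..N}. row_index k i (\<nu> i))"
  define g where "g a x = (f (fst (snd a)) x - m (fst (snd a))) /\<^sub>R (real N * real (\<nu> (fst (snd a))))"
    for a :: "nat \<times> nat \<times> nat" and x
  have K: "K \<subseteq> J" unfolding K_def N_def using sub by (intro UN_least)
  have fst: "fst a = k" "fst (snd a) \<in> {1..N}" if "a \<in> K" for a using that by (auto simp: K_def row_index_def)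
  have sumK: "(\<Sum>a\<in>K. h a) = (\<Sum>i=1..N. \<Sum>r<\<nu> i. h (k, i, r))" for h :: "_ \<Rightarrow> 'c::comm_monoid_add"
    unfolding K_def by (subst sum.UNION_disjoint) (auto simp: row_index_def sum_row_index[unfolded row_index_def])
  have centred: "avg (columns a) (g a) = 0" if "a \<in> K" for a
  proof -
    have "columns a = {1..N}" using fst[OF that] by (simp add: columns_def N_def)
    then show ?thesis unfolding g_def by (simp only: avg_scaleR avg_diff avg_const[OF ne] m_def) simp
  qed
  have "row_mean_sample k \<nu> \<omega> f - mean_op N N f = (\<Sum>a\<in>K. g a (\<omega> a))" for \<omega>
  proof -
    have "mean_op N N f = (\<Sum>i=1..N. \<Sum>r<\<nu> i. m i /\<^sub>R (real N * real (\<nu> i)))"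
      unfolding mean_op_avg m_def[symmetric] avg_def[of _ m] scaleR_sum_right
    proof (rule sum.cong)
      fix i assume "i \<in> {1..N}"
      then have "real (\<nu> i) \<noteq> 0" using \<nu>[of i] by (auto simp: N_def)
      then show "m i /\<^sub>R real (card {1..N}) = (\<Sum>r<\<nu> i. m i /\<^sub>R (real N * real (\<nu> i)))"
        by (simp only: sum_constant_scaleR card_lessThan scaleR_scaleR card_atLeastAtMost) (simp add: field_simps)
    qed simp
    then show ?thesis
      unfolding sumK row_mean_sample_def g_def
      by (simp only: fst_conv snd_conv scaleR_diff_right sum_subtractf N_def of_nat_power of_nat_numeral)
  qed
  then have "avg (PiE J columns) (\<lambda>\<omega>. (norm (row_mean_sample k \<nu> \<omega> f - mean_op N N f))\<^sup>2)
    = (\<Sum>a\<in>K. avg (columns a) (\<lambda>x. (norm (g a x))\<^sup>2))"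
    by (simp only: second_moment_independent_sum[OF J columns_ok K centred])
  also have "\<dots> \<le> (\<Sum>a\<in>K. mean_sq N (f (fst (snd a))) / (real N * real (\<nu> (fst (snd a))))\<^sup>2)"
  proof (rule sum_mono)
    fix a assume a: "a \<in> K"
    let ?i = "fst (snd a)" let ?c = "real N * real (\<nu> ?i)"
    have "avg (columns a) (\<lambda>x. (norm (g a x))\<^sup>2) = avg {1..N} (\<lambda>x. (1 / ?c\<^sup>2) * (norm (f ?i x - m ?i))\<^sup>2)"
      using fst[OF a] unfolding columns_def N_def[symmetric] g_def
      by (simp add: power_mult_distrib power_divide N_def divide_inverse mult_ac power_inverse)
    also have "\<dots> = (1 / ?c\<^sup>2) * (mean_sq N (f ?i) - (norm (m ?i))\<^sup>2)"
      unfolding avg_cmult m_def avg_norm_sq_diff[OF ne] mean_sq_def ..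
    also have "\<dots> \<le> (1 / ?c\<^sup>2) * mean_sq N (f ?i)" by (intro mult_left_mono) auto
    finally show "avg (columns a) (\<lambda>x. (norm (g a x))\<^sup>2) \<le> mean_sq N (f ?i) / ?c\<^sup>2" by simp
  qed
  also have "\<dots> = (\<Sum>i=1..N. mean_sq N (f i) / real (\<nu> i)) / (real N)\<^sup>2"
    unfolding sumK sum_divide_distrib
    by (intro sum.cong refl) (simp add: power2_eq_square)
  finally show ?thesis by (simp add: N_def)
qed

section \<open>Sample sizes that follow the size of the rows\<close>

definition row_size ::
  "nat \<Rightarrow> nat \<Rightarrow> (nat \<times> nat \<times> nat \<Rightarrow> nat) \<Rightarrow> (nat \<Rightarrow> nat \<Rightarrow> 'a::real_normed_vector) \<Rightarrow> nat \<Rightarrow> real" where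
  "row_size k s \<omega> f i = sqrt ((\<Sum>a\<in>row_index k i s. (norm (f i (\<omega> a)))\<^sup>2) / real s)"

text \<open>
  Minimizing the sum of \<open>\<mu> i / \<nu> i\<close> for a given sum of \<open>\<nu> i\<close> leads
  to \<open>\<nu> i\<close> proportional to \<open>sqrt (\<mu> i)\<close>. The offset \<open>s\<close>
  guards against rows whose mean square was underestimated. If all estimates vanish, the quotient is
  \<open>0\<close> and the offset alone remains.
\<close>

definition allocation ::
  "nat \<Rightarrow> nat \<Rightarrow> (nat \<times> nat \<times> nat \<Rightarrow> nat) \<Rightarrow> (nat \<Rightarrow> nat \<Rightarrow> 'a::real_normed_vector) \<Rightarrow> nat \<Rightarrow> nat" where
  "allocation k s \<omega> f i =
     s + nat \<lceil>real s * 2 ^ k * row_size k s \<omega> f i / (\<Sum>l=1..2 ^ k. row_size k s \<omega> f l)\<rceil>"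

lemma row_size_nonneg: "0 \<le> row_size k s \<omega> f i"
  by (simp add: row_size_def sum_nonneg)

lemma allocation_bounds:
  assumes s: "1 \<le> s"
  shows "s \<le> allocation k s \<omega> f i"
    and "i \<in> {1..2 ^ k} \<Longrightarrow> allocation k s \<omega> f i \<le> 3 * s * 2 ^ k"
    and "(\<Sum>i=1..2 ^ k. allocation k s \<omega> f i) \<le> 3 * s * 2 ^ k"
proof -
  define R where "R = (\<Sum>l=1..2 ^ k. row_size k s \<omega> f l)"
  define x where "x i = real s * 2 ^ k * row_size k s \<omega> f i / R" for i
  have alloc: "allocation k s \<omega> f i = s + nat \<lceil>x i\<rceil>" for i by (simp add: allocation_def x_def R_def)
  show "s \<le> allocation k s \<omega> f i" by (simp add: alloc)
  have R: "0 \<le> R" unfolding R_def by (intro sum_nonneg row_size_nonneg)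
  have x0: "0 \<le> x i" for i using R by (simp add: x_def row_size_nonneg)
  have real: "real (nat \<lceil>x i\<rceil>) \<le> x i + 1" for i using x0[of i] by linarith
  have s1: "(2::nat) ^ k \<le> s * 2 ^ k" using s by simp
  show "allocation k s \<omega> f i \<le> 3 * s * 2 ^ k" if i: "i \<in> {1..2 ^ k}"
  proof -
    have "row_size k s \<omega> f i \<le> R" unfolding R_def using i by (intro member_le_sum) (auto simp: row_size_nonneg)
    then have "row_size k s \<omega> f i / R \<le> 1" using R by (cases "R = 0") auto
    then have "real s * 2 ^ k * (row_size k s \<omega> f i / R) \<le> real s * 2 ^ k * 1" by (intro mult_left_mono) auto
    then have "real (nat \<lceil>x i\<rceil>) \<le> real (s * 2 ^ k) + 1" using real[of i] by (simp add: x_def)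
    then have "nat \<lceil>x i\<rceil> \<le> s * 2 ^ k + 1" by linarith
    moreover have "s \<le> s * 2 ^ k" "1 \<le> s * 2 ^ k" using s by auto
    ultimately show ?thesis unfolding alloc mult.assoc by linarith
  qed
  have "(\<Sum>i=1..2 ^ k. x i) = real s * 2 ^ k * (R / R)"
    unfolding x_def by (simp add: R_def flip: sum_divide_distrib sum_distrib_left)
  also have "\<dots> \<le> real s * 2 ^ k" by simp
  finally have "(\<Sum>i=1..2 ^ k. x i) \<le> real s * 2 ^ k" .
  then have "(\<Sum>i=1..2 ^ k. real (nat \<lceil>x i\<rceil>)) \<le> real s * 2 ^ k + 2 ^ k"
    using sum_mono[of "{1..2 ^ k}" "\<lambda>i. real (nat \<lceil>x i\<rceil>)" "\<lambda>i. x i + 1"] real by (simp add: sum.distrib)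
  then have "real (\<Sum>i=1..2 ^ k. nat \<lceil>x i\<rceil>) \<le> real (s * 2 ^ k + 2 ^ k)" by simp
  then have count: "(\<Sum>i=1..2 ^ k. nat \<lceil>x i\<rceil>) \<le> s * 2 ^ k + 2 ^ k" by (simp only: of_nat_le_iff)
  show "(\<Sum>i=1..2 ^ k. allocation k s \<omega> f i) \<le> 3 * s * 2 ^ k"
  proof -
    have "(\<Sum>i=1..2 ^ k. allocation k s \<omega> f i) = s * 2 ^ k + (\<Sum>i=1..2 ^ k. nat \<lceil>x i\<rceil>)"
      unfolding alloc by (simp add: sum.distrib)
    then show ?thesis using s1 count unfolding mult.assoc by linarith
  qed
qed

lemma expected_row_size:
  assumes J: "finite J" and s: "1 \<le> s" and sub: "row_index k i s \<subseteq> J"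
  shows "avg (PiE J columns) (\<lambda>\<omega>. row_size k s \<omega> f i) \<le> sqrt (mean_sq (2 ^ k) (f i))"
proof -
  have one: "avg (PiE J columns) (\<lambda>\<omega>. (norm (f i (\<omega> a)))\<^sup>2) = mean_sq (2 ^ k) (f i)" if "a \<in> row_index k i s" for a
  proof -
    have "a \<in> J" and col: "columns a = {1..2 ^ k}" using that sub by (auto simp: row_index_def columns_def)
    then show ?thesis
      using avg_one_sample[OF J columns_ok, where h = "\<lambda>x. (norm (f i x))\<^sup>2" and a = a]
      by (simp add: col mean_sq_def)
  qed
  have "avg (PiE J columns) (\<lambda>\<omega>. (row_size k s \<omega> f i)\<^sup>2)
      = avg (PiE J columns) (\<lambda>\<omega>. (1 / real s) * (\<Sum>a\<in>row_index k i s. (norm (f i (\<omega> a)))\<^sup>2))"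
    by (intro avg_cong) (simp add: row_size_def sum_nonneg)
  also have "\<dots> = (1 / real s) * (\<Sum>a\<in>row_index k i s. mean_sq (2 ^ k) (f i))"
    unfolding avg_cmult avg_sum using one by simp
  also have "\<dots> = mean_sq (2 ^ k) (f i)" using s by (simp add: card_row_index)
  finally show ?thesis using avg_le_sqrt[of "PiE J columns" "\<lambda>\<omega>. row_size k s \<omega> f i"] by simp
qed

text \<open>
  If the mean square \<open>\<mu>\<close> of row \<open>i\<close> is not underestimated by more than the
  factor \<open>4\<close>, the proportional part of the allocation yields the first term. Otherwise the
  offset \<open>s\<close> yields the second.
\<close>

lemma allocation_quality:
  assumes s: "1 \<le> s" and i: "i \<in> {1..2 ^ k}"
  shows "mean_sq (2 ^ k) (f i) / real (allocation k s \<omega> f i)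
    \<le> 2 * sqrt (mean_sq (2 ^ k) (f i)) / (real s * 2 ^ k) * (\<Sum>l=1..2 ^ k. row_size k s \<omega> f l)
      + (1 / real s) * (mean_sq (2 ^ k) (f i) *
          of_bool ((\<Sum>a\<in>row_index k i s. (norm (f i (\<omega> a)))\<^sup>2) / card (row_index k i s) < mean_sq (2 ^ k) (f i) / 4))"
proof -
  define \<mu> where "\<mu> = mean_sq (2 ^ k) (f i)"
  define R where "R = (\<Sum>l=1..2 ^ k. row_size k s \<omega> f l)"
  define a where "a = row_size k s \<omega> f i"
  have \<mu>: "0 \<le> \<mu>" by (simp add: \<mu>_def mean_sq_nonneg)
  have R: "0 \<le> R" unfolding R_def by (intro sum_nonneg row_size_nonneg)
  have aR: "a \<le> R" unfolding a_def R_def using i by (intro member_le_sum) (auto simp: row_size_nonneg)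
  have sq: "(\<Sum>a\<in>row_index k i s. (norm (f i (\<omega> a)))\<^sup>2) / card (row_index k i s) = a\<^sup>2"
    by (simp add: a_def row_size_def card_row_index sum_nonneg)
  have first: "0 \<le> 2 * sqrt \<mu> / (real s * 2 ^ k) * R" using \<mu> R by simp
  have ge: "real s \<le> real (allocation k s \<omega> f i)" using allocation_bounds(1)[OF s] by simp
  have "\<mu> / real (allocation k s \<omega> f i) \<le> 2 * sqrt \<mu> / (real s * 2 ^ k) * R + (1 / real s) * (\<mu> * of_bool (a\<^sup>2 < \<mu> / 4))"
  proof (cases "a\<^sup>2 < \<mu> / 4")
    case True
    have "\<mu> / real (allocation k s \<omega> f i) \<le> \<mu> / real s"
      using ge s \<mu> by (intro divide_left_mono) auto
    then show ?thesis using True first by simp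
  next
    case False
    show ?thesis
    proof (cases "\<mu> = 0")
      case True
      then show ?thesis by simp
    next
      case nz: False
      then have pos: "\<mu> > 0" using \<mu> by simp
      have a0: "0 \<le> a" by (simp add: a_def row_size_nonneg)
      have "(sqrt \<mu> / 2)\<^sup>2 \<le> a\<^sup>2" using False \<mu> by (simp add: power_divide)
      then have a: "sqrt \<mu> / 2 \<le> a" using a0 by (rule power2_le_imp_le)
      then have "a > 0" using pos by (smt (verit) real_sqrt_gt_zero half_gt_zero)
      then have R: "R > 0" using aR by simp
      have "real s * 2 ^ k * (sqrt \<mu> / 2) / R \<le> real s * 2 ^ k * a / R"
        using a R by (intro divide_right_mono mult_left_mono) auto
      also have "\<dots> \<le> real (allocation k s \<omega> f i)"
        unfolding allocation_def R_def[symmetric] a_def[symmetric] by linarith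
      finally have ge: "real s * 2 ^ k * (sqrt \<mu> / 2) / R \<le> real (allocation k s \<omega> f i)" .
      have p: "0 < real s * 2 ^ k * (sqrt \<mu> / 2) / R" using s pos R by simp
      have "\<mu> / real (allocation k s \<omega> f i) \<le> \<mu> / (real s * 2 ^ k * (sqrt \<mu> / 2) / R)"
        using ge p \<mu> by (intro divide_left_mono mult_pos_pos) auto
      also have "\<dots> = 2 * sqrt \<mu> / (real s * 2 ^ k) * R"
      proof -
        define q where "q = sqrt \<mu>"
        have "q > 0" "\<mu> = q * q" using pos by (auto simp: q_def)
        then show ?thesis unfolding q_def[symmetric] by (simp add: field_simps)
      qed
      finally show ?thesis using False by simp
    qed
  qed
  then show ?thesis by (simp only: \<mu>_def R_def sq)
qed

text \<open>
  By Jensen's inequality the expected estimate of a row size is at most the row size, so the first terms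
  of \<open>allocation_quality\<close> add up to a multiple of the squared \<open>\<ell>\<^sub>1\<close>
  norm of the row sizes. The second terms are controlled by \<open>mean_sq_underestimated\<close>.
\<close>

lemma expected_allocation_variance:
  fixes f :: "nat \<Rightarrow> nat \<Rightarrow> 'a::real_normed_vector"
  assumes u: "2 < u" and J: "finite J" and s: "1 \<le> s" and sub: "\<And>i. i \<in> {1..2 ^ k} \<Longrightarrow> row_index k i s \<subseteq> J"
  defines "b \<equiv> \<lambda>i. L_norm u (2 ^ k) (f i)"
  shows "avg (PiE J columns) (\<lambda>\<omega>. (\<Sum>i=1..2 ^ k. mean_sq (2 ^ k) (f i) / real (allocation k s \<omega> f i)))
    \<le> 2 / (real s * 2 ^ k) * (\<Sum>i=1..2 ^ k. b i)\<^sup>2 + 16 * real s powr (2 * real_of_ereal (1 / u) - 2) * (\<Sum>i=1..2 ^ k. (b i)\<^sup>2)"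
proof -
  define \<mu> where "\<mu> i = mean_sq (2 ^ k) (f i)" for i
  define e where "e = real_of_ereal (1 / u)"
  define bad where "bad \<omega> i = (of_bool ((\<Sum>a\<in>row_index k i s. (norm (f i (\<omega> a)))\<^sup>2) / card (row_index k i s) < \<mu> i / 4) :: real)" for \<omega> i
  have b: "0 \<le> b i" for i unfolding b_def by (intro L_norm_nonneg) simp
  have \<mu>b: "\<mu> i \<le> (b i)\<^sup>2" for i unfolding \<mu>_def b_def using u by (intro mean_sq_le_L_norm) auto
  have sq\<mu>: "sqrt (\<mu> i) \<le> b i" for i using \<mu>b b by (intro real_le_lsqrt) (auto simp: \<mu>_def mean_sq_nonneg)
  have \<mu>0: "0 \<le> \<mu> i" for i by (simp add: \<mu>_def mean_sq_nonneg)
  have "avg (PiE J columns) (\<lambda>\<omega>. (\<Sum>i=1..2 ^ k. \<mu> i / real (allocation k s \<omega> f i)))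
    \<le> avg (PiE J columns) (\<lambda>\<omega>. (\<Sum>i=1..2 ^ k. 2 * sqrt (\<mu> i) / (real s * 2 ^ k) * (\<Sum>l=1..2 ^ k. row_size k s \<omega> f l)
      + (1 / real s) * (\<mu> i * bad \<omega> i)))"
    unfolding \<mu>_def bad_def by (intro avg_mono sum_mono allocation_quality s)
  also have "\<dots> = (\<Sum>i=1..2 ^ k. 2 * sqrt (\<mu> i) / (real s * 2 ^ k) * (\<Sum>l=1..2 ^ k. avg (PiE J columns) (\<lambda>\<omega>. row_size k s \<omega> f l))
      + (1 / real s) * (\<mu> i * avg (PiE J columns) (\<lambda>\<omega>. bad \<omega> i)))"
    by (simp only: avg_sum avg_add avg_cmult)
  also have "\<dots> \<le> (\<Sum>i=1..2 ^ k. 2 * b i / (real s * 2 ^ k) * (\<Sum>l=1..2 ^ k. b l)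
      + (1 / real s) * (16 * (b i)\<^sup>2 * real s powr (2 * e - 1)))"
  proof (rule sum_mono, rule add_mono)
    fix i :: nat assume i: "i \<in> {1..2 ^ k}"
    have "avg (PiE J columns) (\<lambda>\<omega>. row_size k s \<omega> f l) \<le> b l" if "l \<in> {1..2 ^ k}" for l
      using expected_row_size[OF J s sub[OF that], of f] sq\<mu>[of l] by (simp add: \<mu>_def)
    then show "2 * sqrt (\<mu> i) / (real s * 2 ^ k) * (\<Sum>l=1..2 ^ k. avg (PiE J columns) (\<lambda>\<omega>. row_size k s \<omega> f l))
        \<le> 2 * b i / (real s * 2 ^ k) * (\<Sum>l=1..2 ^ k. b l)"
      using sq\<mu>[of i] b by (intro mult_mono divide_right_mono sum_mono)
        (auto intro!: sum_nonneg avg_nonneg row_size_nonneg simp: \<mu>0)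
    have "row_index k i s \<noteq> {}" using s by (auto simp: row_index_def lessThan_empty_iff)
    moreover have "columns a = {1..2 ^ k}" if "a \<in> row_index k i s" for a
      using that by (auto simp: row_index_def columns_def)
    ultimately have "\<mu> i * avg (PiE J columns) (\<lambda>\<omega>. bad \<omega> i) \<le> 16 * (b i)\<^sup>2 * real s powr (2 * e - 1)"
      using mean_sq_underestimated[OF u _ J columns_ok sub[OF i], where g = "f i" and N = "2 ^ k"]
      unfolding \<mu>_def bad_def b_def e_def by (simp add: card_row_index)
    then show "(1 / real s) * (\<mu> i * avg (PiE J columns) (\<lambda>\<omega>. bad \<omega> i))
        \<le> (1 / real s) * (16 * (b i)\<^sup>2 * real s powr (2 * e - 1))"
      by (rule mult_left_mono) simp
  qed
  also have "\<dots> = (\<Sum>i=1..2 ^ k. 2 / (real s * 2 ^ k) * (\<Sum>l=1..2 ^ k. b l) * b i)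
      + (\<Sum>i=1..2 ^ k. 16 * real s powr (2 * e - 2) * (b i)\<^sup>2)"
  proof -
    have "real s powr (2 * e - 1) = real s powr (2 * e - 2) * real s"
      using s powr_add[of "real s" "2 * e - 2" 1] by simp
    then show ?thesis using s by (simp add: sum.distrib mult_ac)
  qed
  also have "\<dots> = 2 / (real s * 2 ^ k) * (\<Sum>i=1..2 ^ k. b i)\<^sup>2 + 16 * real s powr (2 * e - 2) * (\<Sum>i=1..2 ^ k. (b i)\<^sup>2)"
    by (simp only: sum_distrib_left[symmetric] power2_eq_square mult.assoc)
  finally show ?thesis unfolding \<mu>_def e_def .
qed

section \<open>Errors on one level\<close>

text \<open>
  The two consequences of the outer \<open>L\<^sub>p\<close> norm with \<open>1 \<le> p < 2\<close> that
  enter the variance bounds: it dominates the \<open>L\<^sub>1\<close> norm, and, without normalization,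
  the \<open>\<ell>\<^sub>2\<close> norm.
\<close>

lemma row_norms:
  fixes p :: real and f :: "nat \<Rightarrow> nat \<Rightarrow> 'a::real_normed_vector"
  assumes p: "1 \<le> p" "p < 2" and N: "1 \<le> N" and f: "LL_norm (ereal p) N u M f \<le> 1" and M: "1 \<le> M"
  shows "(\<Sum>i=1..N. L_norm u M (f i)) \<le> real N"
    and "(\<Sum>i=1..N. (L_norm u M (f i))\<^sup>2) \<le> real N powr (2 / p)"
proof -
  define b where "b i = L_norm u M (f i)" for i
  have b: "0 \<le> b i" for i unfolding b_def using M by (rule L_norm_nonneg)
  have "avg {1..N} (\<lambda>i. norm (b i) powr p) = LL_norm (ereal p) N u M f powr p"
    unfolding LL_norm_def b_def using p by (intro L_norm_powr[symmetric]) auto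
  also have "\<dots> \<le> 1 powr p"
    using f p L_norm_nonneg[OF N] unfolding LL_norm_def by (intro powr_mono2) auto
  finally have ap: "avg {1..N} (\<lambda>i. b i powr p) \<le> 1 powr p" using b by simp
  have "avg {1..N} b \<le> 1"
    by (rule power_mean[OF _ _ p(1) _ _ ap]) (use N b in auto)
  then show "(\<Sum>i=1..N. L_norm u M (f i)) \<le> real N"
    using N unfolding b_def by (simp add: avg_def field_simps)
  have "(\<Sum>i=1..N. b i powr p) \<le> real N"
    using ap N by (simp add: avg_def field_simps)
  then have "(\<Sum>i=1..N. (b i powr p) powr (2 / p)) \<le> real N powr (2 / p)"
    using p by (intro sum_powr_le_powr_sum) auto
  also have "(\<Sum>i=1..N. (b i powr p) powr (2 / p)) = (\<Sum>i=1..N. (b i)\<^sup>2)"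
    using p b by (intro sum.cong) (auto simp: powr_powr)
  finally show "(\<Sum>i=1..N. (L_norm u M (f i))\<^sup>2) \<le> real N powr (2 / p)" by (simp add: b_def)
qed

lemma norm_mean_op_le:
  fixes f :: "nat \<Rightarrow> nat \<Rightarrow> 'a::{real_normed_field}" and p :: real
  assumes p: "1 \<le> p" "p < 2" and u: "2 < u" and N: "1 \<le> N" and f: "LL_norm (ereal p) N u N f \<le> 1"
  shows "norm (mean_op N N f) \<le> 1"
proof -
  have norm_avg: "norm (avg A h) \<le> avg A (\<lambda>x. norm (h x))" for A :: "nat set" and h :: "nat \<Rightarrow> 'a"
    by (simp add: avg_def mult_left_mono norm_sum)
  have row: "norm (avg {1..N} (f i)) \<le> L_norm u N (f i)" for i
  proof -
    have "norm (avg {1..N} (f i)) \<le> sqrt (mean_sq N (f i))"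
      unfolding mean_sq_def using norm_avg avg_le_sqrt order_trans by blast
    also have "\<dots> \<le> L_norm u N (f i)"
      using mean_sq_le_L_norm[OF u N] N by (intro real_le_lsqrt) (auto simp: mean_sq_nonneg L_norm_nonneg)
    finally show ?thesis .
  qed
  have "norm (mean_op N N f) \<le> avg {1..N} (\<lambda>i. L_norm u N (f i))"
    unfolding mean_op_avg by (rule order_trans[OF norm_avg avg_mono[OF row]])
  also have "\<dots> \<le> 1" using row_norms(1)[OF p N f N] N by (simp add: avg_def field_simps)
  finally show ?thesis .
qed

lemma powr_square: "(x powr a)\<^sup>2 = x powr (2 * a)" for x :: real
  by (simp add: power2_eq_square powr_add[symmetric])

lemma powr_square_minus_half: "x > 0 \<Longrightarrow> (x powr (- (1 / 2)))\<^sup>2 = 1 / x" for x :: real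
  unfolding powr_square by (simp add: powr_minus_divide)

lemma powr_square_diff_one: "x > 0 \<Longrightarrow> (x powr (a / 2 - 1))\<^sup>2 = x powr a / x\<^sup>2" for x :: real
  unfolding powr_square by (simp add: right_diff_distrib powr_diff)

lemma nonadaptive_level_error:
  fixes f :: "nat \<Rightarrow> nat \<Rightarrow> 'a::{real_normed_field, real_inner}" and p :: real
  assumes p: "1 \<le> p" "p < 2" and u: "2 < u" and f: "LL_norm (ereal p) (2 ^ k) u (2 ^ k) f \<le> 1"
    and J: "finite J" and s: "1 \<le> s" and sub: "\<And>i. i \<in> {1..2 ^ k} \<Longrightarrow> row_index k i s \<subseteq> J"
  shows "avg (PiE J columns) (\<lambda>\<omega>. norm (mean_op (2 ^ k) (2 ^ k) f - row_mean_sample k (\<lambda>_. s) \<omega> f))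
    \<le> real s powr (- (1 / 2)) * (2 ^ k) powr (1 / p - 1)"
proof -
  define N :: real where "N = 2 ^ k"
  have N: "N > 0" by (simp add: N_def)
  have sp: "real s > 0" using s by simp
  let ?b = "\<lambda>i. L_norm u (2 ^ k) (f i)"
  have "avg (PiE J columns) (\<lambda>\<omega>. norm (mean_op (2 ^ k) (2 ^ k) f - row_mean_sample k (\<lambda>_. s) \<omega> f))
    \<le> sqrt (avg (PiE J columns) (\<lambda>\<omega>. (norm (row_mean_sample k (\<lambda>_. s) \<omega> f - mean_op (2 ^ k) (2 ^ k) f))\<^sup>2))"
    by (subst norm_minus_commute) (rule avg_le_sqrt)
  also have "\<dots> \<le> sqrt ((\<Sum>i=1..2 ^ k. mean_sq (2 ^ k) (f i) / real s) / (2 ^ k)\<^sup>2)"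
    using s sub by (intro real_sqrt_le_mono row_mean_sample_variance[OF J]) auto
  also have "\<dots> \<le> sqrt (N powr (2 / p) / real s / N\<^sup>2)"
  proof -
    have "(\<Sum>i=1..2 ^ k. mean_sq (2 ^ k) (f i) / real s) \<le> (\<Sum>i=1..2 ^ k. (?b i)\<^sup>2 / real s)"
      by (intro sum_mono divide_right_mono mean_sq_le_L_norm u) auto
    also have "\<dots> \<le> N powr (2 / p) / real s"
      using row_norms(2)[OF p _ f] sp by (simp add: N_def divide_right_mono flip: sum_divide_distrib)
    finally have "(\<Sum>i=1..2 ^ k. mean_sq (2 ^ k) (f i) / real s) \<le> N powr (2 / p) / real s" .
    then show ?thesis unfolding N_def[symmetric] by (rule real_sqrt_le_mono[OF divide_right_mono]) simp
  qed
  also have "N powr (2 / p) / real s / N\<^sup>2 = (real s powr (- (1 / 2)) * N powr (1 / p - 1))\<^sup>2"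
  proof -
    have "(real s powr (- (1 / 2)))\<^sup>2 = 1 / real s"
      using sp by (rule powr_square_minus_half)
    moreover have "(N powr (1 / p - 1))\<^sup>2 = N powr (2 / p) / N\<^sup>2"
      using powr_square_diff_one[OF N, of "2 / p"] by simp
    ultimately show ?thesis by (simp add: power_mult_distrib)
  qed
  finally show ?thesis by (simp add: N_def)
qed

text \<open>
  The first term stems from rows whose mean square is estimated well, the second one from underestimated
  rows.
\<close>

lemma adaptive_level_error:
  fixes f :: "nat \<Rightarrow> nat \<Rightarrow> 'a::{real_normed_field, real_inner}" and p :: real
  assumes p: "1 \<le> p" "p < 2" and u: "2 < u" and f: "LL_norm (ereal p) (2 ^ k) u (2 ^ k) f \<le> 1"
    and J: "finite J" and s: "1 \<le> s"
    and sub: "\<And>i. i \<in> {1..2 ^ k} \<Longrightarrow> row_index k i (3 * s * 2 ^ k) \<subseteq> J"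
  shows "avg (PiE J columns) (\<lambda>\<omega>1. avg (PiE J columns) (\<lambda>\<omega>2.
      norm (mean_op (2 ^ k) (2 ^ k) f - row_mean_sample k (allocation k s \<omega>1 f) \<omega>2 f)))
    \<le> 2 * real s powr (- (1 / 2)) * (2 ^ k) powr (- (1 / 2))
      + 4 * real s powr (real_of_ereal (1 / u) - 1) * (2 ^ k) powr (1 / p - 1)"
proof -
  define N :: real where "N = 2 ^ k"
  have N: "N > 0" by (simp add: N_def)
  have sp: "real s > 0" using s by simp
  define e where "e = real_of_ereal (1 / u)"
  let ?b = "\<lambda>i. L_norm u (2 ^ k) (f i)"
  define V where "V \<omega> = (\<Sum>i=1..2 ^ k. mean_sq (2 ^ k) (f i) / real (allocation k s \<omega> f i))" for \<omega>
  have V: "0 \<le> V \<omega>" for \<omega> unfolding V_def by (intro sum_nonneg divide_nonneg_nonneg mean_sq_nonneg) auto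
  have sub': "row_index k i n \<subseteq> J" if "i \<in> {1..2 ^ k}" "n \<le> 3 * s * 2 ^ k" for i n
    using sub[OF that(1)] that(2) by (auto simp: row_index_def image_subset_iff)
  have ss: "s \<le> 3 * s * 2 ^ k" by simp
  have inner: "avg (PiE J columns) (\<lambda>\<omega>2. norm (mean_op (2 ^ k) (2 ^ k) f - row_mean_sample k (allocation k s \<omega>1 f) \<omega>2 f))
      \<le> sqrt (V \<omega>1 / N\<^sup>2)" for \<omega>1
  proof -
    have "avg (PiE J columns) (\<lambda>\<omega>2. norm (mean_op (2 ^ k) (2 ^ k) f - row_mean_sample k (allocation k s \<omega>1 f) \<omega>2 f))
      \<le> sqrt (avg (PiE J columns) (\<lambda>\<omega>2. (norm (row_mean_sample k (allocation k s \<omega>1 f) \<omega>2 f - mean_op (2 ^ k) (2 ^ k) f))\<^sup>2))"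
      by (subst norm_minus_commute) (rule avg_le_sqrt)
    also have "\<dots> \<le> sqrt (V \<omega>1 / N\<^sup>2)"
      unfolding V_def N_def
      by (intro real_sqrt_le_mono row_mean_sample_variance[OF J] sub' allocation_bounds(2)[OF s])
        (use order_trans[OF s allocation_bounds(1)[OF s]] in auto)
    finally show ?thesis .
  qed
  have "avg (PiE J columns) (\<lambda>\<omega>1. avg (PiE J columns) (\<lambda>\<omega>2.
      norm (mean_op (2 ^ k) (2 ^ k) f - row_mean_sample k (allocation k s \<omega>1 f) \<omega>2 f)))
    \<le> avg (PiE J columns) (\<lambda>\<omega>1. sqrt (V \<omega>1 / N\<^sup>2))" by (rule avg_mono[OF inner])
  also have "\<dots> \<le> sqrt (avg (PiE J columns) (\<lambda>\<omega>1. (sqrt (V \<omega>1 / N\<^sup>2))\<^sup>2))" by (rule avg_le_sqrt)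
  also have "avg (PiE J columns) (\<lambda>\<omega>1. (sqrt (V \<omega>1 / N\<^sup>2))\<^sup>2) = avg (PiE J columns) (\<lambda>\<omega>1. (1 / N\<^sup>2) * V \<omega>1)"
    using V by (intro avg_cong) simp
  also have "\<dots> = (1 / N\<^sup>2) * avg (PiE J columns) V" by (rule avg_cmult)
  also have "sqrt \<dots> \<le> sqrt ((2 * real s powr (- (1 / 2)) * N powr (- (1 / 2)))\<^sup>2 + (4 * real s powr (e - 1) * N powr (1 / p - 1))\<^sup>2)"
  proof (rule real_sqrt_le_mono)
    have b0: "0 \<le> (\<Sum>i=1..2 ^ k. ?b i)" by (intro sum_nonneg L_norm_nonneg) simp
    have "avg (PiE J columns) V \<le> 2 / (real s * 2 ^ k) * (\<Sum>i=1..2 ^ k. ?b i)\<^sup>2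
        + 16 * real s powr (2 * e - 2) * (\<Sum>i=1..2 ^ k. (?b i)\<^sup>2)"
      unfolding V_def e_def by (rule expected_allocation_variance[OF u J s sub'[OF _ ss]])
    also have "\<dots> \<le> 2 / (real s * 2 ^ k) * N\<^sup>2 + 16 * real s powr (2 * e - 2) * N powr (2 / p)"
      using row_norms[OF p _ f] b0 by (intro add_mono mult_left_mono power_mono) (auto simp: N_def)
    finally have "1 / N\<^sup>2 * avg (PiE J columns) V \<le>
        1 / N\<^sup>2 * (2 / (real s * N) * N\<^sup>2 + 16 * real s powr (2 * e - 2) * N powr (2 / p))"
      by (intro mult_left_mono) (auto simp: N_def)
    also have "\<dots> = 2 / (real s * N) + 16 * real s powr (2 * e - 2) * (N powr (2 / p) / N\<^sup>2)"
      using N by (simp add: distrib_left)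
    also have "\<dots> \<le> 4 / (real s * N) + 16 * real s powr (2 * e - 2) * (N powr (2 / p) / N\<^sup>2)"
      using sp N by (intro add_right_mono divide_right_mono) auto
    also have "4 / (real s * N) = (2 * real s powr (- (1 / 2)) * N powr (- (1 / 2)))\<^sup>2"
    proof -
      show ?thesis
        unfolding power_mult_distrib powr_square_minus_half[OF sp] powr_square_minus_half[OF N] by simp
    qed
    also have "16 * real s powr (2 * e - 2) * (N powr (2 / p) / N\<^sup>2) = (4 * real s powr (e - 1) * N powr (1 / p - 1))\<^sup>2"
    proof -
      have "(N powr (1 / p - 1))\<^sup>2 = N powr (2 / p) / N\<^sup>2"
        using powr_square_diff_one[OF N, of "2 / p"] by simp
      moreover have "(real s powr (e - 1))\<^sup>2 = real s powr (2 * e - 2)"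
        unfolding powr_square by (simp add: right_diff_distrib)
      ultimately show ?thesis by (simp add: power_mult_distrib)
    qed
    finally show "1 / N\<^sup>2 * avg (PiE J columns) V \<le>
      (2 * real s powr (- (1 / 2)) * N powr (- (1 / 2)))\<^sup>2 + (4 * real s powr (e - 1) * N powr (1 / p - 1))\<^sup>2" .
  qed
  also have "\<dots> \<le> 2 * real s powr (- (1 / 2)) * N powr (- (1 / 2)) + 4 * real s powr (e - 1) * N powr (1 / p - 1)"
    by (intro sqrt_sum_squares_le_sum) auto
  finally show ?thesis by (simp add: N_def e_def)
qed

section \<open>Finite uniform randomization\<close>

text \<open>
  Randomness that is uniform on a finite set suffices for the upper bounds; measurability is then trivial
  and expectations are finite averages.
\<close>

lemma uniform_ran_algorithm:
  fixes A :: "'w \<Rightarrow> ('f, 'k, 'g::banach) det_alg"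
  assumes \<Omega>: "finite \<Omega>" "\<Omega> \<noteq> {}" and det: "\<And>\<omega>. det_algorithm \<Lambda> (A \<omega>)"
    and card: "\<And>\<omega> f. \<omega> \<in> \<Omega> \<Longrightarrow> f \<in> F \<Longrightarrow> alg_card (A \<omega>) f \<le> enat n"
    and err: "\<And>f. f \<in> F \<Longrightarrow> avg \<Omega> (\<lambda>\<omega>. norm (S f - alg_out (A \<omega>) f)) \<le> e"
  shows "e_ran F S \<Lambda> n \<le> ennreal e"
    and "(\<And>\<omega>. nonadaptive (A \<omega>)) \<Longrightarrow> e_ran_non F S \<Lambda> n \<le> ennreal e"
proof -
  define M where "M = measure_pmf (pmf_of_set \<Omega>)"
  have set: "set_pmf (pmf_of_set \<Omega>) = \<Omega>" using \<Omega> by simp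
  have alg: "ran_algorithm F \<Lambda> M A"
    unfolding ran_algorithm_def
  proof (intro conjI ballI)
    fix f assume "f \<in> F"
    have "AE \<omega> in M. alg_out (A \<omega>) f \<in> closure ((\<lambda>\<omega>. alg_out (A \<omega>) f) ` \<Omega>)"
      unfolding M_def AE_measure_pmf_iff set using closure_subset by fastforce
    then show "\<exists>D. countable D \<and> (AE \<omega> in M. alg_out (A \<omega>) f \<in> closure D)"
      using \<Omega> by (intro exI[of _ "(\<lambda>\<omega>. alg_out (A \<omega>) f) ` \<Omega>"]) (auto intro: countable_finite)
  qed (auto simp: M_def det measure_pmf.prob_space_axioms)
  have "ran_card F M A \<le> of_nat n"
    unfolding ran_card_def
  proof (rule SUP_least)
    fix f assume f: "f \<in> F"
    have "(\<integral>\<^sup>+\<omega>. ennreal_of_enat (alg_card (A \<omega>) f) \<partial>M) \<le> (\<integral>\<^sup>+\<omega>. of_nat n \<partial>M)"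
    proof (rule nn_integral_mono_AE)
      have "ennreal_of_enat (alg_card (A \<omega>) f) \<le> of_nat n" if "\<omega> \<in> \<Omega>" for \<omega>
        using card[OF that f] ennreal_of_enat_le_iff[of "alg_card (A \<omega>) f" "enat n"] by simp
      then show "AE \<omega> in M. ennreal_of_enat (alg_card (A \<omega>) f) \<le> of_nat n"
        unfolding M_def AE_measure_pmf_iff set by blast
    qed
    also have "\<dots> = of_nat n" by (simp add: M_def)
    finally show "(\<integral>\<^sup>+\<omega>. ennreal_of_enat (alg_card (A \<omega>) f) \<partial>M) \<le> of_nat n" .
  qed
  moreover have "ran_error F S M A \<le> ennreal e"
    unfolding ran_error_def
  proof (rule SUP_least)
    fix f assume f: "f \<in> F"
    have "(\<integral>\<^sup>+\<omega>. ennreal (norm (S f - alg_out (A \<omega>) f)) \<partial>M)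
       = (\<Sum>\<omega>\<in>\<Omega>. ennreal (norm (S f - alg_out (A \<omega>) f))) / of_nat (card \<Omega>)"
      unfolding M_def using \<Omega> by (simp add: nn_integral_pmf_of_set)
    also have "\<dots> = ennreal (avg \<Omega> (\<lambda>\<omega>. norm (S f - alg_out (A \<omega>) f)))"
      using \<Omega> by (simp add: avg_def ennreal_of_nat_eq_real_of_nat divide_ennreal sum_nonneg card_gt_0_iff divide_inverse mult.commute)
    also have "\<dots> \<le> ennreal e" by (rule ennreal_leI[OF err[OF f]])
    finally show "(\<integral>\<^sup>+\<omega>. ennreal (norm (S f - alg_out (A \<omega>) f)) \<partial>M) \<le> ennreal e" .
  qed
  ultimately show "e_ran F S \<Lambda> n \<le> ennreal e"
    and "(\<And>\<omega>. nonadaptive (A \<omega>)) \<Longrightarrow> e_ran_non F S \<Lambda> n \<le> ennreal e"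
    using e_ran_le[OF alg, of n S] e_ran_non_le[OF alg _, of n S] order_trans by blast+
qed

section \<open>The multilevel algorithms\<close>

definition exact_points :: "nat \<Rightarrow> pos list" where
  "exact_points m = concat (map (\<lambda>k. concat (map (\<lambda>i. map (\<lambda>j. (k, i, j)) [1..<Suc (2 ^ k)]) [1..<Suc (2 ^ k)])) [0..<Suc m])"

definition sample_points :: "nat \<Rightarrow> (nat \<Rightarrow> nat \<Rightarrow> nat) \<Rightarrow> (nat \<times> nat \<times> nat \<Rightarrow> nat) \<Rightarrow> pos list" where
  "sample_points m \<nu> \<omega> =
     concat (map (\<lambda>k. concat (map (\<lambda>i. map (\<lambda>r. (k, i, \<omega> (k, i, r))) [0..<\<nu> k i]) [1..<Suc (2 ^ k)])) [Suc m..<Suc (2 * m)])"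

definition multilevel ::
  "real \<Rightarrow> nat \<Rightarrow> (nat \<Rightarrow> nat \<Rightarrow> nat) \<Rightarrow> (nat \<times> nat \<times> nat \<Rightarrow> nat) \<Rightarrow> ('a::real_normed_field levels) \<Rightarrow> 'a" where
  "multilevel \<alpha> m \<nu> \<omega> f =
     (\<Sum>k\<le>m. of_real (2 powr (- \<alpha> * real k)) * mean_op (2 ^ k) (2 ^ k) (f k)) +
     (\<Sum>k=Suc m..2 * m. of_real (2 powr (- \<alpha> * real k)) * row_mean_sample k (\<nu> k) \<omega> (f k))"

definition sample_index :: "nat \<Rightarrow> (nat \<Rightarrow> nat) \<Rightarrow> (nat \<times> nat \<times> nat) set" where
  "sample_index m R = (\<Union>k\<in>{Suc m..2 * m}. \<Union>i\<in>{1..2 ^ k}. row_index k i (R k))"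

lemma set_exact_points: "(k, i, j) \<in> set (exact_points m) \<longleftrightarrow> k \<le> m \<and> i \<in> {1..2 ^ k} \<and> j \<in> {1..2 ^ k}"
  unfolding exact_points_def 
  by (fastforce simp del: upt_Suc simp: atLeastLessThanSuc_atLeastAtMost image_iff)

lemma set_sample_points:
  "(k, i, j) \<in> set (sample_points m \<nu> \<omega>) \<longleftrightarrow>
     k \<in> {Suc m..2 * m} \<and> i \<in> {1..2 ^ k} \<and> (\<exists>r<\<nu> k i. j = \<omega> (k, i, r))"
  unfolding sample_points_def 
  by (fastforce simp del: upt_Suc simp: atLeastLessThanSuc_atLeastAtMost image_iff)

lemma sum_list_upt: "sum_list (map (g :: nat \<Rightarrow> nat) [a..<Suc b]) = (\<Sum>k=a..b. g k)"
  by (simp del: upt_Suc add: sum_set_upt_conv_sum_list_nat[symmetric] atLeastLessThanSuc_atLeastAtMost)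

lemma length_exact_points: "length (exact_points m) = (\<Sum>k\<le>m. 4 ^ k)"
proof -
  have "length (exact_points m) = (\<Sum>k=0..m. \<Sum>i=1..(2::nat) ^ k. 2 ^ k)"
    unfolding exact_points_def length_concat map_map comp_def sum_list_upt length_map by simp
  also have "\<dots> = (\<Sum>k=0..m. 4 ^ k)" by (intro sum.cong) (auto simp flip: power_mult_distrib)
  finally show ?thesis by (simp add: atMost_atLeast0)
qed

lemma length_sample_points: "length (sample_points m \<nu> \<omega>) = (\<Sum>k=Suc m..2 * m. \<Sum>i=1..2 ^ k. \<nu> k i)"
  unfolding sample_points_def length_concat map_map comp_def sum_list_upt length_map by simp

lemma finite_sample_index: "finite (sample_index m R)"
  by (auto simp: sample_index_def row_index_def)

lemma row_index_subset_sample_index: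
  assumes "k \<in> {Suc m..2 * m}" "i \<in> {1..2 ^ k}" "n \<le> R k"
  shows "row_index k i n \<subseteq> sample_index m R"
  using assms by (fastforce simp: sample_index_def row_index_def)

lemma valid_exact_points: "list_all valid (exact_points m)"
proof -
  have "valid q" if "q \<in> set (exact_points m)" for q
  proof -
    obtain k i j where "q = (k, i, j)" by (cases q)
    then show ?thesis using that set_exact_points[of k i j m] by (simp add: valid_def)
  qed
  then show ?thesis unfolding list_all_iff by blast
qed

lemma valid_sample_points:
  assumes \<omega>: "\<omega> \<in> PiE (sample_index m R) columns"
    and \<nu>: "\<And>k i. k \<in> {Suc m..2 * m} \<Longrightarrow> i \<in> {1..2 ^ k} \<Longrightarrow> \<nu> k i \<le> R k"
  shows "list_all valid (sample_points m \<nu> \<omega>)"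
proof -
  have "valid (k, i, j)" if q: "(k, i, j) \<in> set (sample_points m \<nu> \<omega>)" for k i j
  proof -
    obtain r where r: "k \<in> {Suc m..2 * m}" "i \<in> {1..2 ^ k}" "r < \<nu> k i" "j = \<omega> (k, i, r)"
      using q unfolding set_sample_points by blast
    then have "(k, i, r) \<in> row_index k i (\<nu> k i)" by (simp add: row_index_def)
    then have "(k, i, r) \<in> sample_index m R"
      using row_index_subset_sample_index[where R = R, OF r(1,2) \<nu>[OF r(1,2)]] by blast
    then have "\<omega> (k, i, r) \<in> columns (k, i, r)" by (rule PiE_mem[OF \<omega>])
    then show ?thesis using r by (simp add: valid_def columns_def)
  qed
  then show ?thesis unfolding list_all_iff by (metis prod_cases3)
qed

lemma mean_op_exact_cong:
  assumes "\<And>k i j. (k, i, j) \<in> set (exact_points m) \<Longrightarrow> f k i j = g k i j" "k \<le> m"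
  shows "mean_op (2 ^ k) (2 ^ k) (f k) = mean_op (2 ^ k) (2 ^ k) (g k)"
  unfolding mean_op_def using assms(2)
  by (intro arg_cong2[where f = "(*)"] sum.cong refl assms(1)) (auto simp: set_exact_points)

lemma multilevel_cong:
  assumes exact: "\<And>k i j. (k, i, j) \<in> set (exact_points m) \<Longrightarrow> f k i j = g k i j"
    and sample: "\<And>k i j. (k, i, j) \<in> set (sample_points m \<nu> \<omega>) \<Longrightarrow> f k i j = g k i j"
    and \<nu>: "\<And>k i. k \<in> {Suc m..2 * m} \<Longrightarrow> i \<in> {1..2 ^ k} \<Longrightarrow> \<nu>' k i = \<nu> k i"
  shows "multilevel \<alpha> m \<nu> \<omega> f = multilevel \<alpha> m \<nu>' \<omega> g"
proof -
  have "mean_op (2 ^ k) (2 ^ k) (f k) = mean_op (2 ^ k) (2 ^ k) (g k)" if "k \<le> m" for k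
    using exact that by (rule mean_op_exact_cong)
  moreover have "row_mean_sample k (\<nu> k) \<omega> (f k) = row_mean_sample k (\<nu>' k) \<omega> (g k)" if k: "k \<in> {Suc m..2 * m}" for k
    unfolding row_mean_sample_def
  proof (rule sum.cong[OF refl])
    fix i :: nat assume i: "i \<in> {1..2 ^ k}"
    have "f k i (\<omega> (k, i, r)) = g k i (\<omega> (k, i, r))" if "r < \<nu> k i" for r
      using k i that by (intro sample) (auto simp: set_sample_points)
    then show "(\<Sum>r<\<nu> k i. f k i (\<omega> (k, i, r)) /\<^sub>R (2 ^ k * real (\<nu> k i))) =
        (\<Sum>r<\<nu>' k i. g k i (\<omega> (k, i, r)) /\<^sub>R (2 ^ k * real (\<nu>' k i)))"
      unfolding \<nu>[OF k i] by (intro sum.cong) auto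
  qed
  ultimately show ?thesis unfolding multilevel_def by (intro arg_cong2[where f = "(+)"] sum.cong) auto
qed

lemma allocation_cong:
  assumes "\<And>i r. i \<in> {1..2 ^ k} \<Longrightarrow> r < s \<Longrightarrow> f i (\<omega> (k, i, r)) = g i (\<omega> (k, i, r))" "i \<in> {1..2 ^ k}"
  shows "allocation k s \<omega> f i = allocation k s \<omega> g i"
proof -
  have size: "row_size k s \<omega> f l = row_size k s \<omega> g l" if "l \<in> {1..2 ^ k}" for l
    unfolding row_size_def using assms(1)[OF that]
    by (intro arg_cong[where f = sqrt] arg_cong2[where f = "(/)"] sum.cong refl) (auto simp: row_index_def)
  have "(\<Sum>l=1..2 ^ k. row_size k s \<omega> f l) = (\<Sum>l=1..2 ^ k. row_size k s \<omega> g l)"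
    by (rule sum.cong[OF refl size])
  then show ?thesis unfolding allocation_def size[OF assms(2)] by simp
qed

text \<open>
  The two components of \<open>\<omega>\<close> supply the samples of the two stages. They are
  independent, so that conditionally on the first stage the second one is a sampling scheme with fixed
  sizes.
\<close>

definition adaptive_alg ::
  "real \<Rightarrow> nat \<Rightarrow> (nat \<Rightarrow> nat) \<Rightarrow> (nat \<times> nat \<times> nat \<Rightarrow> nat) \<times> (nat \<times> nat \<times> nat \<Rightarrow> nat)
    \<Rightarrow> ('a::real_normed_field levels, 'a, 'a) det_alg" where
  "adaptive_alg \<alpha> m s \<omega> =
     two_stage (exact_points m @ sample_points m (\<lambda>k _. s k) (fst \<omega>))
       (\<lambda>f. sample_points m (\<lambda>k. allocation k (s k) (fst \<omega>) (f k)) (snd \<omega>))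
       (\<lambda>f. multilevel \<alpha> m (\<lambda>k. allocation k (s k) (fst \<omega>) (f k)) (snd \<omega>) f)"

text \<open>
  The number \<open>3 * s k * 2 ^ k\<close> of samples provided in each row is the bound of
  \<open>allocation_bounds\<close>; in the cost the factor \<open>4\<close> combines one part for the
  first stage with three for the second.
\<close>

lemma adaptive_alg_run:
  fixes f :: "'a::real_normed_field levels" and m :: nat and s :: "nat \<Rightarrow> nat"
  defines "J \<equiv> sample_index m (\<lambda>k. 3 * s k * 2 ^ k)"
  assumes s: "\<And>k. 1 \<le> s k" and \<omega>: "\<omega>1 \<in> PiE J columns" "\<omega>2 \<in> PiE J columns"
  shows "alg_out (adaptive_alg \<alpha> m s (\<omega>1, \<omega>2)) f = multilevel \<alpha> m (\<lambda>k. allocation k (s k) \<omega>1 (f k)) \<omega>2 f"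
    and "alg_card (adaptive_alg \<alpha> m s (\<omega>1, \<omega>2)) f \<le> enat ((\<Sum>k\<le>m. 4 ^ k) + 4 * (\<Sum>k=Suc m..2 * m. s k * 2 ^ k))"
proof -
  let ?P1 = "exact_points m @ sample_points m (\<lambda>k _. s k) \<omega>1"
  let ?P2 = "\<lambda>f :: 'a levels. sample_points m (\<lambda>k. allocation k (s k) \<omega>1 (f k)) \<omega>2"
  let ?\<Phi> = "\<lambda>f :: 'a levels. multilevel \<alpha> m (\<lambda>k. allocation k (s k) \<omega>1 (f k)) \<omega>2 f"
  have A: "adaptive_alg \<alpha> m s (\<omega>1, \<omega>2) = two_stage ?P1 ?P2 ?\<Phi>"
    by (simp add: adaptive_alg_def)
  have alloc: "allocation k (s k) \<omega>1 (g k) i = allocation k (s k) \<omega>1 (h k) i"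
    if "\<And>k i j. (k, i, j) \<in> set ?P1 \<Longrightarrow> g k i j = h k i j" "k \<in> {Suc m..2 * m}" "i \<in> {1..2 ^ k}"
    for g h :: "'a levels" and k i
    using that(2,3) by (intro allocation_cong that(1)) (auto simp: set_sample_points)
  have run: "alg_card (two_stage ?P1 ?P2 ?\<Phi>) f = enat (length ?P1 + length (?P2 f)) \<and> alg_out (two_stage ?P1 ?P2 ?\<Phi>) f = ?\<Phi> f"
  proof (intro conjI two_stage_run)
    show "list_all valid ?P1"
    proof -
      have "s k \<le> 3 * s k * 2 ^ k" for k by simp
      then show ?thesis
        using valid_exact_points valid_sample_points[OF \<omega>(1)[unfolded J_def], of "\<lambda>k _. s k"] by simp
    qed
    then show "list_all valid ?P1" .
    show "list_all valid (?P2 g)" for g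
      by (rule valid_sample_points[OF \<omega>(2)[unfolded J_def]], rule allocation_bounds(2)[OF s])
    then show "list_all valid (?P2 g)" for g .
    show "?P2 g = ?P2 h" if eq: "\<And>k i j. (k, i, j) \<in> set ?P1 \<Longrightarrow> g k i j = h k i j" for g h
      unfolding sample_points_def
    proof (intro arg_cong[where f = concat] map_cong refl)
      fix k i assume ki: "k \<in> set [Suc m..<Suc (2 * m)]" "i \<in> set [1..<Suc (2 ^ k)]"
      show "[0..<allocation k (s k) \<omega>1 (g k) i] = [0..<allocation k (s k) \<omega>1 (h k) i]"
        by (rule arg_cong[where f = "\<lambda>n. [0..<n]"], rule alloc[OF eq]) (use ki in auto)
    qed
    then show "?P2 g = ?P2 h" if "\<And>k i j. (k, i, j) \<in> set ?P1 \<Longrightarrow> g k i j = h k i j" for g h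
      using that by blast
    show "?\<Phi> g = ?\<Phi> h" if eq: "\<And>k i j. (k, i, j) \<in> set ?P1 \<union> set (?P2 g) \<Longrightarrow> g k i j = h k i j" for g h
      by (rule multilevel_cong) (use eq in \<open>auto intro!: alloc[symmetric]\<close>)
    then show "?\<Phi> g = ?\<Phi> h" if "\<And>k i j. (k, i, j) \<in> set ?P1 \<union> set (?P2 g) \<Longrightarrow> g k i j = h k i j" for g h
      using that by blast
  qed
  then show "alg_out (adaptive_alg \<alpha> m s (\<omega>1, \<omega>2)) f = ?\<Phi> f" unfolding A by blast
  have "length ?P1 = (\<Sum>k\<le>m. 4 ^ k) + (\<Sum>k=Suc m..2 * m. s k * 2 ^ k)"
    by (simp add: length_exact_points length_sample_points mult.commute)
  moreover have "length (?P2 f) \<le> (\<Sum>k=Suc m..2 * m. 3 * s k * 2 ^ k)"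
    unfolding length_sample_points by (intro sum_mono allocation_bounds(3)[OF s])
  moreover have "(\<Sum>k=Suc m..2 * m. 3 * s k * 2 ^ k) = 3 * (\<Sum>k=Suc m..2 * m. s k * 2 ^ k)"
    by (simp add: sum_distrib_left mult.assoc)
  ultimately have "length ?P1 + length (?P2 f) \<le> (\<Sum>k\<le>m. 4 ^ k) + 4 * (\<Sum>k=Suc m..2 * m. s k * 2 ^ k)"
    by linarith
  then show "alg_card (adaptive_alg \<alpha> m s (\<omega>1, \<omega>2)) f \<le> enat ((\<Sum>k\<le>m. 4 ^ k) + 4 * (\<Sum>k=Suc m..2 * m. s k * 2 ^ k))"
    unfolding A using run by simp
qed

definition nonadaptive_alg ::
  "real \<Rightarrow> nat \<Rightarrow> (nat \<Rightarrow> nat) \<Rightarrow> (nat \<times> nat \<times> nat \<Rightarrow> nat) \<Rightarrow> ('a::real_normed_field levels, 'a, 'a) det_alg" where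
  "nonadaptive_alg \<alpha> m s \<omega> =
     two_stage (exact_points m @ sample_points m (\<lambda>k _. s k) \<omega>) (\<lambda>_. []) (multilevel \<alpha> m (\<lambda>k _. s k) \<omega>)"

lemma nonadaptive_alg_run:
  fixes f :: "'a::real_normed_field levels"
  assumes \<omega>: "\<omega> \<in> PiE (sample_index m s) columns"
  shows "alg_out (nonadaptive_alg \<alpha> m s \<omega>) f = multilevel \<alpha> m (\<lambda>k _. s k) \<omega> f"
    and "alg_card (nonadaptive_alg \<alpha> m s \<omega>) f \<le> enat ((\<Sum>k\<le>m. 4 ^ k) + (\<Sum>k=Suc m..2 * m. s k * 2 ^ k))"
proof -
  let ?P1 = "exact_points m @ sample_points m (\<lambda>k _. s k) \<omega>"
  have valid: "list_all valid ?P1"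
    using valid_exact_points valid_sample_points[OF \<omega>, of "\<lambda>k _. s k"] by simp
  have cong: "multilevel \<alpha> m (\<lambda>k _. s k) \<omega> g = multilevel \<alpha> m (\<lambda>k _. s k) \<omega> h"
    if "\<And>k i j. (k, i, j) \<in> set ?P1 \<union> set [] \<Longrightarrow> g k i j = h k i j" for g h :: "'a levels"
    using that by (intro multilevel_cong) auto
  have run: "alg_card (nonadaptive_alg \<alpha> m s \<omega>) f = enat (length ?P1 + length ([] :: pos list)) \<and>
      alg_out (nonadaptive_alg \<alpha> m s \<omega>) f = multilevel \<alpha> m (\<lambda>k _. s k) \<omega> f"
    unfolding nonadaptive_alg_def by (intro conjI two_stage_run cong) (use valid in auto)
  then show "alg_out (nonadaptive_alg \<alpha> m s \<omega>) f = multilevel \<alpha> m (\<lambda>k _. s k) \<omega> f" by blast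
  from run have "alg_card (nonadaptive_alg \<alpha> m s \<omega>) f = enat (length ?P1 + length ([] :: pos list))" by blast
  then show "alg_card (nonadaptive_alg \<alpha> m s \<omega>) f \<le> enat ((\<Sum>k\<le>m. 4 ^ k) + (\<Sum>k=Suc m..2 * m. s k * 2 ^ k))"
    by (simp add: length_exact_points length_sample_points mult.commute)
qed

section \<open>Errors of the multilevel algorithms\<close>

lemma X_ball_levels:
  assumes p1: "1 \<le> p1" and f: "f \<in> X_ball p u p1"
  shows "LL_norm p (2 ^ k) u (2 ^ k) (f k) \<le> 1"
proof -
  define a where "a = X_level_norms p u f"
  have f: "in_lq p1 a" "lq_norm p1 a \<le> 1" using f by (auto simp: X_ball_def X_space_def X_norm_def a_def)
  have "\<bar>a k\<bar> \<le> 1"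
  proof (cases p1)
    case (real r)
    then have r: "1 \<le> r" using p1 by simp
    have sm: "summable (\<lambda>k. \<bar>a k\<bar> powr r)" using f(1) real by (simp add: in_lq_def)
    define t where "t = (\<Sum>k. \<bar>a k\<bar> powr r)"
    have t: "t powr (1 / r) \<le> 1" using f(2) real by (simp add: lq_norm_def t_def)
    have t0: "0 \<le> t" unfolding t_def by (intro suminf_nonneg sm) auto
    have "(t powr (1 / r)) powr r \<le> 1 powr r" using t r by (intro powr_mono2) auto
    then have "t \<le> 1" using r t0 by (simp add: powr_powr)
    moreover have "\<bar>a k\<bar> powr r \<le> t"
      unfolding t_def using sum_le_suminf[OF sm, of "{k}"] by simp
    ultimately have "(\<bar>a k\<bar> powr r) powr (1 / r) \<le> 1 powr (1 / r)" using r by (intro powr_mono2) auto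
    then show ?thesis using r by (simp add: powr_powr)
  next
    case PInf
    then obtain c where "\<And>k. \<bar>a k\<bar> \<le> c" using f(1) by (auto simp: in_lq_def bounded_iff)
    then have "bdd_above (range (\<lambda>k. \<bar>a k\<bar>))" by (rule bdd_aboveI2)
    then have "\<bar>a k\<bar> \<le> (SUP k. \<bar>a k\<bar>)" by (intro cSUP_upper) auto
    then show ?thesis using f(2) PInf by (simp add: lq_norm_def)
  qed (use p1 in auto)
  then show ?thesis by (simp add: a_def X_level_norms_def)
qed

lemma two_powr_nat: "2 powr (- \<alpha> * real k) = (2 powr (- \<alpha>)) ^ k"
  by (simp add: powr_realpow[symmetric] powr_powr)

text \<open>
  As \<open>\<alpha> > 1\<close>, the weights decrease by a factor of at least \<open>2\<close> from
  level to level, hence the sum of all weights after the \<open>M\<close>-th one is at most the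
  \<open>M\<close>-th one.
\<close>

lemma I_op_truncation:
  fixes f :: "'a::{real_normed_field, banach} levels"
  assumes \<alpha>: "1 < \<alpha>" and f: "\<And>k. norm (mean_op (2 ^ k) (2 ^ k) (f k)) \<le> 1"
  shows "norm (I_op \<alpha> f - (\<Sum>k\<le>M. of_real (2 powr (- \<alpha> * real k)) * mean_op (2 ^ k) (2 ^ k) (f k)))
    \<le> 2 powr (- \<alpha> * real M)"
proof -
  define q where "q = (2::real) powr (- \<alpha>)"
  have "q \<le> 2 powr (- 1)" using \<alpha> unfolding q_def by (intro powr_mono) auto
  then have q: "0 < q" "q \<le> 1 / 2" by (auto simp: q_def powr_minus)
  define g where "g k = of_real (2 powr (- \<alpha> * real k)) * mean_op (2 ^ k) (2 ^ k) (f k)" for k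
  have g: "norm (g k) \<le> q ^ k" for k
    using mult_left_mono[OF f[of k], of "q ^ k"] q
    by (simp only: g_def norm_mult norm_of_real two_powr_nat[of \<alpha> k, folded q_def]) simp
  have gs: "summable (\<lambda>k. q ^ k)" using q by (intro summable_geometric) auto
  have sm: "summable (\<lambda>k. norm (g k))" by (rule summable_comparison_test'[OF gs]) (simp add: g)
  have "I_op \<alpha> f - (\<Sum>k<Suc M. g k) = (\<Sum>k. g (k + Suc M))"
    unfolding I_op_def g_def[symmetric] using suminf_minus_initial_segment[OF summable_norm_cancel[OF sm], of "Suc M"] by simp
  then have "norm (I_op \<alpha> f - (\<Sum>k\<le>M. g k)) = norm (\<Sum>k. g (k + Suc M))" by (simp add: lessThan_Suc_atMost)
  also have "\<dots> \<le> (\<Sum>k. norm (g (k + Suc M)))"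
    by (intro summable_norm summable_ignore_initial_segment sm)
  also have "\<dots> \<le> (\<Sum>k. q ^ Suc M * q ^ k)"
  proof (rule suminf_le)
    show "norm (g (k + Suc M)) \<le> q ^ Suc M * q ^ k" for k using g[of "k + Suc M"] by (simp add: power_add mult_ac)
    show "summable (\<lambda>k. norm (g (k + Suc M)))" by (rule summable_ignore_initial_segment[OF sm])
    show "summable (\<lambda>k. q ^ Suc M * q ^ k)" by (rule summable_mult[OF gs])
  qed
  also have "\<dots> = q ^ Suc M * (1 / (1 - q))"
    using q by (simp add: suminf_mult[OF gs] suminf_geometric del: power_Suc)
  also have "\<dots> = q ^ M * (q / (1 - q))" by simp
  also have "\<dots> \<le> q ^ M * 1" using q by (intro mult_left_mono) auto
  finally show ?thesis unfolding g_def two_powr_nat[of \<alpha> M] q_def by simp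
qed

lemma multilevel_error:
  fixes f :: "'a::{real_normed_field, banach} levels"
  assumes \<alpha>: "1 < \<alpha>" and f: "\<And>k. norm (mean_op (2 ^ k) (2 ^ k) (f k)) \<le> 1"
  shows "norm (I_op \<alpha> f - multilevel \<alpha> m \<nu> \<omega> f)
    \<le> (\<Sum>k=Suc m..2 * m. 2 powr (- \<alpha> * real k) *
         norm (mean_op (2 ^ k) (2 ^ k) (f k) - row_mean_sample k (\<nu> k) \<omega> (f k))) + 2 powr (- \<alpha> * (2 * real m))"
proof -
  define g where "g k = of_real (2 powr (- \<alpha> * real k)) * mean_op (2 ^ k) (2 ^ k) (f k)" for k
  define h where "h k = of_real (2 powr (- \<alpha> * real k)) * (mean_op (2 ^ k) (2 ^ k) (f k) - row_mean_sample k (\<nu> k) \<omega> (f k))" for k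
  have split: "(\<Sum>k\<le>2 * m. g k) = (\<Sum>k\<le>m. g k) + (\<Sum>k=Suc m..2 * m. g k)"
  proof -
    have "{..2 * m} = {..m} \<union> {Suc m..2 * m}" by auto
    then show ?thesis by (simp add: sum.union_disjoint)
  qed
  have "I_op \<alpha> f - multilevel \<alpha> m \<nu> \<omega> f = (I_op \<alpha> f - (\<Sum>k\<le>2 * m. g k)) + (\<Sum>k=Suc m..2 * m. h k)"
    unfolding split by (simp add: multilevel_def g_def h_def sum_subtractf right_diff_distrib)
  also have "norm \<dots> \<le> norm (I_op \<alpha> f - (\<Sum>k\<le>2 * m. g k)) + norm (\<Sum>k=Suc m..2 * m. h k)"
    by (rule norm_triangle_ineq)
  also have "\<dots> \<le> 2 powr (- \<alpha> * real (2 * m)) + (\<Sum>k=Suc m..2 * m. norm (h k))"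
    using I_op_truncation[OF \<alpha> f, of "2 * m"] norm_sum unfolding g_def by (intro add_mono) auto
  finally show ?thesis by (simp add: h_def norm_mult)
qed

section \<open>Sample sizes and rates\<close>

text \<open>
  On the level \<open>m + l\<close> every row receives about \<open>2 powr (m - (1 + \<delta>) *
  l)\<close> samples with \<open>\<delta> = (\<alpha> - 1) / 2\<close>. As the number of rows is \<open>2
  ^ (m + l)\<close>, the number of samples decays like \<open>decay \<alpha> ^ l = 2 powr (- \<delta> *
  l)\<close>. The weighted errors decay at least as fast: since \<open>\<alpha> = 1 + 2 *
  \<delta>\<close>, the weight still gains a factor \<open>2 powr (- \<delta> * l)\<close> against
  \<open>1 / s\<close>, where \<open>s\<close> is the number of samples in a row.
\<close>

definition decay :: "real \<Rightarrow> real" where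
  "decay \<alpha> = 2 powr (- ((\<alpha> - 1) / 2))"

definition samples_per_row :: "real \<Rightarrow> nat \<Rightarrow> nat \<Rightarrow> nat" where
  "samples_per_row \<alpha> m k = nat \<lceil>2 powr (real m - (\<alpha> + 1) / 2 * (real k - real m))\<rceil>"

lemma two_powr_double: "2 powr (2 * real m) = (4::real) ^ m"
proof -
  have "2 powr (2 * real m) = (2 powr 2) powr real m" by (simp only: powr_powr)
  also have "\<dots> = 4 powr real m" by simp
  also have "\<dots> = 4 ^ m" by (simp only: powr_realpow zero_less_numeral)
  finally show ?thesis .
qed

lemma decay_bounds: "1 < \<alpha> \<Longrightarrow> 0 < decay \<alpha> \<and> decay \<alpha> < 1"
  by (simp add: decay_def powr_less_one)

lemma decay_power: "decay \<alpha> ^ l = 2 powr (- ((\<alpha> - 1) / 2 * real l))"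
  by (simp add: decay_def powr_realpow[symmetric] powr_powr)

lemma samples_per_row_ge:
  "2 powr (real m - (\<alpha> + 1) / 2 * (real k - real m)) \<le> real (samples_per_row \<alpha> m k)"
  unfolding samples_per_row_def by linarith

lemma samples_per_row_le:
  "real (samples_per_row \<alpha> m k) \<le> 2 powr (real m - (\<alpha> + 1) / 2 * (real k - real m)) + 1"
proof -
  have "0 < 2 powr (real m - (\<alpha> + 1) / 2 * (real k - real m))" by simp
  then show ?thesis unfolding samples_per_row_def by linarith
qed

lemma samples_per_row_pos: "1 \<le> samples_per_row \<alpha> m k"
proof -
  have "0 < real (samples_per_row \<alpha> m k)"
    by (rule less_le_trans[OF _ samples_per_row_ge]) simp
  then show ?thesis by simp
qed

lemma sum_levels_geometric:
  fixes q :: real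
  assumes q: "0 < q" "q < 1" and c: "0 \<le> c" and g: "\<And>k. k \<in> {Suc m..2 * m} \<Longrightarrow> g k \<le> c * q ^ (k - m)"
  shows "(\<Sum>k=Suc m..2 * m. g k) \<le> c * (1 / (1 - q))"
proof -
  have "(\<Sum>k=Suc m..2 * m. g k) \<le> (\<Sum>k=Suc m..2 * m. c * q ^ (k - m))" by (rule sum_mono[OF g])
  also have "\<dots> = c * (\<Sum>k=1 + m..m + m. q ^ (k - m))" by (simp add: sum_distrib_left mult_2)
  also have "(\<Sum>k=1 + m..m + m. q ^ (k - m)) = (\<Sum>l=1..m. q ^ l)"
    by (subst sum.shift_bounds_cl_nat_ivl) simp
  also have "c * \<dots> \<le> c * (\<Sum>l. q ^ l)"
    using q c by (intro mult_left_mono sum_le_suminf summable_geometric) auto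
  also have "(\<Sum>l. q ^ l) = 1 / (1 - q)" using q by (intro suminf_geometric) auto
  finally show ?thesis .
qed

text \<open>
  Rounding up costs at most one sample for each row. There are fewer than \<open>2 * 4 ^ m\<close> rows
  on all levels up to \<open>2 * m\<close>, so this is of the order of the budget; it is the reason why
  sampling stops at level \<open>2 * m\<close>.
\<close>

lemma total_cost:
  assumes \<alpha>: "1 < \<alpha>"
  shows "real ((\<Sum>k\<le>m. 4 ^ k) + 4 * (\<Sum>k=Suc m..2 * m. samples_per_row \<alpha> m k * 2 ^ k))
    \<le> (10 + 4 / (1 - decay \<alpha>)) * 4 ^ m"
proof -
  note q = decay_bounds[OF \<alpha>]
  have four: "(\<Sum>k\<le>m. (4::real) ^ k) \<le> 2 * 4 ^ m"
  proof (induction m)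
    case (Suc m)
    moreover have "0 \<le> (4::real) ^ m" by simp
    ultimately show ?case unfolding sum.atMost_Suc power_Suc by linarith
  qed simp
  have "(\<Sum>k\<le>2 * m. (2::real) ^ k) \<le> 2 * 2 ^ (2 * m)"
    using sum_gp[of "2::real" 0 "2 * m"] by (simp add: atMost_atLeast0)
  moreover have "(\<Sum>k=Suc m..2 * m. (2::real) ^ k) \<le> (\<Sum>k\<le>2 * m. 2 ^ k)" by (intro sum_mono2) auto
  ultimately have two: "(\<Sum>k=Suc m..2 * m. (2::real) ^ k) \<le> 2 * 4 ^ m" by (simp add: power_mult)
  have "(\<Sum>k=Suc m..2 * m. 2 powr (real m - (\<alpha> + 1) / 2 * (real k - real m)) * 2 ^ k) \<le> 4 ^ m * (1 / (1 - decay \<alpha>))"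
  proof (rule sum_levels_geometric)
    fix k assume k: "k \<in> {Suc m..2 * m}"
    define l where "l = k - m"
    have kl: "k = m + l" using k by (simp add: l_def)
    have "2 powr (real m - (\<alpha> + 1) / 2 * (real k - real m)) * 2 ^ k
        = 2 powr (real m - (\<alpha> + 1) / 2 * (real k - real m) + real k)"
      by (simp only: powr_add powr_realpow zero_less_numeral)
    also have "real m - (\<alpha> + 1) / 2 * (real k - real m) + real k = 2 * real m + - ((\<alpha> - 1) / 2 * real l)"
      by (simp add: kl field_simps)
    also have "2 powr (2 * real m + - ((\<alpha> - 1) / 2 * real l)) = 2 powr (2 * real m) * decay \<alpha> ^ l"
      by (simp only: powr_add decay_power)
    also have "2 powr (2 * real m) = 4 ^ m"
      by (rule two_powr_double)
    finally show "2 powr (real m - (\<alpha> + 1) / 2 * (real k - real m)) * 2 ^ k \<le> 4 ^ m * decay \<alpha> ^ (k - m)"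
      by (simp add: l_def)
  qed (use q in auto)
  moreover have "(\<Sum>k=Suc m..2 * m. real (samples_per_row \<alpha> m k) * 2 ^ k)
      \<le> (\<Sum>k=Suc m..2 * m. 2 powr (real m - (\<alpha> + 1) / 2 * (real k - real m)) * 2 ^ k + 2 ^ k)"
  proof (rule sum_mono)
    fix k
    have "real (samples_per_row \<alpha> m k) * 2 ^ k \<le> (2 powr (real m - (\<alpha> + 1) / 2 * (real k - real m)) + 1) * 2 ^ k"
      by (intro mult_right_mono samples_per_row_le) simp
    then show "real (samples_per_row \<alpha> m k) * 2 ^ k \<le> 2 powr (real m - (\<alpha> + 1) / 2 * (real k - real m)) * 2 ^ k + 2 ^ k"
      by (simp only: distrib_right mult_1)
  qed
  ultimately have "(\<Sum>k=Suc m..2 * m. real (samples_per_row \<alpha> m k) * 2 ^ k) \<le> 4 ^ m * (1 / (1 - decay \<alpha>)) + 2 * 4 ^ m"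
    using two unfolding sum.distrib by linarith
  then have "real ((\<Sum>k\<le>m. 4 ^ k) + 4 * (\<Sum>k=Suc m..2 * m. samples_per_row \<alpha> m k * 2 ^ k))
      \<le> 2 * 4 ^ m + 4 * (4 ^ m * (1 / (1 - decay \<alpha>)) + 2 * 4 ^ m)"
    using four by simp
  also have "\<dots> = (10 + 4 / (1 - decay \<alpha>)) * 4 ^ m" by (simp add: algebra_simps)
  finally show ?thesis .
qed

text \<open>
  The level errors found above are of the form \<open>D * s powr (- \<gamma>) * (2 ^ k) powr
  \<beta>\<close> with \<open>\<beta> \<le> 0\<close> and \<open>0 \<le> \<gamma> \<le> 1\<close>. Up to
  a constant factor their weighted sum is the term of level \<open>m\<close> with \<open>2 ^ m\<close>
  samples per row.
\<close>

lemma sum_levels_rate: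
  fixes \<beta> \<gamma> :: real
  assumes \<alpha>: "1 < \<alpha>" and \<beta>: "\<beta> \<le> 0" and \<gamma>: "0 \<le> \<gamma>" "\<gamma> \<le> 1" and D: "0 \<le> D"
  shows "(\<Sum>k=Suc m..2 * m. 2 powr (- \<alpha> * real k) * (D * real (samples_per_row \<alpha> m k) powr (- \<gamma>) * (2 ^ k) powr \<beta>))
    \<le> D / (1 - decay \<alpha>) * 2 powr (real m * (- \<alpha> + \<beta> - \<gamma>))"
proof -
  note q = decay_bounds[OF \<alpha>]
  have "(\<Sum>k=Suc m..2 * m. 2 powr (- \<alpha> * real k) * (D * real (samples_per_row \<alpha> m k) powr (- \<gamma>) * (2 ^ k) powr \<beta>))
    \<le> D * 2 powr (real m * (- \<alpha> + \<beta> - \<gamma>)) * (1 / (1 - decay \<alpha>))"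
  proof (rule sum_levels_geometric)
    fix k assume k: "k \<in> {Suc m..2 * m}"
    define l where "l = k - m"
    have kl: "k = m + l" using k by (simp add: l_def)
    define x where "x = real m - (\<alpha> + 1) / 2 * (real k - real m)"
    have "real (samples_per_row \<alpha> m k) powr (- \<gamma>) \<le> (2 powr x) powr (- \<gamma>)"
      using samples_per_row_ge[of m \<alpha> k] \<gamma> unfolding x_def by (intro powr_mono2') auto
    also have "\<dots> = 2 powr (- (x * \<gamma>))" by (simp add: powr_powr)
    finally have s: "real (samples_per_row \<alpha> m k) powr (- \<gamma>) \<le> 2 powr (- (x * \<gamma>))" .
    have two: "((2::real) ^ k) powr \<beta> = 2 powr (real k * \<beta>)" by (simp add: powr_powr flip: powr_realpow)
    have "2 powr (- \<alpha> * real k) * (D * real (samples_per_row \<alpha> m k) powr (- \<gamma>) * (2 ^ k) powr \<beta>)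
        \<le> 2 powr (- \<alpha> * real k) * (D * 2 powr (- (x * \<gamma>)) * 2 powr (real k * \<beta>))"
      unfolding two by (intro mult_left_mono mult_right_mono s D) auto
    also have "\<dots> = D * 2 powr (- \<alpha> * real k + - (x * \<gamma>) + real k * \<beta>)" by (simp only: powr_add mult_ac)
    also have "\<dots> \<le> D * 2 powr (real m * (- \<alpha> + \<beta> - \<gamma>) + - ((\<alpha> - 1) / 2 * real l))"
    proof (intro mult_left_mono powr_mono D)
      have "real l * \<beta> \<le> 0" using \<beta> by (simp add: mult_nonneg_nonpos)
      moreover have "\<gamma> * ((\<alpha> + 1) / 2 * real l) \<le> 1 * ((\<alpha> + 1) / 2 * real l)"
        using \<gamma> \<alpha> by (intro mult_right_mono) auto
      ultimately have "0 \<le> (\<alpha> + 1) / 2 * real l - \<gamma> * ((\<alpha> + 1) / 2 * real l) - real l * \<beta>" by linarith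
      also have "\<dots> = (real m * (- \<alpha> + \<beta> - \<gamma>) + - ((\<alpha> - 1) / 2 * real l)) - (- \<alpha> * real k + - (x * \<gamma>) + real k * \<beta>)"
        unfolding x_def kl by (simp add: field_simps)
      finally show "- \<alpha> * real k + - (x * \<gamma>) + real k * \<beta> \<le> real m * (- \<alpha> + \<beta> - \<gamma>) + - ((\<alpha> - 1) / 2 * real l)"
        by linarith
    qed simp
    also have "\<dots> = D * 2 powr (real m * (- \<alpha> + \<beta> - \<gamma>)) * decay \<alpha> ^ (k - m)"
      by (simp only: powr_add decay_power l_def mult.assoc)
    finally show "2 powr (- \<alpha> * real k) * (D * real (samples_per_row \<alpha> m k) powr (- \<gamma>) * (2 ^ k) powr \<beta>)
      \<le> D * 2 powr (real m * (- \<alpha> + \<beta> - \<gamma>)) * decay \<alpha> ^ (k - m)" .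
  qed (use q D in auto)
  then show ?thesis by (simp add: field_simps)
qed

lemma level_for_budget:
  fixes C :: real
  assumes C: "1 \<le> C" and n: "C \<le> real n"
  obtains m where "C * 4 ^ m \<le> real n" "real n < 4 * C * 4 ^ m"
proof -
  obtain M where "real n / C < 4 ^ M" using real_arch_pow[of 4 "real n / C"] by auto
  then have ex: "\<exists>M. real n < C * 4 ^ M" using C by (auto simp: field_simps)
  define M where "M = (LEAST M. real n < C * 4 ^ M)"
  have M: "real n < C * 4 ^ M" unfolding M_def by (rule LeastI_ex[OF ex])
  have "M \<noteq> 0" using M n by (intro notI) simp
  then obtain m where m: "M = Suc m" using not0_implies_Suc by blast
  have "\<not> real n < C * 4 ^ m" using m not_less_Least[of m "\<lambda>M. real n < C * 4 ^ M"] unfolding M_def by simp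
  then show ?thesis using that[of m] M m by simp
qed

lemma level_rate_to_budget_rate:
  assumes C: "0 < C" and n: "0 < real n" "real n < C * 4 ^ m" and \<kappa>: "\<kappa> \<le> 0"
  shows "2 powr (real m * \<kappa>) \<le> C powr (- \<kappa> / 2) * real n powr (\<kappa> / 2)"
proof -
  have "2 powr (real m * \<kappa>) = (2 powr (2 * real m)) powr (\<kappa> / 2)" by (simp add: powr_powr)
  also have "2 powr (2 * real m) = (4::real) ^ m"
    by (rule two_powr_double)
  also have "((4::real) ^ m) powr (\<kappa> / 2) \<le> (real n / C) powr (\<kappa> / 2)"
    using assms by (intro powr_mono2') (auto simp: field_simps)
  also have "\<dots> = C powr (- \<kappa> / 2) * real n powr (\<kappa> / 2)"
    using n C by (simp add: powr_divide powr_minus_divide)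
  finally show ?thesis .
qed

section \<open>Upper bounds\<close>

lemma adaptive_error:
  fixes p \<alpha> :: real and u p1 :: ereal and f :: "'a::{real_normed_field, real_inner, banach} levels"
    and m :: nat
  defines "\<Omega> \<equiv> PiE (sample_index m (\<lambda>k. 3 * samples_per_row \<alpha> m k * 2 ^ k)) columns" and "e \<equiv> real_of_ereal (1 / u)"
  assumes p: "1 \<le> p" "p < 2" and u: "2 < u" and p1: "1 \<le> p1" and \<alpha>: "1 < \<alpha>" and f: "f \<in> X_ball (ereal p) u p1"
  shows "avg (\<Omega> \<times> \<Omega>) (\<lambda>\<omega>. norm (I_op \<alpha> f - alg_out (adaptive_alg \<alpha> m (samples_per_row \<alpha> m) \<omega>) f))
    \<le> 2 / (1 - decay \<alpha>) * 2 powr (real m * (- \<alpha> - 1)) + 4 / (1 - decay \<alpha>) * 2 powr (real m * (- \<alpha> + 1 / p + e - 2))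
      + 2 powr (real m * (- (2 * \<alpha>)))"
proof -
  define s where "s = samples_per_row \<alpha> m"
  define J where "J = sample_index m (\<lambda>k. 3 * s k * 2 ^ k)"
  have \<Omega>: "\<Omega> = PiE J columns" by (simp add: \<Omega>_def J_def s_def)
  have J: "finite J" by (simp add: J_def finite_sample_index)
  have ne: "finite \<Omega>" "\<Omega> \<noteq> {}"
    unfolding \<Omega> using finite_samples[OF J columns_ok] samples_nonempty[OF J columns_ok] by auto
  have s: "1 \<le> s k" for k unfolding s_def by (rule samples_per_row_pos)
  have level: "LL_norm (ereal p) (2 ^ k) u (2 ^ k) (f k) \<le> 1" for k by (rule X_ball_levels[OF p1 f])
  have mean: "norm (mean_op (2 ^ k) (2 ^ k) (f k)) \<le> 1" for k
    by (rule norm_mean_op_le[OF p u _ level]) simp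
  have e: "0 \<le> e \<and> e \<le> 1"
    unfolding e_def using u by (cases u) (auto simp: real_of_ereal_inverse)
  let ?n = "\<lambda>\<omega>1 \<omega>2 k. norm (mean_op (2 ^ k) (2 ^ k) (f k) - row_mean_sample k (allocation k (s k) \<omega>1 (f k)) \<omega>2 (f k))"
  have "avg (\<Omega> \<times> \<Omega>) (\<lambda>\<omega>. norm (I_op \<alpha> f - alg_out (adaptive_alg \<alpha> m s \<omega>) f))
    \<le> avg \<Omega> (\<lambda>\<omega>1. avg \<Omega> (\<lambda>\<omega>2. (\<Sum>k=Suc m..2 * m. 2 powr (- \<alpha> * real k) * ?n \<omega>1 \<omega>2 k) + 2 powr (- \<alpha> * (2 * real m))))"
    unfolding avg_Pair
  proof (intro avg_mono)
    fix \<omega>1 \<omega>2 assume \<omega>: "\<omega>1 \<in> \<Omega>" "\<omega>2 \<in> \<Omega>"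
    have "alg_out (adaptive_alg \<alpha> m s (\<omega>1, \<omega>2)) f = multilevel \<alpha> m (\<lambda>k. allocation k (s k) \<omega>1 (f k)) \<omega>2 f"
      using \<omega> unfolding \<Omega> J_def by (intro adaptive_alg_run(1) s)
    then show "norm (I_op \<alpha> f - alg_out (adaptive_alg \<alpha> m s (\<omega>1, \<omega>2)) f)
      \<le> (\<Sum>k=Suc m..2 * m. 2 powr (- \<alpha> * real k) * ?n \<omega>1 \<omega>2 k) + 2 powr (- \<alpha> * (2 * real m))"
      by (simp only: multilevel_error[OF \<alpha> mean])
  qed
  also have "\<dots> = (\<Sum>k=Suc m..2 * m. 2 powr (- \<alpha> * real k) * avg \<Omega> (\<lambda>\<omega>1. avg \<Omega> (\<lambda>\<omega>2. ?n \<omega>1 \<omega>2 k))) + 2 powr (- \<alpha> * (2 * real m))"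
    by (simp only: avg_add avg_sum avg_cmult avg_const[OF ne])
  also have "\<dots> \<le> (\<Sum>k=Suc m..2 * m. 2 powr (- \<alpha> * real k) * (2 * real (s k) powr (- (1 / 2)) * (2 ^ k) powr (- (1 / 2))
      + 4 * real (s k) powr (- (1 - e)) * (2 ^ k) powr (1 / p - 1))) + 2 powr (- \<alpha> * (2 * real m))"
  proof (intro add_right_mono sum_mono mult_left_mono)
    fix k assume k: "k \<in> {Suc m..2 * m}"
    have "row_index k i (3 * s k * 2 ^ k) \<subseteq> J" if "i \<in> {1..2 ^ k}" for i
      unfolding J_def using k that by (intro row_index_subset_sample_index) auto
    from adaptive_level_error[OF p u level J s this]
    show "avg \<Omega> (\<lambda>\<omega>1. avg \<Omega> (\<lambda>\<omega>2. ?n \<omega>1 \<omega>2 k)) \<le> 2 * real (s k) powr (- (1 / 2)) * (2 ^ k) powr (- (1 / 2))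
      + 4 * real (s k) powr (- (1 - e)) * (2 ^ k) powr (1 / p - 1)"
      unfolding \<Omega> e_def by simp
  qed simp
  also have "\<dots> = (\<Sum>k=Suc m..2 * m. 2 powr (- \<alpha> * real k) * (2 * real (s k) powr (- (1 / 2)) * (2 ^ k) powr (- (1 / 2))))
      + (\<Sum>k=Suc m..2 * m. 2 powr (- \<alpha> * real k) * (4 * real (s k) powr (- (1 - e)) * (2 ^ k) powr (1 / p - 1)))
      + 2 powr (- \<alpha> * (2 * real m))"
    by (simp only: distrib_left sum.distrib)
  also have "\<dots> \<le> 2 / (1 - decay \<alpha>) * 2 powr (real m * (- \<alpha> + - (1 / 2) - 1 / 2))
      + 4 / (1 - decay \<alpha>) * 2 powr (real m * (- \<alpha> + (1 / p - 1) - (1 - e))) + 2 powr (- \<alpha> * (2 * real m))"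
    unfolding s_def using p e by (intro add_right_mono add_mono sum_levels_rate \<alpha>) auto
  also have "- \<alpha> + - (1 / 2) - 1 / 2 = - \<alpha> - 1" by simp
  also have "- \<alpha> + (1 / p - 1) - (1 - e) = - \<alpha> + 1 / p + e - 2" by simp
  also have "- \<alpha> * (2 * real m) = real m * (- (2 * \<alpha>))" by simp
  finally show ?thesis by (simp only: s_def)
qed

lemma nonadaptive_error:
  fixes p \<alpha> :: real and u p1 :: ereal and f :: "'a::{real_normed_field, real_inner, banach} levels"
    and m :: nat
  defines "\<Omega> \<equiv> PiE (sample_index m (samples_per_row \<alpha> m)) columns"
  assumes p: "1 \<le> p" "p < 2" and u: "2 < u" and p1: "1 \<le> p1" and \<alpha>: "1 < \<alpha>" and f: "f \<in> X_ball (ereal p) u p1"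
  shows "avg \<Omega> (\<lambda>\<omega>. norm (I_op \<alpha> f - alg_out (nonadaptive_alg \<alpha> m (samples_per_row \<alpha> m) \<omega>) f))
    \<le> 1 / (1 - decay \<alpha>) * 2 powr (real m * (- \<alpha> + 1 / p - 3 / 2)) + 2 powr (real m * (- (2 * \<alpha>)))"
proof -
  define s where "s = samples_per_row \<alpha> m"
  define J where "J = sample_index m s"
  have \<Omega>: "\<Omega> = PiE J columns" by (simp add: \<Omega>_def J_def s_def)
  have J: "finite J" by (simp add: J_def finite_sample_index)
  have ne: "finite \<Omega>" "\<Omega> \<noteq> {}"
    unfolding \<Omega> using finite_samples[OF J columns_ok] samples_nonempty[OF J columns_ok] by auto
  have s: "1 \<le> s k" for k unfolding s_def by (rule samples_per_row_pos)
  have level: "LL_norm (ereal p) (2 ^ k) u (2 ^ k) (f k) \<le> 1" for k by (rule X_ball_levels[OF p1 f])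
  have mean: "norm (mean_op (2 ^ k) (2 ^ k) (f k)) \<le> 1" for k
    by (rule norm_mean_op_le[OF p u _ level]) simp
  let ?n = "\<lambda>\<omega> k. norm (mean_op (2 ^ k) (2 ^ k) (f k) - row_mean_sample k (\<lambda>_. s k) \<omega> (f k))"
  have "avg \<Omega> (\<lambda>\<omega>. norm (I_op \<alpha> f - alg_out (nonadaptive_alg \<alpha> m s \<omega>) f))
    \<le> avg \<Omega> (\<lambda>\<omega>. (\<Sum>k=Suc m..2 * m. 2 powr (- \<alpha> * real k) * ?n \<omega> k) + 2 powr (- \<alpha> * (2 * real m)))"
  proof (intro avg_mono)
    fix \<omega> assume \<omega>: "\<omega> \<in> \<Omega>"
    have "alg_out (nonadaptive_alg \<alpha> m s \<omega>) f = multilevel \<alpha> m (\<lambda>k _. s k) \<omega> f"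
      using \<omega> unfolding \<Omega> J_def by (intro nonadaptive_alg_run(1))
    then show "norm (I_op \<alpha> f - alg_out (nonadaptive_alg \<alpha> m s \<omega>) f)
      \<le> (\<Sum>k=Suc m..2 * m. 2 powr (- \<alpha> * real k) * ?n \<omega> k) + 2 powr (- \<alpha> * (2 * real m))"
      by (simp only: multilevel_error[OF \<alpha> mean])
  qed
  also have "\<dots> = (\<Sum>k=Suc m..2 * m. 2 powr (- \<alpha> * real k) * avg \<Omega> (\<lambda>\<omega>. ?n \<omega> k)) + 2 powr (- \<alpha> * (2 * real m))"
    by (simp only: avg_add avg_sum avg_cmult avg_const[OF ne])
  also have "\<dots> \<le> (\<Sum>k=Suc m..2 * m. 2 powr (- \<alpha> * real k) * (1 * real (s k) powr (- (1 / 2)) * (2 ^ k) powr (1 / p - 1)))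
      + 2 powr (- \<alpha> * (2 * real m))"
  proof (intro add_right_mono sum_mono mult_left_mono)
    fix k assume k: "k \<in> {Suc m..2 * m}"
    have "row_index k i (s k) \<subseteq> J" if "i \<in> {1..2 ^ k}" for i
      unfolding J_def using k that by (intro row_index_subset_sample_index) auto
    from nonadaptive_level_error[OF p u level J s this]
    show "avg \<Omega> (\<lambda>\<omega>. ?n \<omega> k) \<le> 1 * real (s k) powr (- (1 / 2)) * (2 ^ k) powr (1 / p - 1)"
      unfolding \<Omega> by simp
  qed simp
  also have "\<dots> \<le> 1 / (1 - decay \<alpha>) * 2 powr (real m * (- \<alpha> + (1 / p - 1) - 1 / 2)) + 2 powr (- \<alpha> * (2 * real m))"
    unfolding s_def using p by (intro add_right_mono sum_levels_rate \<alpha>) auto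
  also have "- \<alpha> + (1 / p - 1) - 1 / 2 = - \<alpha> + 1 / p - 3 / 2" by simp
  also have "- \<alpha> * (2 * real m) = real m * (- (2 * \<alpha>))" by simp
  finally show ?thesis by (simp only: s_def)
qed

lemma e_det_non_upper:
  fixes p \<alpha> :: real and u p1 :: ereal
  assumes p: "1 \<le> p" "p < 2" and u: "2 < u" and p1: "1 \<le> p1" and \<alpha>: "1 < \<alpha>" and n: "(\<Sum>k\<le>m. 4 ^ k) \<le> n"
  shows "e_det_non (X_ball (ereal p) u p1 :: ('a::{real_normed_field, real_inner, banach} levels) set)
      (I_op \<alpha>) std_info n \<le> ennreal (2 powr (real m * (- \<alpha>)))"
proof -
  define \<Phi> where "\<Phi> f = (\<Sum>k\<le>m. of_real (2 powr (- \<alpha> * real k)) * mean_op (2 ^ k) (2 ^ k) (f k))"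
    for f :: "'a levels"
  define A where "A = two_stage (exact_points m) (\<lambda>_. []) \<Phi>"
  have cong: "\<Phi> f = \<Phi> g" if "\<And>k i j. (k, i, j) \<in> set (exact_points m) \<union> set [] \<Longrightarrow> f k i j = g k i j" for f g
    unfolding \<Phi>_def using that
    by (intro sum.cong refl arg_cong2[where f = "(*)"] mean_op_exact_cong) auto
  have run: "alg_card A f = enat (length (exact_points m) + length ([] :: pos list)) \<and> alg_out A f = \<Phi> f" for f
    unfolding A_def by (intro conjI two_stage_run cong) (use valid_exact_points in auto)
  have "(SUP f\<in>X_ball (ereal p) u p1. alg_card A f) \<le> enat n"
    using run n by (intro SUP_least) (simp add: length_exact_points)
  moreover have "det_algorithm std_info A" "nonadaptive A"
    by (simp_all add: A_def det_algorithm_two_stage nonadaptive_two_stage)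
  moreover have "det_error (X_ball (ereal p) u p1) (I_op \<alpha>) A \<le> ennreal (2 powr (real m * (- \<alpha>)))"
    unfolding det_error_def
  proof (intro SUP_least ennreal_leI)
    fix f :: "'a levels" assume f: "f \<in> X_ball (ereal p) u p1"
    have "norm (mean_op (2 ^ k) (2 ^ k) (f k)) \<le> 1" for k
      by (rule norm_mean_op_le[OF p u _ X_ball_levels[OF p1 f]]) simp
    from I_op_truncation[where f = f, OF \<alpha> this, of m]
    show "norm (I_op \<alpha> f - alg_out A f) \<le> 2 powr (real m * (- \<alpha>))"
      using run by (simp add: \<Phi>_def mult.commute)
  qed
  ultimately show ?thesis
    unfolding e_det_non_def by (intro INF_lower2[of A]) auto
qed

lemma e_ran_upper:
  fixes p \<alpha> :: real and u p1 :: ereal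
  assumes p: "1 \<le> p" "p < 2" and u: "2 < u" and p1: "1 \<le> p1" and \<alpha>: "1 < \<alpha>"
    and n: "(10 + 4 / (1 - decay \<alpha>)) * 4 ^ m \<le> real n"
  shows "e_ran (X_ball (ereal p) u p1 :: ('a::{real_normed_field, real_inner, banach} levels) set)
      (I_op \<alpha>) std_info n
    \<le> ennreal (2 / (1 - decay \<alpha>) * 2 powr (real m * (- \<alpha> - 1))
        + 4 / (1 - decay \<alpha>) * 2 powr (real m * (- \<alpha> + 1 / p + real_of_ereal (1 / u) - 2))
        + 2 powr (real m * (- (2 * \<alpha>))))" (is ?ran)
    and "e_ran_non (X_ball (ereal p) u p1 :: ('a levels) set) (I_op \<alpha>) std_info n
    \<le> ennreal (1 / (1 - decay \<alpha>) * 2 powr (real m * (- \<alpha> + 1 / p - 3 / 2)) + 2 powr (real m * (- (2 * \<alpha>))))" (is ?non)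
    and "(\<Sum>k\<le>m. 4 ^ k) \<le> n"
proof -
  define s where "s = samples_per_row \<alpha> m"
  define J where "J = sample_index m (\<lambda>k. 3 * s k * 2 ^ k)"
  define J' where "J' = sample_index m s"
  have fin: "finite J" "finite J'" by (simp_all add: J_def J'_def finite_sample_index)
  have s: "1 \<le> s k" for k unfolding s_def by (rule samples_per_row_pos)
  have "real ((\<Sum>k\<le>m. 4 ^ k) + 4 * (\<Sum>k=Suc m..2 * m. s k * 2 ^ k)) \<le> real n"
    unfolding s_def by (rule order_trans[OF total_cost[OF \<alpha>] n])
  then have cost: "(\<Sum>k\<le>m. 4 ^ k) + 4 * (\<Sum>k=Suc m..2 * m. s k * 2 ^ k) \<le> n" by (simp only: of_nat_le_iff)
  then show "(\<Sum>k\<le>m. 4 ^ k) \<le> n" by linarith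
  show ?ran
  proof (rule uniform_ran_algorithm(1)[where \<Omega> = "PiE J columns \<times> PiE J columns" and A = "adaptive_alg \<alpha> m s"])
    show "finite (PiE J columns \<times> PiE J columns)"
      using finite_samples[OF fin(1) columns_ok] by blast
    show "PiE J columns \<times> PiE J columns \<noteq> {}"
      using samples_nonempty[OF fin(1) columns_ok] by blast
    show "det_algorithm std_info (adaptive_alg \<alpha> m s \<omega>)" for \<omega>
      unfolding adaptive_alg_def by (rule det_algorithm_two_stage)
    fix f :: "'a levels" assume f: "f \<in> X_ball (ereal p) u p1"
    show "alg_card (adaptive_alg \<alpha> m s \<omega>) f \<le> enat n" if mem: "\<omega> \<in> PiE J columns \<times> PiE J columns" for \<omega>
    proof -
      obtain \<omega>1 \<omega>2 where \<omega>: "\<omega> = (\<omega>1, \<omega>2)" "\<omega>1 \<in> PiE J columns" "\<omega>2 \<in> PiE J columns" using mem by blast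
      have "alg_card (adaptive_alg \<alpha> m s (\<omega>1, \<omega>2)) f \<le> enat ((\<Sum>k\<le>m. 4 ^ k) + 4 * (\<Sum>k=Suc m..2 * m. s k * 2 ^ k))"
        by (rule adaptive_alg_run(2)[where s = s, OF s \<omega>(2)[unfolded J_def] \<omega>(3)[unfolded J_def]])
      also have "\<dots> \<le> enat n" using cost by simp
      finally show ?thesis by (simp add: \<omega>(1))
    qed
    show "avg (PiE J columns \<times> PiE J columns) (\<lambda>\<omega>. norm (I_op \<alpha> f - alg_out (adaptive_alg \<alpha> m s \<omega>) f))
      \<le> 2 / (1 - decay \<alpha>) * 2 powr (real m * (- \<alpha> - 1))
        + 4 / (1 - decay \<alpha>) * 2 powr (real m * (- \<alpha> + 1 / p + real_of_ereal (1 / u) - 2))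
        + 2 powr (real m * (- (2 * \<alpha>)))"
      unfolding J_def s_def by (rule adaptive_error[OF p u p1 \<alpha> f])
  qed
  show ?non
  proof (rule uniform_ran_algorithm(2)[where \<Omega> = "PiE J' columns" and A = "nonadaptive_alg \<alpha> m s"])
    show "finite (PiE J' columns)" by (rule finite_samples[OF fin(2) columns_ok])
    show "PiE J' columns \<noteq> {}" by (rule samples_nonempty[OF fin(2) columns_ok])
    show "det_algorithm std_info (nonadaptive_alg \<alpha> m s \<omega>)" for \<omega>
      unfolding nonadaptive_alg_def by (rule det_algorithm_two_stage)
    show "nonadaptive (nonadaptive_alg \<alpha> m s \<omega> :: (_ \<Rightarrow> _ \<Rightarrow> _ \<Rightarrow> 'a, 'a, 'a) det_alg)" for \<omega>
      unfolding nonadaptive_alg_def by (rule nonadaptive_two_stage)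
    fix f :: "'a levels" assume f: "f \<in> X_ball (ereal p) u p1"
    show "alg_card (nonadaptive_alg \<alpha> m s \<omega>) f \<le> enat n" if "\<omega> \<in> PiE J' columns" for \<omega>
    proof -
      have "alg_card (nonadaptive_alg \<alpha> m s \<omega>) f \<le> enat ((\<Sum>k\<le>m. 4 ^ k) + (\<Sum>k=Suc m..2 * m. s k * 2 ^ k))"
        by (rule nonadaptive_alg_run(2)[OF that[unfolded J'_def]])
      also have "\<dots> \<le> enat n" using cost by simp
      finally show ?thesis .
    qed
    show "avg (PiE J' columns) (\<lambda>\<omega>. norm (I_op \<alpha> f - alg_out (nonadaptive_alg \<alpha> m s \<omega>) f))
      \<le> 1 / (1 - decay \<alpha>) * 2 powr (real m * (- \<alpha> + 1 / p - 3 / 2)) + 2 powr (real m * (- (2 * \<alpha>)))"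
      unfolding J'_def s_def by (rule nonadaptive_error[OF p u p1 \<alpha> f])
  qed
qed

section \<open>The orders of the minimal errors\<close>

lemma level_above_budget:
  assumes "1 \<le> n"
  obtains k where "16 * n \<le> 4 ^ k" "(4::real) ^ k \<le> 64 * real n"
proof -
  have "1 \<le> 4 * real n" using assms by simp
  then obtain m where m: "1 * 4 ^ m \<le> 4 * real n" "4 * real n < 4 * 1 * 4 ^ m"
    using level_for_budget[of 1 "4 * n"] by auto
  have "real (16 * n) \<le> real (4 ^ Suc (Suc m))" using m by simp
  then have "16 * n \<le> 4 ^ Suc (Suc m)" by (simp only: of_nat_le_iff)
  moreover have "(4::real) ^ Suc (Suc m) \<le> 64 * real n" using m by simp
  ultimately show ?thesis using that by blast
qed

lemma budget_rate_to_level_rate: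
  assumes n: "(4::real) ^ k \<le> C * real n" and C: "0 \<le> C" and \<kappa>: "\<kappa> \<le> 0"
  shows "C powr (\<kappa> / 2) * real n powr (\<kappa> / 2) \<le> 2 powr (real k * \<kappa>)"
proof -
  have "C powr (\<kappa> / 2) * real n powr (\<kappa> / 2) = (C * real n) powr (\<kappa> / 2)"
    using C by (simp add: powr_mult)
  also have "\<dots> \<le> ((4::real) ^ k) powr (\<kappa> / 2)"
    using assms by (intro powr_mono2') auto
  also have "\<dots> = (2 powr (2 * real k)) powr (\<kappa> / 2)" by (simp only: two_powr_double)
  also have "\<dots> = 2 powr (real k * \<kappa>)" by (simp add: powr_powr)
  finally show ?thesis .
qed

lemma lower_bounds:
  fixes p \<alpha> :: real and u p1 :: ereal
  defines "e \<equiv> real_of_ereal (1 / u)"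
  assumes p: "1 \<le> p" "p < 2" and u: "2 < u" and p1: "1 \<le> p1" and \<alpha>: "1 < \<alpha>"
  shows "\<exists>c>0. \<forall>n\<ge>1.
     ennreal (c * real n powr ((- \<alpha> + 1 / p + e - 2) / 2) + c * real n powr ((- \<alpha> - 1) / 2))
       \<le> e_ran (X_ball (ereal p) u p1 :: ('a::{real_normed_field, banach} levels) set) (I_op \<alpha>) std_info n \<and>
     ennreal (c * real n powr ((- \<alpha> + 1 / p - 3 / 2) / 2))
       \<le> e_ran_non (X_ball (ereal p) u p1 :: ('a levels) set) (I_op \<alpha>) std_info n \<and>
     ennreal (c * real n powr ((- \<alpha>) / 2))
       \<le> e_det (X_ball (ereal p) u p1 :: ('a levels) set) (I_op \<alpha>) std_info n"
proof -
  have e: "0 \<le> e \<and> e \<le> 1" unfolding e_def using u by (cases u) (auto simp: real_of_ereal_inverse)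
  have p': "1 / p \<le> 1" using p by simp
  have u1: "1 \<le> u" using u by (cases u) auto
  have pe: "1 \<le> p" "1 \<le> u" "1 \<le> p1" using p u1 p1 by auto
  define \<kappa>1 \<kappa>2 \<kappa>3 where "\<kappa>1 = - \<alpha> + 1 / p + e - 2" and "\<kappa>2 = - \<alpha> - 1" and "\<kappa>3 = - \<alpha> + 1 / p - 3 / 2"
  have \<kappa>: "\<kappa>1 \<le> 0" "\<kappa>2 \<le> 0" "\<kappa>3 \<le> 0" "- \<alpha> \<le> 0"
    using e p' \<alpha> by (auto simp: \<kappa>1_def \<kappa>2_def \<kappa>3_def)
  \<comment> \<open>The level errors carry a factor \<open>1 / 8\<close>; half of it leaves room for the sum of two terms.\<close>
  define c where "c = Min ((\<lambda>\<kappa>. 64 powr (\<kappa> / 2)) ` {\<kappa>1, \<kappa>2, \<kappa>3, - \<alpha>}) / 16"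
  have c: "c > 0" by (simp add: c_def)
  have rate: "c * real n powr (\<kappa> / 2) \<le> 2 powr (real k * \<kappa>) / 16"
    if "\<kappa> \<in> {\<kappa>1, \<kappa>2, \<kappa>3, - \<alpha>}" "(4::real) ^ k \<le> 64 * real n" for \<kappa> n k
  proof -
    have "Min ((\<lambda>\<kappa>. 64 powr (\<kappa> / 2)) ` {\<kappa>1, \<kappa>2, \<kappa>3, - \<alpha>}) \<le> 64 powr (\<kappa> / 2)"
      using that(1) by (intro Min_le) auto
    then have "16 * c \<le> 64 powr (\<kappa> / 2)" by (simp only: c_def)
    then have "16 * c * real n powr (\<kappa> / 2) \<le> 64 powr (\<kappa> / 2) * real n powr (\<kappa> / 2)" by (intro mult_right_mono) auto
    also have "\<dots> \<le> 2 powr (real k * \<kappa>)" using that \<kappa> by (intro budget_rate_to_level_rate) auto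
    finally show ?thesis by simp
  qed
  show ?thesis
  proof (intro exI[of _ c] conjI c allI impI)
    fix n :: nat assume "1 \<le> n"
    then obtain k where k: "16 * n \<le> 4 ^ k" "(4::real) ^ k \<le> 64 * real n" by (rule level_above_budget)
    have two: "(2::real) ^ k = 2 powr real k" "(4::real) ^ k = 2 powr (2 * real k)"
      by (simp_all add: powr_realpow two_powr_double)
    let ?ran = "e_ran (X_ball (ereal p) u p1 :: ('a levels) set) (I_op \<alpha>) std_info n"
    have "2 powr (- \<alpha> * real k) / 4 ^ k * (2 ^ k) powr (1 / p + e) / 8 = 2 powr (real k * \<kappa>1) / 8"
      unfolding two powr_powr powr_diff[symmetric] powr_add[symmetric] by (simp add: \<kappa>1_def algebra_simps)
    then have 1: "ennreal (2 powr (real k * \<kappa>1) / 8) \<le> ?ran"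
      using e_ran_ge_spike[where 'a = 'a, OF pe k(1), of \<alpha>] by (simp add: e_def)
    have "2 powr (- \<alpha> * real k) / 2 ^ k / 8 = 2 powr (real k * \<kappa>2) / 8"
      unfolding two powr_diff[symmetric] by (simp add: \<kappa>2_def algebra_simps)
    then have 2: "ennreal (2 powr (real k * \<kappa>2) / 8) \<le> ?ran"
      using e_ran_ge_all_signs[where 'a = 'a, OF pe k(1), of \<alpha>] by simp
    have "c * real n powr (\<kappa>1 / 2) + c * real n powr (\<kappa>2 / 2) \<le> 2 powr (real k * \<kappa>1) / 16 + 2 powr (real k * \<kappa>2) / 16"
      by (intro add_mono rate k) auto
    also have "\<dots> \<le> max (2 powr (real k * \<kappa>1) / 8) (2 powr (real k * \<kappa>2) / 8)" by linarith
    finally have "ennreal (c * real n powr (\<kappa>1 / 2) + c * real n powr (\<kappa>2 / 2))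
        \<le> ennreal (max (2 powr (real k * \<kappa>1) / 8) (2 powr (real k * \<kappa>2) / 8))" by (rule ennreal_leI)
    also have "\<dots> \<le> ?ran" using 1 2 by (simp add: max_def)
    finally show "ennreal (c * real n powr ((- \<alpha> + 1 / p + e - 2) / 2) + c * real n powr ((- \<alpha> - 1) / 2)) \<le> ?ran"
      by (simp add: \<kappa>1_def \<kappa>2_def)
    have "2 powr (- \<alpha> * real k) / 4 ^ k * (2 ^ k) powr (1 / p) * sqrt (2 ^ k) / 8 = 2 powr (real k * \<kappa>3) / 8"
      unfolding two powr_half_sqrt[symmetric, OF powr_ge_zero] powr_powr powr_diff[symmetric] powr_add[symmetric]
      by (simp add: \<kappa>3_def algebra_simps)
    then have 3: "ennreal (2 powr (real k * \<kappa>3) / 8)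
      \<le> e_ran_non (X_ball (ereal p) u p1 :: ('a levels) set) (I_op \<alpha>) std_info n"
      using e_ran_non_ge_random_row[where 'a = 'a, OF pe k(1), of \<alpha>] by simp
    have "c * real n powr (\<kappa>3 / 2) \<le> 2 powr (real k * \<kappa>3) / 8"
      by (rule order_trans[OF rate[OF _ k(2)]]) auto
    from order_trans[OF ennreal_leI[OF this] 3]
    show "ennreal (c * real n powr ((- \<alpha> + 1 / p - 3 / 2) / 2))
      \<le> e_ran_non (X_ball (ereal p) u p1 :: ('a levels) set) (I_op \<alpha>) std_info n"
      by (simp add: \<kappa>3_def)
    have "c * real n powr (- \<alpha> / 2) \<le> 2 powr (real k * (- \<alpha>)) / 8"
      by (rule order_trans[OF rate[OF _ k(2)]]) auto
    also have "\<dots> = 2 powr (- \<alpha> * real k) / 8" by (simp add: mult.commute)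
    finally have "c * real n powr (- \<alpha> / 2) \<le> 2 powr (- \<alpha> * real k) / 8" .
    from order_trans[OF ennreal_leI[OF this] e_det_ge_fooling[OF pe k(1)]]
    show "ennreal (c * real n powr ((- \<alpha>) / 2))
      \<le> e_det (X_ball (ereal p) u p1 :: ('a levels) set) (I_op \<alpha>) std_info n" .
  qed
qed

lemma upper_bounds:
  fixes p \<alpha> :: real and u p1 :: ereal
  defines "e \<equiv> real_of_ereal (1 / u)"
  assumes p: "1 \<le> p" "p < 2" and u: "2 < u" and p1: "1 \<le> p1" and \<alpha>: "1 < \<alpha>"
  shows "\<exists>c>0. \<exists>n0\<ge>1. \<forall>n\<ge>n0.
     e_ran (X_ball (ereal p) u p1 :: ('a::{real_normed_field, real_inner, banach} levels) set) (I_op \<alpha>) std_info n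
       \<le> ennreal (c * real n powr ((- \<alpha> + 1 / p + e - 2) / 2) + c * real n powr ((- \<alpha> - 1) / 2)) \<and>
     e_ran_non (X_ball (ereal p) u p1 :: ('a levels) set) (I_op \<alpha>) std_info n
       \<le> ennreal (c * real n powr ((- \<alpha> + 1 / p - 3 / 2) / 2)) \<and>
     e_det_non (X_ball (ereal p) u p1 :: ('a levels) set) (I_op \<alpha>) std_info n
       \<le> ennreal (c * real n powr ((- \<alpha>) / 2))"
proof -
  have e: "0 \<le> e \<and> e \<le> 1" unfolding e_def using u by (cases u) (auto simp: real_of_ereal_inverse)
  have p': "1 / p \<le> 1" "1 / 2 \<le> 1 / p" using p by (auto simp: field_simps)
  define Q where "Q = 1 / (1 - decay \<alpha>)"
  have Q: "0 < Q" using decay_bounds[OF \<alpha>] by (simp add: Q_def)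
  define C where "C = 10 + 4 / (1 - decay \<alpha>)"
  have C: "10 \<le> C" using decay_bounds[OF \<alpha>] by (simp add: C_def)
  define \<kappa>1 \<kappa>2 \<kappa>3 where "\<kappa>1 = - \<alpha> + 1 / p + e - 2" and "\<kappa>2 = - \<alpha> - 1" and "\<kappa>3 = - \<alpha> + 1 / p - 3 / 2"
  have \<kappa>: "\<kappa>1 \<le> 0" "\<kappa>2 \<le> 0" "\<kappa>3 \<le> 0" "- \<alpha> \<le> 0" "- (2 * \<alpha>) \<le> \<kappa>2" "- (2 * \<alpha>) \<le> \<kappa>3"
    using e p' \<alpha> by (auto simp: \<kappa>1_def \<kappa>2_def \<kappa>3_def)
  define d where "d = Max ((\<lambda>\<kappa>. (4 * C) powr (- \<kappa> / 2)) ` {\<kappa>1, \<kappa>2, \<kappa>3, - \<alpha>})"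
  have d0: "(4 * C) powr (- \<kappa> / 2) \<le> d" if "\<kappa> \<in> {\<kappa>1, \<kappa>2, \<kappa>3, - \<alpha>}" for \<kappa>
    unfolding d_def using that by (intro Max_ge) auto
  have "0 < (4 * C) powr (- \<kappa>1 / 2)" using C by simp
  then have d: "0 < d" using d0[of \<kappa>1] by (rule less_le_trans) simp
  define c where "c = (4 * Q + 1) * d"
  have c: "c > 0" using Q d by (simp add: c_def)
  have rate: "D * 2 powr (real m * \<kappa>) \<le> c * real n powr (\<kappa> / 2)"
    if "\<kappa> \<in> {\<kappa>1, \<kappa>2, \<kappa>3, - \<alpha>}" "C * 4 ^ m \<le> real n" "real n < 4 * C * 4 ^ m" "0 \<le> D" "D \<le> 4 * Q + 1" for \<kappa> n m D
  proof -
    have "0 < C * 4 ^ m" using C by simp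
    then have n: "0 < real n" using that(2) by linarith
    have "2 powr (real m * \<kappa>) \<le> (4 * C) powr (- \<kappa> / 2) * real n powr (\<kappa> / 2)"
      using that(1) C \<kappa> by (intro level_rate_to_budget_rate n that(3)) auto
    also have "\<dots> \<le> d * real n powr (\<kappa> / 2)" by (intro mult_right_mono d0 that) auto
    finally have "D * 2 powr (real m * \<kappa>) \<le> (4 * Q + 1) * (d * real n powr (\<kappa> / 2))"
      using that by (intro mult_mono) auto
    then show ?thesis by (simp add: c_def mult.assoc)
  qed
  have tail: "2 powr (real m * (- (2 * \<alpha>))) \<le> 2 powr (real m * \<kappa>)" if "- (2 * \<alpha>) \<le> \<kappa>" for m \<kappa>
    using that by (intro powr_mono mult_left_mono) auto
  show ?thesis
  proof (intro exI[of _ c] exI[of _ "nat \<lceil>C\<rceil>"] conjI c allI impI)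
    show "1 \<le> nat \<lceil>C\<rceil>" using C by linarith
    fix n assume "nat \<lceil>C\<rceil> \<le> n"
    then have "C \<le> real n" by linarith
    then obtain m where m: "C * 4 ^ m \<le> real n" "real n < 4 * C * 4 ^ m"
      using level_for_budget[of C n] C by auto
    note up = e_ran_upper[OF p u p1 \<alpha> m(1)[unfolded C_def]]
    have "2 / (1 - decay \<alpha>) * 2 powr (real m * (- \<alpha> - 1))
        + 4 / (1 - decay \<alpha>) * 2 powr (real m * (- \<alpha> + 1 / p + real_of_ereal (1 / u) - 2))
        + 2 powr (real m * (- (2 * \<alpha>)))
      \<le> 2 * Q * 2 powr (real m * \<kappa>2) + 4 * Q * 2 powr (real m * \<kappa>1) + 2 powr (real m * \<kappa>2)"
      using tail[OF \<kappa>(5), of m] by (simp add: Q_def \<kappa>1_def \<kappa>2_def e_def)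
    also have "\<dots> = 4 * Q * 2 powr (real m * \<kappa>1) + (2 * Q + 1) * 2 powr (real m * \<kappa>2)"
      by (simp add: algebra_simps)
    also have "\<dots> \<le> c * real n powr (\<kappa>1 / 2) + c * real n powr (\<kappa>2 / 2)"
      using Q by (intro add_mono rate m) auto
    finally show "e_ran (X_ball (ereal p) u p1 :: ('a levels) set) (I_op \<alpha>) std_info n
       \<le> ennreal (c * real n powr ((- \<alpha> + 1 / p + e - 2) / 2) + c * real n powr ((- \<alpha> - 1) / 2))"
      unfolding \<kappa>1_def \<kappa>2_def by (rule order_trans[OF up(1) ennreal_leI])
    have "1 / (1 - decay \<alpha>) * 2 powr (real m * (- \<alpha> + 1 / p - 3 / 2)) + 2 powr (real m * (- (2 * \<alpha>)))
      \<le> (Q + 1) * 2 powr (real m * \<kappa>3)"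
      using tail[OF \<kappa>(6), of m] by (simp add: Q_def \<kappa>3_def distrib_right)
    also have "\<dots> \<le> c * real n powr (\<kappa>3 / 2)"
      using Q by (intro rate m) auto
    finally show "e_ran_non (X_ball (ereal p) u p1 :: ('a levels) set) (I_op \<alpha>) std_info n
       \<le> ennreal (c * real n powr ((- \<alpha> + 1 / p - 3 / 2) / 2))"
      unfolding \<kappa>3_def by (rule order_trans[OF up(2) ennreal_leI])
    have "1 * 2 powr (real m * (- \<alpha>)) \<le> c * real n powr (- \<alpha> / 2)"
      using Q by (intro rate m) auto
    then have "ennreal (2 powr (real m * (- \<alpha>))) \<le> ennreal (c * real n powr (- \<alpha> / 2))"
      by (intro ennreal_leI) simp
    then show "e_det_non (X_ball (ereal p) u p1 :: ('a levels) set) (I_op \<alpha>) std_info n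
       \<le> ennreal (c * real n powr ((- \<alpha>) / 2))"
      using e_det_non_upper[where 'a = 'a, OF p u p1 \<alpha> up(3)] by (rule order_trans[rotated])
  qed
qed

text \<open>
  Both scalar fields are instances: what is used of the field is its inner product, for the variances,
  and its completeness.
\<close>

lemma minimal_errors:
  fixes p \<alpha> :: real and u p\<^sub>1 :: ereal
  assumes "1 \<le> p" and "p < 2" and "2 < u" and "1 \<le> p\<^sub>1" and "1 < \<alpha>"
  shows "\<exists>c\<^sub>1 c\<^sub>2 c\<^sub>3 c\<^sub>4 c\<^sub>5 c\<^sub>6 :: real. \<exists>n\<^sub>0 :: nat.
       c\<^sub>1 > 0 \<and> c\<^sub>2 > 0 \<and> c\<^sub>3 > 0 \<and> c\<^sub>4 > 0 \<and> c\<^sub>5 > 0 \<and> c\<^sub>6 > 0 \<and> n\<^sub>0 \<ge> 1 \<and>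
       (\<forall>n\<ge>n\<^sub>0.
          ennreal (c\<^sub>1 * real n powr (- \<alpha> / 2 + 1 / (2 * p) + real_of_ereal (1 / u) / 2 - 1)
                   + c\<^sub>1 * real n powr (- \<alpha> / 2 - 1 / 2))
            \<le> e_ran (X_ball (ereal p) u p\<^sub>1 :: ('a::{real_normed_field, real_inner, banach} levels) set) (I_op \<alpha>) std_info n \<and>
          e_ran (X_ball (ereal p) u p\<^sub>1 :: ('a levels) set) (I_op \<alpha>) std_info n
            \<le> ennreal (c\<^sub>2 * real n powr (- \<alpha> / 2 + 1 / (2 * p) + real_of_ereal (1 / u) / 2 - 1)
                          * log 2 (real n + 1) powr (1 - real_of_ereal (1 / u))
                       + c\<^sub>2 * real n powr (- \<alpha> / 2 - 1 / 2) * log 2 (real n + 1) powr (1 / 2)) \<and>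
          ennreal (c\<^sub>3 * real n powr (- \<alpha> / 2 + 1 / (2 * p) - 3 / 4))
            \<le> e_ran_non (X_ball (ereal p) u p\<^sub>1 :: ('a levels) set) (I_op \<alpha>) std_info n \<and>
          e_ran_non (X_ball (ereal p) u p\<^sub>1 :: ('a levels) set) (I_op \<alpha>) std_info n
            \<le> ennreal (c\<^sub>4 * real n powr (- \<alpha> / 2 + 1 / (2 * p) - 3 / 4)) \<and>
          ennreal (c\<^sub>5 * real n powr (- \<alpha> / 2))
            \<le> e_det (X_ball (ereal p) u p\<^sub>1 :: ('a levels) set) (I_op \<alpha>) std_info n \<and>
          e_det (X_ball (ereal p) u p\<^sub>1 :: ('a levels) set) (I_op \<alpha>) std_info n
            \<le> e_det_non (X_ball (ereal p) u p\<^sub>1 :: ('a levels) set) (I_op \<alpha>) std_info n \<and>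
          e_det_non (X_ball (ereal p) u p\<^sub>1 :: ('a levels) set) (I_op \<alpha>) std_info n
            \<le> ennreal (c\<^sub>6 * real n powr (- \<alpha> / 2)))"
proof -
  define e where "e = real_of_ereal (1 / u)"
  have e: "0 \<le> e \<and> e \<le> 1" unfolding e_def using assms by (cases u) (auto simp: real_of_ereal_inverse)
  have exps: "- \<alpha> / 2 + 1 / (2 * p) + e / 2 - 1 = (- \<alpha> + 1 / p + e - 2) / 2"
    "- \<alpha> / 2 - 1 / 2 = (- \<alpha> - 1) / 2" "- \<alpha> / 2 + 1 / (2 * p) - 3 / 4 = (- \<alpha> + 1 / p - 3 / 2) / 2"
    using assms by (simp_all add: field_simps)
  obtain c where c: "c > 0" and lower: "\<forall>n\<ge>1.
     ennreal (c * real n powr ((- \<alpha> + 1 / p + e - 2) / 2) + c * real n powr ((- \<alpha> - 1) / 2))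
       \<le> e_ran (X_ball (ereal p) u p\<^sub>1 :: ('a levels) set) (I_op \<alpha>) std_info n \<and>
     ennreal (c * real n powr ((- \<alpha> + 1 / p - 3 / 2) / 2))
       \<le> e_ran_non (X_ball (ereal p) u p\<^sub>1 :: ('a levels) set) (I_op \<alpha>) std_info n \<and>
     ennreal (c * real n powr ((- \<alpha>) / 2))
       \<le> e_det (X_ball (ereal p) u p\<^sub>1 :: ('a levels) set) (I_op \<alpha>) std_info n"
    using lower_bounds[where 'a = 'a, OF assms] unfolding e_def by blast
  obtain d n\<^sub>0 where d: "d > 0" and n\<^sub>0: "n\<^sub>0 \<ge> 1" and upper: "\<forall>n\<ge>n\<^sub>0.
     e_ran (X_ball (ereal p) u p\<^sub>1 :: ('a levels) set) (I_op \<alpha>) std_info n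
       \<le> ennreal (d * real n powr ((- \<alpha> + 1 / p + e - 2) / 2) + d * real n powr ((- \<alpha> - 1) / 2)) \<and>
     e_ran_non (X_ball (ereal p) u p\<^sub>1 :: ('a levels) set) (I_op \<alpha>) std_info n
       \<le> ennreal (d * real n powr ((- \<alpha> + 1 / p - 3 / 2) / 2)) \<and>
     e_det_non (X_ball (ereal p) u p\<^sub>1 :: ('a levels) set) (I_op \<alpha>) std_info n
       \<le> ennreal (d * real n powr ((- \<alpha>) / 2))"
    using upper_bounds[where 'a = 'a, OF assms] unfolding e_def by blast
  have log: "ennreal (d * real n powr x + d * real n powr y)
      \<le> ennreal (d * real n powr x * log 2 (real n + 1) powr (1 - e) + d * real n powr y * log 2 (real n + 1) powr (1 / 2))"
    if "n \<ge> 1" for n x y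
  proof -
    have "log 2 2 \<le> log 2 (real n + 1)" using that by (subst log_le_cancel_iff) auto
    then have l: "1 \<le> log 2 (real n + 1) powr z" if "0 \<le> z" for z using that by (intro ge_one_powr_ge_zero) auto
    have "a \<le> a * log 2 (real n + 1) powr z" if "0 \<le> a" "0 \<le> z" for a z
      using mult_left_mono[OF l[OF that(2)] that(1)] by simp
    then show ?thesis using d e by (intro ennreal_leI add_mono) auto
  qed
  have det: "e_det F S \<Lambda> n \<le> e_det_non F S \<Lambda> n" for F S \<Lambda> n
    unfolding e_det_def e_det_non_def by (rule INF_superset_mono) auto
  show ?thesis
    unfolding e_def[symmetric] exps
  proof (rule exI[of _ c], rule exI[of _ d], rule exI[of _ c], rule exI[of _ d], rule exI[of _ c],
      rule exI[of _ d], rule exI[of _ n\<^sub>0], intro conjI c d n\<^sub>0 allI impI)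
    fix n assume n: "n\<^sub>0 \<le> n"
    then have n1: "1 \<le> n" using n\<^sub>0 by simp
    show "e_ran (X_ball (ereal p) u p\<^sub>1 :: ('a levels) set) (I_op \<alpha>) std_info n
      \<le> ennreal (d * real n powr ((- \<alpha> + 1 / p + e - 2) / 2) * log 2 (real n + 1) powr (1 - e)
                 + d * real n powr ((- \<alpha> - 1) / 2) * log 2 (real n + 1) powr (1 / 2))"
      using upper n log[OF n1] order_trans by blast
  qed (use lower upper n\<^sub>0 det in auto)
qed

theorem proposition5p2:
  fixes p \<alpha> :: real and u p\<^sub>1 :: ereal
  assumes "1 \<le> p" and "p < 2" and "2 < u" and "1 \<le> p\<^sub>1" and "1 < \<alpha>"
  shows
    "(\<exists>c\<^sub>1 c\<^sub>2 c\<^sub>3 c\<^sub>4 c\<^sub>5 c\<^sub>6 :: real. \<exists>n\<^sub>0 :: nat.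
       c\<^sub>1 > 0 \<and> c\<^sub>2 > 0 \<and> c\<^sub>3 > 0 \<and> c\<^sub>4 > 0 \<and> c\<^sub>5 > 0 \<and> c\<^sub>6 > 0 \<and> n\<^sub>0 \<ge> 1 \<and>
       (\<forall>n\<ge>n\<^sub>0.
          ennreal (c\<^sub>1 * real n powr (- \<alpha> / 2 + 1 / (2 * p) + real_of_ereal (1 / u) / 2 - 1)
                   + c\<^sub>1 * real n powr (- \<alpha> / 2 - 1 / 2))
            \<le> e_ran (X_ball (ereal p) u p\<^sub>1 :: (nat \<Rightarrow> nat \<Rightarrow> nat \<Rightarrow> real) set) (I_op \<alpha>) std_info n \<and>
          e_ran (X_ball (ereal p) u p\<^sub>1 :: (nat \<Rightarrow> nat \<Rightarrow> nat \<Rightarrow> real) set) (I_op \<alpha>) std_info n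
            \<le> ennreal (c\<^sub>2 * real n powr (- \<alpha> / 2 + 1 / (2 * p) + real_of_ereal (1 / u) / 2 - 1)
                          * log 2 (real n + 1) powr (1 - real_of_ereal (1 / u))
                       + c\<^sub>2 * real n powr (- \<alpha> / 2 - 1 / 2) * log 2 (real n + 1) powr (1 / 2)) \<and>
          ennreal (c\<^sub>3 * real n powr (- \<alpha> / 2 + 1 / (2 * p) - 3 / 4))
            \<le> e_ran_non (X_ball (ereal p) u p\<^sub>1 :: (nat \<Rightarrow> nat \<Rightarrow> nat \<Rightarrow> real) set) (I_op \<alpha>) std_info n \<and>
          e_ran_non (X_ball (ereal p) u p\<^sub>1 :: (nat \<Rightarrow> nat \<Rightarrow> nat \<Rightarrow> real) set) (I_op \<alpha>) std_info n
            \<le> ennreal (c\<^sub>4 * real n powr (- \<alpha> / 2 + 1 / (2 * p) - 3 / 4)) \<and>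
          ennreal (c\<^sub>5 * real n powr (- \<alpha> / 2))
            \<le> e_det (X_ball (ereal p) u p\<^sub>1 :: (nat \<Rightarrow> nat \<Rightarrow> nat \<Rightarrow> real) set) (I_op \<alpha>) std_info n \<and>
          e_det (X_ball (ereal p) u p\<^sub>1 :: (nat \<Rightarrow> nat \<Rightarrow> nat \<Rightarrow> real) set) (I_op \<alpha>) std_info n
            \<le> e_det_non (X_ball (ereal p) u p\<^sub>1 :: (nat \<Rightarrow> nat \<Rightarrow> nat \<Rightarrow> real) set) (I_op \<alpha>) std_info n \<and>
          e_det_non (X_ball (ereal p) u p\<^sub>1 :: (nat \<Rightarrow> nat \<Rightarrow> nat \<Rightarrow> real) set) (I_op \<alpha>) std_info n
            \<le> ennreal (c\<^sub>6 * real n powr (- \<alpha> / 2))))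
     \<and>
     (\<exists>c\<^sub>1 c\<^sub>2 c\<^sub>3 c\<^sub>4 c\<^sub>5 c\<^sub>6 :: real. \<exists>n\<^sub>0 :: nat.
       c\<^sub>1 > 0 \<and> c\<^sub>2 > 0 \<and> c\<^sub>3 > 0 \<and> c\<^sub>4 > 0 \<and> c\<^sub>5 > 0 \<and> c\<^sub>6 > 0 \<and> n\<^sub>0 \<ge> 1 \<and>
       (\<forall>n\<ge>n\<^sub>0.
          ennreal (c\<^sub>1 * real n powr (- \<alpha> / 2 + 1 / (2 * p) + real_of_ereal (1 / u) / 2 - 1)
                   + c\<^sub>1 * real n powr (- \<alpha> / 2 - 1 / 2))
            \<le> e_ran (X_ball (ereal p) u p\<^sub>1 :: (nat \<Rightarrow> nat \<Rightarrow> nat \<Rightarrow> complex) set) (I_op \<alpha>) std_info n \<and>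
          e_ran (X_ball (ereal p) u p\<^sub>1 :: (nat \<Rightarrow> nat \<Rightarrow> nat \<Rightarrow> complex) set) (I_op \<alpha>) std_info n
            \<le> ennreal (c\<^sub>2 * real n powr (- \<alpha> / 2 + 1 / (2 * p) + real_of_ereal (1 / u) / 2 - 1)
                          * log 2 (real n + 1) powr (1 - real_of_ereal (1 / u))
                       + c\<^sub>2 * real n powr (- \<alpha> / 2 - 1 / 2) * log 2 (real n + 1) powr (1 / 2)) \<and>
          ennreal (c\<^sub>3 * real n powr (- \<alpha> / 2 + 1 / (2 * p) - 3 / 4))
            \<le> e_ran_non (X_ball (ereal p) u p\<^sub>1 :: (nat \<Rightarrow> nat \<Rightarrow> nat \<Rightarrow> complex) set) (I_op \<alpha>) std_info n \<and>
          e_ran_non (X_ball (ereal p) u p\<^sub>1 :: (nat \<Rightarrow> nat \<Rightarrow> nat \<Rightarrow> complex) set) (I_op \<alpha>) std_info n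
            \<le> ennreal (c\<^sub>4 * real n powr (- \<alpha> / 2 + 1 / (2 * p) - 3 / 4)) \<and>
          ennreal (c\<^sub>5 * real n powr (- \<alpha> / 2))
            \<le> e_det (X_ball (ereal p) u p\<^sub>1 :: (nat \<Rightarrow> nat \<Rightarrow> nat \<Rightarrow> complex) set) (I_op \<alpha>) std_info n \<and>
          e_det (X_ball (ereal p) u p\<^sub>1 :: (nat \<Rightarrow> nat \<Rightarrow> nat \<Rightarrow> complex) set) (I_op \<alpha>) std_info n
            \<le> e_det_non (X_ball (ereal p) u p\<^sub>1 :: (nat \<Rightarrow> nat \<Rightarrow> nat \<Rightarrow> complex) set) (I_op \<alpha>) std_info n \<and>
          e_det_non (X_ball (ereal p) u p\<^sub>1 :: (nat \<Rightarrow> nat \<Rightarrow> nat \<Rightarrow> complex) set) (I_op \<alpha>) std_info n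
            \<le> ennreal (c\<^sub>6 * real n powr (- \<alpha> / 2))))"
  by (intro conjI minimal_errors assms)

end
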